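(* Let $f^\pm(x,y)=\sum_{i+j=0}^2 a^\pm_{i,j}x^iy^j$ and $g^\pm(x,y)=\sum_{i+j=0}^2 b^\pm_{i,j}x^iy^j$ be real polynomials of degree at most $2$. For each of the two cases $S_1$, $S_2$ (with the corresponding $k$, $H$, $\Gamma_h^\pm$ given in the context), consider the Abelian integral $$M(h)=\int_{\Gamma^+_h}x^{-k-1}\big[g^+(x,y)\,dx-f^+(x,y)\,dy\big]+\int_{\Gamma^-_h}x^{-k-1}\big[g^-(x,y)\,dx-f^-(x,y)\,dy\big].$$ (1) For $S_1$, and for each of the two intervals $L=(-\infty,-1)$ and $L=(0,+\infty)$ separately: for every choice of the coefficients for which $M$ is not identically zero on $L$, $M$ has at most $5$ zeros in $L$ counted with multiplicity, and there is a choice of the coefficients for which $M$ has exactly $5$ zeros in $L$ counted with multiplicity. (2) For $S_2$: for every choice of the coefficients for which $M$ is not identically zero on $(0,1)$, $M$ has at most $6$ zeros in $(0,1)$ counted with multiplicity, and there is a choice of the coefficients for which $M$ has exactly $6$ zeros in $(0,1)$ counted with multiplicity.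
   Context: $S_1$: system $\dot x=\sqrt2\,xy,\ \dot y=\tfrac{\sqrt2}{4}(1-x^2+2y^2)$, with first integral $H(x,y)=x^{-1}\big(\tfrac12y^2+\tfrac14x^2-\tfrac12x+\tfrac14\big)$ and $k=1$. The level curves $\{H=h\}$ with $h\in(0,+\infty)$ are closed orbits around the center $(1,0)$ in $x>0$, and those with $h\in(-\infty,-1)$ are closed orbits around the center $(-1,0)$ in $x<0$. $S_2$: system $\dot x=\tfrac{\sqrt2}{2}xy,\ \dot y=\tfrac{\sqrt2}{2}(2-2x+y^2)$, with first integral $H(x,y)=x^{-2}\big(\tfrac12y^2+x^2-2x+1\big)$ and $k=2$. The level curves $\{H=h\}$ with $h\in(0,1)$ are closed orbits around the center $(1,0)$ in $x>0$. For such $h$, $\Gamma_h^+=\{(x,y): H(x,y)=h,\ y>0\}$ and $\Gamma_h^-=\{(x,y): H(x,y)=h,\ y<0\}$ are the upper and lower arcs of the closed orbit $\{H=h\}$, both oriented by the flow of the stated system. The sums $\sum_{i+j=0}^2$ run over integers $i,j\ge0$ with $i+j\le 2$. The coefficients $a^\pm_{i,j},b^\pm_{i,j}$ are arbitrary real numbers. *)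

theory Defs
  imports "HOL-Analysis.Analysis" "HOL-Library.Extended_Nat"
begin

section \<open>Line integrals along arcs oriented by a planar vector field\<close>

text \<open>
  A regular parametrisation of the open arc \<open>\<Gamma>\<close>: the endpoints of the path are excluded from
  \<open>\<Gamma>\<close> (for the arcs used below they lie on the axis \<open>y = 0\<close>). The orientation is that of the flow of
  the vector field \<open>X\<close>: the velocity is a positive multiple of \<open>X\<close>. The velocity is not required to
  equal \<open>X\<close>, since a line integral depends only on the oriented arc.
\<close>

definition flow_parametrization ::
  "(real \<times> real \<Rightarrow> real \<times> real) \<Rightarrow> (real \<times> real) set \<Rightarrow> (real \<Rightarrow> real \<times> real) \<Rightarrow> bool" where
  "flow_parametrization X \<Gamma> \<gamma> \<longleftrightarrow>
     arc \<gamma> \<and> \<gamma> C1_differentiable_on {0..1} \<and> \<gamma> ` {0<..<1} = \<Gamma> \<and>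
     (\<forall>t\<in>{0<..<1}. \<exists>c>0. vector_derivative \<gamma> (at t) = c *\<^sub>R X (\<gamma> t))"

definition path_line_integral ::
  "(real \<Rightarrow> real \<times> real) \<Rightarrow> (real \<times> real \<Rightarrow> real) \<Rightarrow> (real \<times> real \<Rightarrow> real) \<Rightarrow> real" where
  "path_line_integral \<gamma> P Q =
     integral {0..1} (\<lambda>t. P (\<gamma> t) * fst (vector_derivative \<gamma> (at t))
                        + Q (\<gamma> t) * snd (vector_derivative \<gamma> (at t)))"

text \<open>
  The integral of \<open>P dx + Q dy\<close> over the arc \<open>\<Gamma>\<close> oriented by the flow of \<open>X\<close>; for continuous
  \<open>P\<close>, \<open>Q\<close> and the arcs used below it does not depend on the chosen parametrisation.
\<close>

definition arc_line_integral ::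
  "(real \<times> real \<Rightarrow> real \<times> real) \<Rightarrow> (real \<times> real) set \<Rightarrow>
   (real \<times> real \<Rightarrow> real) \<Rightarrow> (real \<times> real \<Rightarrow> real) \<Rightarrow> real" where
  "arc_line_integral X \<Gamma> P Q = path_line_integral (SOME \<gamma>. flow_parametrization X \<Gamma> \<gamma>) P Q"


section \<open>The Abelian integral\<close>

definition quad_poly :: "(nat \<Rightarrow> nat \<Rightarrow> real) \<Rightarrow> real \<times> real \<Rightarrow> real" where
  "quad_poly a = (\<lambda>(x, y). \<Sum>i\<le>2. \<Sum>j\<le>2 - i. a i j * x ^ i * y ^ j)"

text \<open>The first integrals have a pole at \<open>x = 0\<close>, where HOL division would return \<open>0\<close>.\<close>

definition upper_arc :: "(real \<times> real \<Rightarrow> real) \<Rightarrow> real \<Rightarrow> (real \<times> real) set" where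
  "upper_arc H h = {(x, y). x \<noteq> 0 \<and> H (x, y) = h \<and> y > 0}"

definition lower_arc :: "(real \<times> real \<Rightarrow> real) \<Rightarrow> real \<Rightarrow> (real \<times> real) set" where
  "lower_arc H h = {(x, y). x \<noteq> 0 \<and> H (x, y) = h \<and> y < 0}"

definition abelian_integral ::
  "(real \<times> real \<Rightarrow> real \<times> real) \<Rightarrow> (real \<times> real \<Rightarrow> real) \<Rightarrow> int \<Rightarrow>
   (nat \<Rightarrow> nat \<Rightarrow> real) \<Rightarrow> (nat \<Rightarrow> nat \<Rightarrow> real) \<Rightarrow>
   (nat \<Rightarrow> nat \<Rightarrow> real) \<Rightarrow> (nat \<Rightarrow> nat \<Rightarrow> real) \<Rightarrow> real \<Rightarrow> real" where
  "abelian_integral X H k ap bp am bm h =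
     arc_line_integral X (upper_arc H h)
       (\<lambda>p. fst p powi (- k - 1) * quad_poly bp p)
       (\<lambda>p. - (fst p powi (- k - 1) * quad_poly ap p)) +
     arc_line_integral X (lower_arc H h)
       (\<lambda>p. fst p powi (- k - 1) * quad_poly bm p)
       (\<lambda>p. - (fst p powi (- k - 1) * quad_poly am p))"

definition S1_field :: "real \<times> real \<Rightarrow> real \<times> real" where
  "S1_field = (\<lambda>(x, y). (sqrt 2 * x * y, sqrt 2 / 4 * (1 - x\<^sup>2 + 2 * y\<^sup>2)))"

definition S1_H :: "real \<times> real \<Rightarrow> real" where
  "S1_H = (\<lambda>(x, y). (y\<^sup>2 / 2 + x\<^sup>2 / 4 - x / 2 + 1 / 4) / x)"

definition S2_field :: "real \<times> real \<Rightarrow> real \<times> real" where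
  "S2_field = (\<lambda>(x, y). (sqrt 2 / 2 * x * y, sqrt 2 / 2 * (2 - 2 * x + y\<^sup>2)))"

definition S2_H :: "real \<times> real \<Rightarrow> real" where
  "S2_H = (\<lambda>(x, y). (y\<^sup>2 / 2 + x\<^sup>2 - 2 * x + 1) / x\<^sup>2)"

definition M1 ::
  "(nat \<Rightarrow> nat \<Rightarrow> real) \<Rightarrow> (nat \<Rightarrow> nat \<Rightarrow> real) \<Rightarrow>
   (nat \<Rightarrow> nat \<Rightarrow> real) \<Rightarrow> (nat \<Rightarrow> nat \<Rightarrow> real) \<Rightarrow> real \<Rightarrow> real" where
  "M1 = abelian_integral S1_field S1_H 1"

definition M2 ::
  "(nat \<Rightarrow> nat \<Rightarrow> real) \<Rightarrow> (nat \<Rightarrow> nat \<Rightarrow> real) \<Rightarrow>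
   (nat \<Rightarrow> nat \<Rightarrow> real) \<Rightarrow> (nat \<Rightarrow> nat \<Rightarrow> real) \<Rightarrow> real \<Rightarrow> real" where
  "M2 = abelian_integral S2_field S2_H 2"


section \<open>Zeros counted with multiplicity\<close>

text \<open>
  \<open>f\<close> vanishes at \<open>t\<close> to order exactly \<open>m\<close>. The differentiability clause prevents the arbitrary
  value of \<^const>\<open>deriv\<close> at a point of non-differentiability from entering the count.
\<close>

definition vanishes_to_order :: "(real \<Rightarrow> real) \<Rightarrow> real \<Rightarrow> nat \<Rightarrow> bool" where
  "vanishes_to_order f t m \<longleftrightarrow>
     (\<forall>j<m. (deriv ^^ j) f t = 0 \<and> (deriv ^^ j) f field_differentiable (at t)) \<and>
     (deriv ^^ m) f t \<noteq> 0"

definition zero_multiplicity :: "(real \<Rightarrow> real) \<Rightarrow> real \<Rightarrow> enat" where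
  "zero_multiplicity f t =
     (if \<exists>m. vanishes_to_order f t m then enat (THE m. vanishes_to_order f t m) else \<infinity>)"

definition zeros_with_multiplicity :: "(real \<Rightarrow> real) \<Rightarrow> real set \<Rightarrow> enat" where
  "zeros_with_multiplicity f L =
     (if finite {t \<in> L. f t = 0} then (\<Sum>t | t \<in> L \<and> f t = 0. zero_multiplicity f t) else \<infinity>)"

end

theory Submission
  imports Defs
begin

text \<open>
  The arcs are half ellipses, symmetric with respect to \<open>y = 0\<close>, and \<open>(x, y) \<mapsto> (x cosh s, 2 y)\<close> carries
  the arcs of the first system at \<open>h = (cosh s - 1) / 2\<close> to those of the second at \<open>h = tanh s ^ 2\<close>. After
  integrating the \<open>dy\<close> terms by parts, the moments of these arcs show that, as functions of \<open>s > 0\<close>, the Abelian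
  integrals range over the span of \<open>sinh s\<close>, \<open>sinh s cosh s\<close>, \<open>s\<close>, \<open>s cosh s\<close>, \<open>cosh s - 1\<close>,
  \<open>(cosh s - 1) ^ 2\<close> for the first system, and over that of \<open>t\<close>, \<open>t ^ 3\<close>, \<open>s\<close>, \<open>s t ^ 2\<close>, \<open>1 - q\<close>,
  \<open>1 - q ^ 2\<close>, \<open>1 - q ^ 3\<close> with \<open>t = tanh s\<close>, \<open>q = 1 / cosh s\<close> for the second. All these functions vanish at
  \<open>s = 0\<close>. Alternately differentiating and multiplying by nonvanishing factors, Rolle's theorem bounds the
  zeros of a nontrivial combination of all \<open>n + 1\<close> functions by \<open>n\<close>; the first differentiation loses no zero
  because of the additional one at \<open>s = 0\<close>. Conversely, some nontrivial combination vanishes at \<open>n\<close>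
  prescribed points. For the first system, the interval \<open>h < - 1\<close> is reduced to \<open>h > 0\<close> by the reflection in
  the \<open>y\<close>-axis.
\<close>


section \<open>Smooth functions and zeros counted with multiplicity\<close>

text \<open>The substitution comes from the first system: its level \<open>h\<close> reads
  \<open>y^2 = (2 (2 h + 1) x - x^2 - 1) / 2\<close>, and with \<open>2 h + 1 = cosh s\<close> the
  endpoints become \<open>exp (- s)\<close> and \<open>exp s\<close>. Even powers of
  \<open>y\<close> then integrate as Laurent polynomials in \<open>x\<close>, the logarithm being
  the source of the bare \<open>s\<close>; odd powers lead to arcsines and give
  \<open>sqrt 2 * pi\<close> times polynomials in \<open>cosh s\<close>. Both kinds survive because
  the two arcs carry independent coefficients: orientation and sign of \<open>y\<close> together
  turn the contributions into differences for one parity and into sums for the other. The integral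
  is defined through an arbitrarily selected parametrisation, so it has to be evaluated along every
  parametrisation, and separately one has to be exhibited. In the second system degree counting
  alone would give one zero too many: two differentiations lead to a polynomial of degree six in
  \<open>sinh s\<close>, and the absence of its linear term saves the zero.\<close>

definition smooth_upto :: "nat \<Rightarrow> (real \<Rightarrow> real) \<Rightarrow> real set \<Rightarrow> bool" where
  "smooth_upto n f S \<longleftrightarrow> (\<forall>j<n. \<forall>t\<in>S. (deriv ^^ j) f field_differentiable (at t))"

text \<open>Encoded by iterated \<open>deriv\<close> and \<open>field_differentiable\<close>, the
  data of \<open>vanishes_to_order\<close>, so that its differentiability clause is immediate for
  smooth functions.\<close>

definition smooth :: "(real \<Rightarrow> real) \<Rightarrow> real set \<Rightarrow> bool" where
  "smooth f S \<longleftrightarrow> (\<forall>n. smooth_upto n f S)"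

lemma higher_deriv_Suc: "(deriv ^^ Suc j) f = (deriv ^^ j) (deriv f)"
  by (simp add: funpow_swap1)

lemma higher_deriv_cong_open:
  assumes "open S" "\<And>x. x \<in> S \<Longrightarrow> f x = g x" "t \<in> S"
  shows "(deriv ^^ j) f t = (deriv ^^ j) g (t::real)"
  using assms(2,3)
proof (induction j arbitrary: f g t)
  case (Suc j)
  have "deriv f x = deriv g x" if "x \<in> S" for x
    using Suc.prems(1) assms(1) that by (intro deriv_cong_ev eventually_mono[OF eventually_nhds_in_open[of S]]) auto
  from Suc.IH[OF this Suc.prems(2)] show ?case
    by (simp only: higher_deriv_Suc)
qed simp

lemma smooth_upto_0 [simp]: "smooth_upto 0 f S"
  by (simp add: smooth_upto_def)

lemma smooth_upto_Suc:
  "smooth_upto (Suc n) f S \<longleftrightarrow> (\<forall>t\<in>S. f field_differentiable (at t)) \<and> smooth_upto n (deriv f) S"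
  unfolding smooth_upto_def
  by (auto simp: less_Suc_eq_0_disj higher_deriv_Suc simp del: funpow.simps(2))

lemma smooth_upto_mono: "smooth_upto n f S \<Longrightarrow> m \<le> n \<Longrightarrow> smooth_upto m f S"
  by (auto simp: smooth_upto_def)

lemma smooth_upto_SucD:
  assumes "smooth_upto (Suc n) f S"
  shows "smooth_upto n f S" "smooth_upto n (deriv f) S"
  using smooth_upto_mono[OF assms, of n] assms by (simp_all add: smooth_upto_Suc)

lemma smooth_upto_cong:
  assumes "open S" "\<And>x. x \<in> S \<Longrightarrow> f x = g x" "smooth_upto n f S"
  shows "smooth_upto n g S"
  unfolding smooth_upto_def
proof (intro allI impI ballI)
  fix j t assume j: "j < n" "t \<in> S"
  obtain D where D: "((deriv ^^ j) f has_field_derivative D) (at t)"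
    using assms(3) j unfolding smooth_upto_def field_differentiable_def by blast
  have "((deriv ^^ j) g has_field_derivative D) (at t)"
    by (rule has_field_derivative_transform_within_open[OF D assms(1) j(2)])
       (use assms higher_deriv_cong_open in blast)
  then show "(deriv ^^ j) g field_differentiable (at t)"
    unfolding field_differentiable_def by blast
qed

lemma smooth_upto_SucI:
  assumes "open S" "\<And>x. x \<in> S \<Longrightarrow> (f has_real_derivative f' x) (at x)" "smooth_upto n f' S"
  shows "smooth_upto (Suc n) f S"
  unfolding smooth_upto_Suc
proof
  show "\<forall>t\<in>S. f field_differentiable (at t)"
    using assms(2) unfolding field_differentiable_def by blast
  show "smooth_upto n (deriv f) S"
    by (rule smooth_upto_cong[OF assms(1) _ assms(3)]) (use assms(2) DERIV_imp_deriv in force)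
qed

lemma smooth_upto_has_deriv:
  "smooth_upto (Suc n) f S \<Longrightarrow> x \<in> S \<Longrightarrow> (f has_real_derivative deriv f x) (at x)"
  by (simp add: smooth_upto_Suc field_differentiable_derivI)

lemma smooth_upto_const: "smooth_upto n (\<lambda>x. c) S"
proof -
  \<comment> \<open>\<open>smooth_upto_SucI\<close> needs an open set; the whole line is one, and
    the claim restricts to any \<open>S\<close>. The value \<open>d\<close> varies because the
    induction passes to the zero function.\<close>
  have "smooth_upto n (\<lambda>x. d) UNIV" for d
    by (induction n arbitrary: d) (auto intro!: smooth_upto_SucI[where f' = "\<lambda>_. 0"])
  then show ?thesis unfolding smooth_upto_def by blast
qed

lemma smooth_upto_add:
  assumes "open S"
  shows "smooth_upto n f S \<Longrightarrow> smooth_upto n g S \<Longrightarrow> smooth_upto n (\<lambda>x. f x + g x) S"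
proof (induction n arbitrary: f g)
  case (Suc n)
  show ?case
    by (rule smooth_upto_SucI[OF assms, where f' = "\<lambda>x. deriv f x + deriv g x"])
       (use Suc in \<open>simp_all add: smooth_upto_Suc DERIV_add field_differentiable_derivI\<close>)
qed simp

lemma smooth_upto_mult:
  assumes "open S"
  shows "smooth_upto n f S \<Longrightarrow> smooth_upto n g S \<Longrightarrow> smooth_upto n (\<lambda>x. f x * g x) S"
proof (induction n arbitrary: f g)
  case (Suc n)
  have D: "((\<lambda>x. f x * g x) has_real_derivative deriv f x * g x + deriv g x * f x) (at x)" if "x \<in> S" for x
    using Suc.prems that by (intro DERIV_mult smooth_upto_has_deriv)
  show ?case
    by (intro smooth_upto_SucI[OF assms D] smooth_upto_add[OF assms] Suc.IH
      smooth_upto_SucD[OF Suc.prems(1)] smooth_upto_SucD[OF Suc.prems(2)])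
qed simp

text \<open>The derivative \<open>- (1/f) f' (1/f)\<close> contains the inverse of the same
  \<open>f\<close>, so the induction closes with \<open>f\<close> fixed.\<close>

lemma smooth_upto_inverse:
  assumes "open S" "\<And>x. x \<in> S \<Longrightarrow> f x \<noteq> 0"
  shows "smooth_upto n f S \<Longrightarrow> smooth_upto n (\<lambda>x. inverse (f x)) S"
proof (induction n)
  case (Suc n)
  have D: "((\<lambda>x. inverse (f x)) has_real_derivative (- 1) * (inverse (f x) * deriv f x * inverse (f x))) (at x)"
    if "x \<in> S" for x
    using DERIV_inverse'[OF smooth_upto_has_deriv[OF Suc.prems that] assms(2)[OF that]] by simp
  note c = smooth_upto_const[of n "- 1" S]
  show ?case
    by (rule smooth_upto_SucI[OF assms(1) D], assumption)
       (intro smooth_upto_mult[OF assms(1)] c Suc.IH smooth_upto_SucD[OF Suc.prems])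
qed simp

lemma smooth_upto_compose:
  assumes "open S" "open U" "\<And>x. x \<in> S \<Longrightarrow> g x \<in> U"
  shows "smooth_upto n f U \<Longrightarrow> smooth_upto n g S \<Longrightarrow> smooth_upto n (\<lambda>x. f (g x)) S"
proof (induction n arbitrary: f)
  case (Suc n)
  have D: "((\<lambda>x. f (g x)) has_real_derivative deriv f (g x) * deriv g x) (at x)" if "x \<in> S" for x
    using Suc.prems that assms(3) by (intro DERIV_chain2 smooth_upto_has_deriv)
  show ?case
    by (rule smooth_upto_SucI[OF assms(1) D], assumption)
       (rule smooth_upto_mult[OF assms(1) Suc.IH[OF smooth_upto_SucD(2)[OF Suc.prems(1)]
          smooth_upto_SucD(1)[OF Suc.prems(2)]] smooth_upto_SucD(2)[OF Suc.prems(2)]])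
qed simp

lemma smooth_cong: "open S \<Longrightarrow> (\<And>x. x \<in> S \<Longrightarrow> f x = g x) \<Longrightarrow> smooth f S \<Longrightarrow> smooth g S"
  unfolding smooth_def using smooth_upto_cong by blast

lemma smoothI:
  assumes "open S" "\<And>x. x \<in> S \<Longrightarrow> (f has_real_derivative f' x) (at x)" "smooth f' S"
  shows "smooth f S"
  unfolding smooth_def
proof
  fix n show "smooth_upto n f S"
    using smooth_upto_SucI[OF assms(1,2), of n] assms(3) smooth_upto_mono[of "Suc n" f S n]
    unfolding smooth_def by auto
qed

lemma smooth_has_deriv: "smooth f S \<Longrightarrow> x \<in> S \<Longrightarrow> (f has_real_derivative deriv f x) (at x)"
  unfolding smooth_def using smooth_upto_has_deriv by blast

lemma smooth_deriv: "smooth f S \<Longrightarrow> smooth (deriv f) S"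
  by (simp add: smooth_def) (metis smooth_upto_Suc)

lemma smooth_higher_deriv: "smooth f S \<Longrightarrow> t \<in> S \<Longrightarrow> (deriv ^^ j) f field_differentiable (at t)"
  unfolding smooth_def smooth_upto_def by blast

lemma smooth_const: "smooth (\<lambda>x. c) S"
  by (simp add: smooth_def smooth_upto_const)

lemma smooth_ident: "smooth (\<lambda>x. x) S"
proof -
  have "smooth (\<lambda>x. x) UNIV"
    by (rule smoothI[where f' = "\<lambda>_. 1"]) (auto intro: smooth_const)
  then show ?thesis unfolding smooth_def smooth_upto_def by blast
qed

lemma smooth_add: "open S \<Longrightarrow> smooth f S \<Longrightarrow> smooth g S \<Longrightarrow> smooth (\<lambda>x. f x + g x) S"
  and smooth_mult: "open S \<Longrightarrow> smooth f S \<Longrightarrow> smooth g S \<Longrightarrow> smooth (\<lambda>x. f x * g x) S"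
  unfolding smooth_def by (auto intro: smooth_upto_add smooth_upto_mult)

lemma smooth_inverse:
  "open S \<Longrightarrow> smooth f S \<Longrightarrow> (\<And>x. x \<in> S \<Longrightarrow> f x \<noteq> 0) \<Longrightarrow> smooth (\<lambda>x. inverse (f x)) S"
  unfolding smooth_def by (auto intro: smooth_upto_inverse)

lemma smooth_compose:
  "open S \<Longrightarrow> open U \<Longrightarrow> smooth f U \<Longrightarrow> smooth g S \<Longrightarrow> (\<And>x. x \<in> S \<Longrightarrow> g x \<in> U) \<Longrightarrow>
   smooth (\<lambda>x. f (g x)) S"
  unfolding smooth_def by (intro allI, rule smooth_upto_compose[of S U]) simp_all

lemma smooth_minus: "open S \<Longrightarrow> smooth f S \<Longrightarrow> smooth (\<lambda>x. - f x) S"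
  using smooth_mult[of S "\<lambda>_. - 1" f] smooth_const by auto

lemma smooth_diff: "open S \<Longrightarrow> smooth f S \<Longrightarrow> smooth g S \<Longrightarrow> smooth (\<lambda>x. f x - g x) S"
  using smooth_add[of S f "\<lambda>x. - g x"] smooth_minus by auto

lemma smooth_divide:
  "open S \<Longrightarrow> smooth f S \<Longrightarrow> smooth g S \<Longrightarrow> (\<And>x. x \<in> S \<Longrightarrow> g x \<noteq> 0) \<Longrightarrow> smooth (\<lambda>x. f x / g x) S"
  unfolding divide_inverse by (intro smooth_mult smooth_inverse)

lemma smooth_power: "open S \<Longrightarrow> smooth f S \<Longrightarrow> smooth (\<lambda>x. f x ^ n) S"
  by (induction n) (auto intro: smooth_mult smooth_const)

lemma smooth_sum: "open S \<Longrightarrow> (\<And>i. i \<in> I \<Longrightarrow> smooth (f i) S) \<Longrightarrow> smooth (\<lambda>x. \<Sum>i\<in>I. f i x) S"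
  by (induction I rule: infinite_finite_induct) (auto intro: smooth_add smooth_const)

lemma smooth_sinh: "open S \<Longrightarrow> smooth sinh S" and smooth_cosh: "open S \<Longrightarrow> smooth cosh S"
proof -
  assume S: "open S"
  \<comment> \<open>Each of the two functions is the derivative of the other, so one induction
    treats both.\<close>
  have "smooth_upto n sinh S \<and> smooth_upto n cosh S" for n
    by (induction n) (auto intro!: smooth_upto_SucI[OF S, of sinh cosh] smooth_upto_SucI[OF S, of cosh sinh]
      derivative_eq_intros)
  then show "smooth sinh S" "smooth cosh S" unfolding smooth_def by auto
qed

text \<open>The derivative is half the inverse of \<open>sqrt\<close> itself, so order
  \<open>n\<close> yields order \<open>n + 1\<close>.\<close>

lemma smooth_sqrt: "smooth sqrt {0<..}"
proof -
  have "smooth_upto n sqrt {0<..}" for n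
  proof (induction n)
    case (Suc n)
    have "smooth_upto n (\<lambda>x. inverse (sqrt x) * inverse 2) {0<..}"
      by (rule smooth_upto_mult[OF _ smooth_upto_inverse[OF _ _ Suc] smooth_upto_const]) auto
    moreover have "(sqrt has_real_derivative inverse (sqrt x) * inverse 2) (at x)" if "x \<in> {0<..}" for x
      using that DERIV_real_sqrt[of x] by simp
    ultimately show ?case by (intro smooth_upto_SucI) auto
  qed simp
  then show ?thesis by (simp add: smooth_def)
qed

text \<open>Every partial count of zeros is bounded, with \<^term>\<open>m t\<close> a lower bound for the multiplicity
  of \<^term>\<open>t\<close>; this handles finite and infinite multiplicities uniformly.\<close>

definition zeros_le :: "real set \<Rightarrow> nat \<Rightarrow> (real \<Rightarrow> real) \<Rightarrow> bool" where
  "zeros_le S n f \<longleftrightarrow> (\<forall>T m. finite T \<longrightarrow> T \<subseteq> S \<longrightarrow> (\<forall>t\<in>T. \<forall>j<m t. (deriv ^^ j) f t = 0) \<longrightarrow> sum m T \<le> n)"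

lemma zeros_leD:
  assumes "zeros_le S n f" "finite T" "T \<subseteq> S"
    "\<And>t j. t \<in> T \<Longrightarrow> j < m t \<Longrightarrow> (deriv ^^ j) f t = 0"
  shows "sum m T \<le> n"
  using assms unfolding zeros_le_def by blast

lemma zeros_le_cong:
  assumes "open S" "\<And>x. x \<in> S \<Longrightarrow> f x = g x" "zeros_le S n f"
  shows "zeros_le S n g"
  unfolding zeros_le_def
proof (intro allI impI)
  fix T m assume T: "finite T" "T \<subseteq> S" "\<forall>t\<in>T. \<forall>j<m t. (deriv ^^ j) g t = 0"
  have "\<forall>t\<in>T. \<forall>j<m t. (deriv ^^ j) f t = 0"
    using T higher_deriv_cong_open[of S f g] assms(1,2) by (auto simp: subset_iff)
  then show "sum m T \<le> n" by (intro zeros_leD[OF assms(3) T(1,2)]) blast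
qed

lemma zeros_le_nonzero:
  assumes "\<And>x. x \<in> S \<Longrightarrow> f x \<noteq> 0"
  shows "zeros_le S n f"
  unfolding zeros_le_def
proof (intro allI impI)
  fix T m assume T: "finite T" "T \<subseteq> S" "\<forall>t\<in>T. \<forall>j<m t. (deriv ^^ j) f t = 0"
  have "m t = 0" if "t \<in> T" for t
    using T(3)[rule_format, OF that, of 0] assms T(2) that by auto
  then show "sum m T \<le> n" by simp
qed

section \<open>Orders of vanishing of sums, products and compositions\<close>

lemma higher_deriv_add:
  assumes "open S"
  shows "smooth f S \<Longrightarrow> smooth g S \<Longrightarrow> t \<in> S \<Longrightarrow>
    (deriv ^^ j) (\<lambda>x. f x + g x) t = (deriv ^^ j) f t + (deriv ^^ j) g t"
proof (induction j arbitrary: f g)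
  case (Suc j)
  have "deriv (\<lambda>x. f x + g x) x = deriv f x + deriv g x" if "x \<in> S" for x
    by (intro DERIV_imp_deriv DERIV_add smooth_has_deriv[OF Suc.prems(1) that] smooth_has_deriv[OF Suc.prems(2) that])
  then have "(deriv ^^ j) (deriv (\<lambda>x. f x + g x)) t = (deriv ^^ j) (\<lambda>x. deriv f x + deriv g x) t"
    by (rule higher_deriv_cong_open[OF assms _ Suc.prems(3)])
  with Suc.IH[OF smooth_deriv[OF Suc.prems(1)] smooth_deriv[OF Suc.prems(2)] Suc.prems(3)]
  show ?case by (simp only: higher_deriv_Suc)
qed simp

text \<open>Leibniz's formula is avoided: in \<open>f' g + f g'\<close> the factor \<open>f'\<close>
  vanishes to one order less and \<open>f\<close> to its old order, so induction on the order
  applies to both summands.\<close>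

lemma higher_deriv_mult_eq_0:
  assumes "open S"
  shows "smooth f S \<Longrightarrow> smooth g S \<Longrightarrow> t \<in> S \<Longrightarrow> \<forall>j<m. (deriv ^^ j) f t = 0 \<Longrightarrow> k < m \<Longrightarrow>
    (deriv ^^ k) (\<lambda>x. f x * g x) t = 0"
proof (induction m arbitrary: f g k)
  case (Suc m)
  show ?case
  proof (cases k)
    case 0
    then show ?thesis using Suc.prems(4)[rule_format, of 0] by simp
  next
    case (Suc i)
    note sm = Suc.prems(1,2)
    have f': "\<forall>j<m. (deriv ^^ j) (deriv f) t = 0" and f0: "\<forall>j<m. (deriv ^^ j) f t = 0"
      using Suc.prems(4) by (auto simp: higher_deriv_Suc[symmetric] simp del: funpow.simps)
    have "deriv (\<lambda>x. f x * g x) x = deriv f x * g x + f x * deriv g x" if "x \<in> S" for x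
      using DERIV_imp_deriv[OF DERIV_mult[OF smooth_has_deriv[OF sm(1) that] smooth_has_deriv[OF sm(2) that]]]
      by (simp add: mult.commute)
    then have "(deriv ^^ i) (deriv (\<lambda>x. f x * g x)) t = (deriv ^^ i) (\<lambda>x. deriv f x * g x + f x * deriv g x) t"
      by (rule higher_deriv_cong_open[OF assms _ Suc.prems(3)])
    also have "\<dots> = (deriv ^^ i) (\<lambda>x. deriv f x * g x) t + (deriv ^^ i) (\<lambda>x. f x * deriv g x) t"
      by (intro higher_deriv_add[OF assms] smooth_mult[OF assms] smooth_deriv sm Suc.prems(3))
    also have "\<dots> = 0"
      using Suc.IH[OF smooth_deriv[OF sm(1)] sm(2) Suc.prems(3) f', of i]
        Suc.IH[OF sm(1) smooth_deriv[OF sm(2)] Suc.prems(3) f0, of i] \<open>k < Suc m\<close> Suc by simp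
    finally show ?thesis by (simp only: Suc higher_deriv_Suc)
  qed
qed simp

text \<open>The same induction for the chain rule: \<open>f'\<close> composed with \<open>g\<close>
  vanishes to one order less, and the product lemma absorbs the factor \<open>g'\<close>.\<close>

lemma higher_deriv_compose_eq_0:
  assumes "open S" "open U" "smooth g S" "\<And>x. x \<in> S \<Longrightarrow> g x \<in> U" "t \<in> S"
  shows "smooth f U \<Longrightarrow> \<forall>j<m. (deriv ^^ j) f (g t) = 0 \<Longrightarrow> k < m \<Longrightarrow> (deriv ^^ k) (\<lambda>x. f (g x)) t = 0"
proof (induction m arbitrary: f k)
  case (Suc m)
  show ?case
  proof (cases k)
    case 0
    then show ?thesis using Suc.prems(2)[rule_format, of 0] by simp
  next
    case (Suc i)
    have f': "\<forall>j<m. (deriv ^^ j) (deriv f) (g t) = 0"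
      using Suc.prems(2) by (auto simp: higher_deriv_Suc[symmetric] simp del: funpow.simps)
    have "deriv (\<lambda>x. f (g x)) x = deriv f (g x) * deriv g x" if "x \<in> S" for x
      by (intro DERIV_imp_deriv DERIV_chain2[OF smooth_has_deriv[OF Suc.prems(1) assms(4)[OF that]]
        smooth_has_deriv[OF assms(3) that]])
    then have "(deriv ^^ i) (deriv (\<lambda>x. f (g x))) t = (deriv ^^ i) (\<lambda>x. deriv f (g x) * deriv g x) t"
      by (rule higher_deriv_cong_open[OF assms(1) _ assms(5)])
    also have "\<dots> = 0"
      by (rule higher_deriv_mult_eq_0[OF assms(1) smooth_compose[OF assms(1,2) smooth_deriv[OF Suc.prems(1)] assms(3,4)]
          smooth_deriv[OF assms(3)] assms(5), of m])
         (use Suc.IH[OF smooth_deriv[OF Suc.prems(1)] f'] \<open>k < Suc m\<close> Suc in auto)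
    finally show ?thesis by (simp only: Suc higher_deriv_Suc)
  qed
qed simp

text \<open>A smooth factor never lowers an order of vanishing, so every family of zeros of
  \<open>f\<close> is one of the product.\<close>

lemma zeros_le_mult:
  assumes "open S" "smooth f S" "smooth \<phi> S" "zeros_le S n (\<lambda>x. f x * \<phi> x)"
  shows "zeros_le S n f"
  unfolding zeros_le_def
proof (intro allI impI)
  fix T m assume T: "finite T" "T \<subseteq> S" "\<forall>t\<in>T. \<forall>j<m t. (deriv ^^ j) f t = 0"
  have "(deriv ^^ j) (\<lambda>x. f x * \<phi> x) t = 0" if "t \<in> T" "j < m t" for t j
    by (rule higher_deriv_mult_eq_0[OF assms(1-3) _ _ that(2)]) (use T that in auto)
  then show "sum m T \<le> n" by (rule zeros_leD[OF assms(4) T(1,2)])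
qed

text \<open>Change of variable: zeros are pulled back along the bijection, with orders that can only
  grow. This carries bounds from \<open>s\<close> to the energy \<open>h\<close>.\<close>

lemma zeros_le_compose:
  assumes "open S" "open U" "smooth g S" "bij_betw g S U" "smooth f U" "zeros_le S n (\<lambda>x. f (g x))"
  shows "zeros_le U n f"
  unfolding zeros_le_def
proof (intro allI impI)
  fix T m assume T: "finite T" "T \<subseteq> U" "\<forall>t\<in>T. \<forall>j<m t. (deriv ^^ j) f t = 0"
  have gU: "\<And>x. x \<in> S \<Longrightarrow> g x \<in> U" using assms(4) by (auto simp: bij_betw_def)
  define T' where "T' = {x \<in> S. g x \<in> T}"
  have b: "bij_betw g T' T"
    using assms(4) T(2) unfolding bij_betw_def T'_def inj_on_def by auto
  have "finite T'" using b T(1) bij_betw_finite by blast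
  have "T' \<subseteq> S" by (auto simp: T'_def)
  have "(deriv ^^ j) (\<lambda>x. f (g x)) t = 0" if "t \<in> T'" "j < m (g t)" for t j
    by (rule higher_deriv_compose_eq_0[OF assms(1-3) gU _ assms(5) _ that(2)]) (use T that in \<open>auto simp: T'_def\<close>)
  then have "(\<Sum>t\<in>T'. m (g t)) \<le> n"
    by (rule zeros_leD[OF assms(6) \<open>finite T'\<close> \<open>T' \<subseteq> S\<close>])
  then show "sum m T \<le> n" using sum.reindex_bij_betw[OF b, of m] by simp
qed

section \<open>Rolle's theorem with multiplicities\<close>

lemma rolle_points:
  fixes f f' :: "real \<Rightarrow> real"
  assumes "finite T" "T \<noteq> {}" "\<And>t. t \<in> T \<Longrightarrow> f t = 0" "continuous_on {Min T..Max T} f"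
    "\<And>x. Min T < x \<Longrightarrow> x < Max T \<Longrightarrow> (f has_real_derivative f' x) (at x)"
  shows "\<exists>U. finite U \<and> U \<inter> T = {} \<and> Suc (card U) = card T \<and> U \<subseteq> {Min T<..<Max T} \<and> (\<forall>u\<in>U. f' u = 0)"
  using assms
\<comment> \<open>A new maximum \<open>b\<close> creates one new gap, between the old maximum and
  \<open>b\<close>; its Rolle point lies strictly inside, hence beyond all earlier points.\<close>
proof (induction T rule: finite_linorder_max_induct)
  case (insert b A)
  show ?case
  proof (cases "A = {}")
    case True
    then show ?thesis by (intro exI[of _ "{}"]) auto
  next
    case False
    define a where "a = Max A"
    have aA: "a \<in> A" and ab: "a < b" using False insert.hyps a_def by auto
    have mn: "Min (insert b A) = Min A" "Max (insert b A) = b"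
    proof -
      have "Min A \<le> b" using Min_le[OF insert.hyps(1) aA] ab by linarith
      then show "Min (insert b A) = Min A" using insert.hyps False by simp
      show "Max (insert b A) = b" using insert.hyps False ab by (simp add: a_def)
    qed
    have le: "Min A \<le> a" using aA insert.hyps by simp
    have "continuous_on {Min A..Max A} f"
      using insert.prems(3) ab unfolding mn a_def[symmetric] by (auto intro: continuous_on_subset)
    then obtain U where U: "finite U" "U \<inter> A = {}" "Suc (card U) = card A" "U \<subseteq> {Min A<..<a}" "\<forall>u\<in>U. f' u = 0"
      using insert.IH[OF False] insert.prems(2,4) ab unfolding mn a_def[symmetric] by force
    have "\<exists>z>a. z < b \<and> (*) (f' z) = (\<lambda>v. 0)"
    proof (rule Rolle_deriv[OF ab])
      show "f a = f b" using insert.prems aA by simp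
      show "continuous_on {a..b} f" 
        using insert.prems(3) le unfolding mn by (auto intro: continuous_on_subset)
      show "(f has_derivative (*) (f' x)) (at x)" if "a < x" "x < b" for x
        using insert.prems(4)[of x] that le unfolding mn by (simp add: has_field_derivative_def)
    qed
    \<comment> \<open>\<open>Rolle_deriv\<close> yields the vanishing of a linear map; evaluating it
      at 1 gives \<open>f' z = 0\<close>.\<close>
    then obtain z where z: "a < z" "z < b" "f' z = 0" by (metis mult.right_neutral)
    have "z \<notin> A" "z \<notin> U" using z U a_def insert.hyps by (auto simp: not_less dest: Max_ge)
    moreover have "b \<notin> U" "b \<notin> A" using U ab insert.hyps by auto
    ultimately show ?thesis
      using U z insert.hyps le ab unfolding mn by (intro exI[of _ "insert z U"]) auto
  qed
qed simp

text \<open>Effect of one differentiation: multiplicities in \<open>T\<close> drop by one, and each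
  Rolle point in \<open>U\<close> enters with multiplicity one. Adding \<open>card T\<close> on the
  right replaces a truncated subtraction.\<close>

lemma sum_drop_one_multiplicity:
  assumes "finite T" "finite U" "U \<inter> T = {}" "\<And>t. t \<in> T \<Longrightarrow> 1 \<le> m t"
  shows "sum m T + card U = (\<Sum>t\<in>T \<union> U. if t \<in> U then 1 else m t - 1) + card T"
proof -
  have "(\<Sum>t\<in>T \<union> U. if t \<in> U then 1 else m t - 1) = (\<Sum>t\<in>T. m t - 1) + card U"
    using assms(1-3) by (subst sum.union_disjoint) (auto intro!: sum.cong)
  moreover have "sum m T = (\<Sum>t\<in>T. (m t - 1) + 1)"
    by (intro sum.cong refl) (use assms(4) le_add_diff_inverse2 in \<open>metis\<close>)
  then have "sum m T = (\<Sum>t\<in>T. m t - 1) + card T"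
    by (simp only: sum.distrib card_eq_sum)
  ultimately show ?thesis by simp
qed

text \<open>Common core of the two Rolle estimates. If \<open>card U + 1 = card T\<close>, as
  between the zeros alone, one zero is lost; if \<open>card U = card T\<close>, as with an extra
  zero at the endpoint, none is.\<close>

lemma zeros_le_deriv_aux:
  assumes "zeros_le S n (deriv f)" "finite T" "T \<subseteq> S" "\<forall>t\<in>T. \<forall>j<m t. (deriv ^^ j) f t = 0"
    "\<And>t. t \<in> T \<Longrightarrow> 1 \<le> m t" "finite U" "U \<inter> T = {}" "U \<subseteq> S" "\<forall>u\<in>U. deriv f u = 0"
  shows "sum m T + card U \<le> n + card T"
proof -
  define m' where "m' t = (if t \<in> U then 1 else m t - 1)" for t
  have "\<forall>t\<in>T \<union> U. \<forall>j<m' t. (deriv ^^ j) (deriv f) t = 0"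
  proof (intro ballI allI impI)
    fix t j assume t: "t \<in> T \<union> U" "j < m' t"
    show "(deriv ^^ j) (deriv f) t = 0"
    proof (cases "t \<in> U")
      case True
      with t assms(9) show ?thesis by (simp add: m'_def)
    next
      case False
      with t have "t \<in> T" "Suc j < m t" by (auto simp: m'_def)
      with assms(4) show ?thesis by (metis higher_deriv_Suc)
    qed
  qed
  then have "sum m' (T \<union> U) \<le> n"
    using assms(2,3,6,8) by (intro zeros_leD[OF assms(1)]) auto
  with sum_drop_one_multiplicity[OF assms(2,6,7,5)] show ?thesis by (simp add: m'_def)
qed

text \<open>Points with \<open>m t = 0\<close> carry no condition and need not be zeros of
  \<open>f\<close>; removing them makes every point of \<open>T\<close> a zero, as Rolle's theorem
  requires.\<close>

lemma zeros_le_reduce: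
  assumes "\<And>T m. finite T \<Longrightarrow> T \<noteq> {} \<Longrightarrow> T \<subseteq> S \<Longrightarrow> \<forall>t\<in>T. \<forall>j<m t. (deriv ^^ j) f t = 0 \<Longrightarrow>
    (\<And>t. t \<in> T \<Longrightarrow> 1 \<le> m t) \<Longrightarrow> sum m T \<le> n"
  shows "zeros_le S n f"
  unfolding zeros_le_def
proof (intro allI impI)
  fix T m assume T: "finite T" "T \<subseteq> S" "\<forall>t\<in>T. \<forall>j<m t. (deriv ^^ j) f t = 0"
  define T' where "T' = {t \<in> T. m t \<noteq> 0}"
  have "sum m T = sum m T'"
    unfolding T'_def using T(1) by (intro sum.mono_neutral_right) auto
  also have "\<dots> \<le> n"
  proof (cases "T' = {}")
    case False
    then show ?thesis
      by (rule assms[rotated]) (use T in \<open>auto simp: T'_def\<close>)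
  qed simp
  finally show "sum m T \<le> n" .
qed

lemma zeros_le_Suc_deriv:
  assumes "smooth f {a<..}" "zeros_le {a<..} n (deriv f)"
  shows "zeros_le {a<..} (Suc n) f"
proof (rule zeros_le_reduce)
  fix T m assume T: "finite T" "T \<noteq> {}" "T \<subseteq> {a<..}" "\<forall>t\<in>T. \<forall>j<m t. (deriv ^^ j) f t = 0"
    "\<And>t. t \<in> T \<Longrightarrow> 1 \<le> m t"
  have z: "f t = 0" if "t \<in> T" for t
    using T(4)[rule_format, OF that, of 0] T(5)[OF that] by simp
  have mn: "Min T \<in> T" using T by simp
  have D: "(f has_real_derivative deriv f x) (at x)" if "Min T \<le> x" for x
    using that mn T(3) by (intro smooth_has_deriv[OF assms(1)]) auto
  have "continuous_on {Min T..Max T} f"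
    by (rule DERIV_continuous_on[where D = "deriv f"]) (auto intro: D has_field_derivative_at_within)
  from rolle_points[OF T(1,2) z this D]
  obtain U where U: "finite U" "U \<inter> T = {}" "Suc (card U) = card T" "U \<subseteq> {Min T<..<Max T}" "\<forall>u\<in>U. deriv f u = 0"
    by auto
  have "U \<subseteq> {a<..}" using U(4) mn T(3) by force
  from zeros_le_deriv_aux[OF assms(2) T(1,3-5) U(1,2) this U(5)] U(3)
  show "sum m T \<le> Suc n" by simp
qed

text \<open>The zero at the endpoint \<^term>\<open>a\<close>, which is not counted, makes up for the one lost in
  Rolle's theorem.\<close>

lemma zeros_le_deriv_endpoint:
  assumes "smooth f {a<..}" "continuous_on {a..} f" "f a = 0" "zeros_le {a<..} n (deriv f)"
  shows "zeros_le {a<..} n f"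
proof (rule zeros_le_reduce)
  fix T m assume T: "finite T" "T \<noteq> {}" "T \<subseteq> {a<..}" "\<forall>t\<in>T. \<forall>j<m t. (deriv ^^ j) f t = 0"
    "\<And>t. t \<in> T \<Longrightarrow> 1 \<le> m t"
  have z: "f t = 0" if "t \<in> insert a T" for t
    using T(4)[rule_format, of t 0] T(5)[of t] that assms(3) by auto
  have mn: "Min (insert a T) = a" 
    using T by (intro Min_eqI) auto
  have D: "(f has_real_derivative deriv f x) (at x)" if "a < x" for x
    using that by (intro smooth_has_deriv[OF assms(1)]) auto
  have "continuous_on {a..Max (insert a T)} f"
    by (rule continuous_on_subset[OF assms(2)]) auto
  then obtain U where U: "finite U" "U \<inter> insert a T = {}" "Suc (card U) = card (insert a T)"
      "U \<subseteq> {a<..<Max (insert a T)}" "\<forall>u\<in>U. deriv f u = 0"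
    using rolle_points[of "insert a T" f "deriv f", OF _ _ z] T(1) D unfolding mn by auto
  have "a \<notin> T" using T(3) by auto
  then have c: "card U = card T" using U(3) T(1) by simp
  have "U \<subseteq> {a<..}" "U \<inter> T = {}" using U by auto
  from zeros_le_deriv_aux[OF assms(4) T(1,3-5) U(1) this(2,1) U(5)] c
  show "sum m T \<le> n" by simp
qed

text \<open>Replaces \<open>deriv f\<close> by an explicit derivative times a factor: every zero of
  \<open>deriv f\<close> is a zero of \<open>g\<close> of at least the same order.\<close>

lemma zeros_le_deriv_cong:
  assumes "open S" "\<And>x. x \<in> S \<Longrightarrow> (f has_real_derivative f' x) (at x)"
    "smooth f S" "smooth \<phi> S" "\<And>x. x \<in> S \<Longrightarrow> f' x * \<phi> x = g x" "zeros_le S n g"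
  shows "zeros_le S n (deriv f)"
proof (rule zeros_le_mult[OF assms(1) smooth_deriv[OF assms(3)] assms(4)])
  show "zeros_le S n (\<lambda>x. deriv f x * \<phi> x)"
    by (rule zeros_le_cong[OF assms(1) _ assms(6)])
       (simp add: assms(5)[symmetric] DERIV_imp_deriv[OF assms(2)])
qed

section \<open>From partial counts to zeros counted with multiplicity\<close>

lemma zero_multiplicity_eq:
  assumes "vanishes_to_order f t m"
  shows "zero_multiplicity f t = enat m"
proof -
  have "k = m" if "vanishes_to_order f t k" for k
    using that assms unfolding vanishes_to_order_def by (cases k m rule: linorder_cases) auto
  with assms have "(THE k. vanishes_to_order f t k) = m"
    by (intro the_equality)
  with assms show ?thesis unfolding zero_multiplicity_def by auto
qed

text \<open>Two choices of \<open>m\<close> exclude the infinite values of the count: weight 1 at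
  \<open>n + 1\<close> points shows that there are finitely many zeros, weight \<open>n + 1\<close>
  at a single point that no zero has infinite order.\<close>

lemma zeros_with_multiplicity_le:
  assumes "smooth f S" "zeros_le S n f"
  shows "zeros_with_multiplicity f S \<le> enat n"
proof -
  define Z where "Z = {t \<in> S. f t = 0}"
  have cnt: "sum m T \<le> n" if "finite T" "T \<subseteq> S" "\<And>t j. t \<in> T \<Longrightarrow> j < m t \<Longrightarrow> (deriv ^^ j) f t = 0" for T m
    by (rule zeros_leD[OF assms(2) that])
  have fin: "finite Z"
  proof (rule ccontr)
    assume "infinite Z"
    then obtain T where "T \<subseteq> Z" "finite T" "card T = Suc n"
      using infinite_arbitrarily_large by blast
    with cnt[of T "\<lambda>_. 1"] show False by (auto simp: Z_def)
  qed
  have "\<exists>m. vanishes_to_order f t m" if "t \<in> Z" for t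
  proof -
    have "\<exists>j. (deriv ^^ j) f t \<noteq> 0"
    proof (rule ccontr)
      assume "\<nexists>j. (deriv ^^ j) f t \<noteq> 0"
      with cnt[of "{t}" "\<lambda>_. Suc n"] that show False by (auto simp: Z_def)
    qed
    then obtain m where m: "(deriv ^^ m) f t \<noteq> 0" "\<forall>j<m. (deriv ^^ j) f t = 0"
      using exists_least_iff[of "\<lambda>j. (deriv ^^ j) f t \<noteq> 0"] by auto
    have "(deriv ^^ j) f field_differentiable (at t)" for j
      using smooth_higher_deriv[OF assms(1)] that by (simp add: Z_def)
    with m have "vanishes_to_order f t m"
      by (simp add: vanishes_to_order_def)
    then show ?thesis ..
  qed
  then obtain m where m: "\<And>t. t \<in> Z \<Longrightarrow> vanishes_to_order f t (m t)" by metis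
  then have "zero_multiplicity f t = enat (m t)" if "t \<in> Z" for t
    using that by (intro zero_multiplicity_eq)
  then have "zeros_with_multiplicity f S = (\<Sum>t\<in>Z. enat (m t))"
    using fin unfolding zeros_with_multiplicity_def Z_def by simp
  also have "\<dots> = enat (sum m Z)"
    using fin by (induction Z rule: finite_induct) (auto simp: zero_enat_def)
  also have "\<dots> \<le> enat n"
    using cnt[of Z m] fin m by (auto simp: Z_def vanishes_to_order_def)
  finally show ?thesis .
qed

text \<open>A zero counts at least once, also when it has no order and its multiplicity is
  \<infinity>; with infinitely many zeros the whole count is \<infinity>.\<close>

lemma zeros_with_multiplicity_ge_card:
  assumes "finite T" "T \<subseteq> S" "\<And>t. t \<in> T \<Longrightarrow> f t = 0"
  shows "enat (card T) \<le> zeros_with_multiplicity f S"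
proof (cases "finite {t \<in> S. f t = 0}")
  case True
  have ge: "1 \<le> zero_multiplicity f t" if t: "f t = 0" for t
  proof (cases "\<exists>m. vanishes_to_order f t m")
    case True
    then obtain m where m: "vanishes_to_order f t m" ..
    moreover have "m \<noteq> 0" using m t by (cases m) (auto simp: vanishes_to_order_def)
    ultimately show ?thesis by (simp add: zero_multiplicity_eq one_enat_def)
  qed (simp add: zero_multiplicity_def)
  have "enat (card T) = (\<Sum>t\<in>T. 1)"
    by (simp add: of_nat_eq_enat)
  also have "\<dots> \<le> (\<Sum>t\<in>T. zero_multiplicity f t)"
    using assms ge by (intro sum_mono) auto
  also have "\<dots> \<le> (\<Sum>t | t \<in> S \<and> f t = 0. zero_multiplicity f t)"
    using assms True by (intro sum_mono2) auto
  finally show ?thesis using True by (simp add: zeros_with_multiplicity_def)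
qed (simp add: zeros_with_multiplicity_def)

text \<open>A homogeneous linear system with fewer equations than unknowns. A point \<open>t\<close>
  is eliminated by a pivot with \<open>v k t \<noteq> 0\<close>, multiples of which are subtracted
  from the other functions so that they all vanish at \<open>t\<close>.\<close>

lemma nontrivial_combination_vanishing:
  fixes v :: "nat \<Rightarrow> 'a \<Rightarrow> real"
  assumes "finite T" "card T < n"
  shows "\<exists>c. (\<exists>i<n. c i \<noteq> 0) \<and> (\<forall>t\<in>T. (\<Sum>i<n. c i * v i t) = 0)"
  using assms
proof (induction T arbitrary: n v rule: finite_induct)
  case empty
  then show ?case by (intro exI[of _ "\<lambda>_. 1"]) auto
next
  case (insert t T)
  show ?case
  proof (cases "\<forall>i<n. v i t = 0")
    case True
    obtain c where "\<exists>i<n. c i \<noteq> 0" "\<forall>t\<in>T. (\<Sum>i<n. c i * v i t) = 0"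
      using insert.IH[of n v] insert.prems insert.hyps by auto
    with True show ?thesis by (intro exI[of _ c]) auto
  next
    case False
    then obtain k where k: "k < n" "v k t \<noteq> 0" by blast
    \<comment> \<open>\<open>s\<close> enumerates the indices below \<open>n\<close> other than the
      pivot.\<close>
    define s where "s i = (if i < k then i else Suc i)" for i
    define w where "w i x = v (s i) x - v (s i) t / v k t * v k x" for i x
    obtain n' where n': "n = Suc n'" using k by (cases n) auto
    have "card T < n'" using insert n' by simp
    then obtain c where c: "\<exists>i<n'. c i \<noteq> 0" "\<forall>t\<in>T. (\<Sum>i<n'. c i * w i t) = 0"
      using insert.IH[of n' w] by blast
    have inj: "inj_on s {..<n'}" by (auto simp: inj_on_def s_def split: if_splits)
    have im: "s ` {..<n'} = {..<n} - {k}"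
    proof (intro equalityI subsetI)
      fix i assume "i \<in> {..<n} - {k}"
      then show "i \<in> s ` {..<n'}"
        using k n' by (intro image_eqI[of _ _ "if i < k then i else i - 1"]) (auto simp: s_def)
    qed (use k n' in \<open>auto simp: s_def split: if_splits\<close>)
    \<comment> \<open>The coefficient of the pivot: it collects the multiples of \<open>v k\<close>
      contained in the functions \<open>w i\<close>.\<close>
    define e where "e = - (\<Sum>i<n'. c i * v (s i) t / v k t)"
    define d where "d j = (if j = k then e else c (inv_into {..<n'} s j))" for j
    have ds: "d (s i) = c i" if "i < n'" for i
      using that inv_into_f_f[OF inj, of i] by (auto simp: d_def s_def)
    have sum: "(\<Sum>j<n. d j * v j x) = (\<Sum>i<n'. c i * w i x)" for x
    proof -
      have "(\<Sum>j<n. d j * v j x) = d k * v k x + (\<Sum>j\<in>{..<n} - {k}. d j * v j x)"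
        using k by (simp add: sum.remove)
      also have "(\<Sum>j\<in>{..<n} - {k}. d j * v j x) = (\<Sum>i<n'. c i * v (s i) x)"
        unfolding im[symmetric] using ds by (simp add: sum.reindex[OF inj])
      also have "d k * v k x = - (\<Sum>i<n'. c i * (v (s i) t / v k t * v k x))"
        by (simp add: d_def e_def sum_distrib_left mult_ac)
      finally show ?thesis by (simp add: w_def right_diff_distrib sum_subtractf)
    qed
    have "w i t = 0" for i using k by (simp add: w_def)
    then have "\<forall>x\<in>insert t T. (\<Sum>j<n. d j * v j x) = 0"
      using c(2) sum by simp
    moreover from c(1) obtain i where i: "i < n'" "c i \<noteq> 0" by blast
    have "s i < n" "d (s i) \<noteq> 0" using i ds n' by (auto simp: s_def)
    ultimately show ?thesis by (intro exI[of _ d]) auto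
  qed
qed


section \<open>Two Chebyshev systems of hyperbolic functions\<close>

lemmas smooth_intros = smooth_ident smooth_const smooth_add smooth_diff smooth_minus smooth_mult
  smooth_divide smooth_power smooth_sinh smooth_cosh

lemma times_one_div_cancel: "x * y = z \<Longrightarrow> y \<noteq> 0 \<Longrightarrow> z * (1 / y) = x" for x y z :: real
  by auto

lemma sinh_real_DERIV: "(sinh has_real_derivative cosh s) (at s)"
  and cosh_real_DERIV: "(cosh has_real_derivative sinh s) (at s)" for s :: real
  by (auto intro!: derivative_eq_intros)

lemma DERIV_cosh_div_sinh: "s \<noteq> 0 \<Longrightarrow> ((\<lambda>s. cosh s / sinh s) has_real_derivative
    (sinh s * sinh s - cosh s * cosh s) / (sinh s * sinh s)) (at s)"
  and DERIV_one_div_sinh: "s \<noteq> 0 \<Longrightarrow> ((\<lambda>s. 1 / sinh s) has_real_derivative - cosh s / (sinh s * sinh s)) (at s)"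
  and DERIV_one_div_cosh: "((\<lambda>s. 1 / cosh s) has_real_derivative - sinh s / (cosh s * cosh s)) (at s)"
  and DERIV_sinh_div_cosh: "((\<lambda>s. sinh s / cosh s) has_real_derivative
    (cosh s * cosh s - sinh s * sinh s) / (cosh s * cosh s)) (at s)" for s :: real
  by (auto intro!: derivative_eq_intros)

text \<open>One link of the chains below: \<open>g\<close> is the next stage, and
  \<open>\<phi>\<close> is chosen so that \<open>g\<close> has a constant summand for the following
  differentiation to remove.\<close>

lemma zeros_le_step:
  assumes "\<And>x. x > a \<Longrightarrow> (f has_real_derivative f' x) (at x)" "smooth f {a<..}" "smooth \<phi> {a<..}"
    "\<And>x. x > a \<Longrightarrow> f' x * \<phi> x = g x" "zeros_le {a<..} n g"
  shows "zeros_le {a<..} (Suc n) f"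
  by (rule zeros_le_Suc_deriv[OF assms(2) zeros_le_deriv_cong[OF _ _ assms(2,3) _ assms(5)]])
     (use assms in auto)

lemma zeros_le_step_endpoint:
  assumes "\<And>x. x > a \<Longrightarrow> (f has_real_derivative f' x) (at x)" "smooth f {a<..}" "smooth \<phi> {a<..}"
    "\<And>x. x > a \<Longrightarrow> f' x * \<phi> x = g x" "zeros_le {a<..} n g" "continuous_on {a..} f" "f a = 0"
  shows "zeros_le {a<..} n f"
  by (rule zeros_le_deriv_endpoint[OF assms(2,6,7) zeros_le_deriv_cong[OF _ _ assms(2,3) _ assms(5)]])
     (use assms in auto)

lemma zeros_le_const: "c \<noteq> 0 \<Longrightarrow> zeros_le S n (\<lambda>x. c)"
  by (rule zeros_le_nonzero) simp

section \<open>The chain of differentiations for the first system\<close>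

definition S1_comb :: "real \<Rightarrow> real \<Rightarrow> real \<Rightarrow> real \<Rightarrow> real \<Rightarrow> real \<Rightarrow> real \<Rightarrow> real" where
  "S1_comb a1 a2 a3 a4 a5 a6 s = a1 * sinh s + a2 * (cosh s * sinh s) + a3 * s + a4 * (s * cosh s)
     + a5 * (cosh s - 1) + a6 * (cosh s - 1)\<^sup>2"

text \<open>The stage number counts the differentiations of \<open>S1_comb\<close> already made; the
  chain is proved from its end. Only \<open>a2\<close> and \<open>a6\<close> are left here, and one
  more differentiation gives a multiple of the constant \<open>3 * a6\<close>.\<close>

lemma zeros_le_S1_stage_5:
  assumes "a2 \<noteq> 0 \<or> a6 \<noteq> 0"
  shows "zeros_le {0<..} 1 (\<lambda>s::real. 2 * a2 + a6 * (2 * cosh s / sinh s - cosh s / sinh s ^ 3))"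
proof (cases "a6 = 0")
  case True
  with assms show ?thesis by (simp add: zeros_le_const)
next
  case False
  show ?thesis unfolding One_nat_def
  proof (rule zeros_le_step[where g = "\<lambda>_. 3 * a6" and \<phi> = "\<lambda>s. sinh s ^ 4"
      and f' = "\<lambda>s. a6 * (3 / sinh s ^ 4)"])
    fix s :: real assume s: "s > 0"
    then have S: "sinh s \<noteq> 0" by simp
    have y: "cosh s * cosh s = sinh s * sinh s + 1"
      using cosh_square_eq[of s] by (simp add: power2_eq_square)
    have "2 * sinh s * sinh s - 2 * cosh s * cosh s = -2"
      using y by simp
    moreover have "sinh s * sinh s ^ 3 - cosh s * (3 * sinh s ^ 2 * cosh s) = - 2 * sinh s ^ 4 - 3 * sinh s ^ 2"
      using y by algebra
    \<comment> \<open>The terms in \<open>1 / sinh s ^ 2\<close> cancel between the two quotients;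
      only \<open>3 / sinh s ^ 4\<close> remains, whence the factor
      \<open>sinh s ^ 4\<close>.\<close>
    moreover have "3 / sinh s ^ 4 = - 2 / (sinh s * sinh s) - (- 2 * sinh s ^ 4 - 3 * sinh s ^ 2) / (sinh s ^ 3 * sinh s ^ 3)"
      using S by (simp add: field_simps eval_nat_numeral)
    ultimately have "a6 * (3 / sinh s ^ 4) = a6 * ((2 * sinh s * sinh s - 2 * cosh s * cosh s) / (sinh s * sinh s) -
      (sinh s * sinh s ^ 3 - cosh s * (3 * sinh s ^ 2 * cosh s)) / (sinh s ^ 3 * sinh s ^ 3))"
      by simp
    moreover have "((\<lambda>s::real. 2 * a2 + a6 * (2 * cosh s / sinh s - cosh s / sinh s ^ 3)) has_real_derivative
      a6 * ((2 * sinh s * sinh s - 2 * cosh s * cosh s) / (sinh s * sinh s) -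
      (sinh s * sinh s ^ 3 - cosh s * (3 * sinh s ^ 2 * cosh s)) / (sinh s ^ 3 * sinh s ^ 3))) (at s)"
    proof -
      have "((\<lambda>s. 2 * cosh s / sinh s) has_real_derivative
        (2 * sinh s * sinh s - 2 * cosh s * cosh s) / (sinh s * sinh s)) (at s)"
        using S by (auto intro!: derivative_eq_intros)
      moreover have "((\<lambda>s. cosh s / sinh s ^ 3) has_real_derivative
        (sinh s * sinh s ^ 3 - cosh s * (3 * sinh s ^ 2 * cosh s)) / (sinh s ^ 3 * sinh s ^ 3)) (at s)"
        using S by (auto intro!: derivative_eq_intros)
      ultimately have "((\<lambda>s::real. 2 * a2 + a6 * (2 * cosh s / sinh s - cosh s / sinh s ^ 3)) has_real_derivative
        0 + a6 * ((2 * sinh s * sinh s - 2 * cosh s * cosh s) / (sinh s * sinh s) -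
        (sinh s * sinh s ^ 3 - cosh s * (3 * sinh s ^ 2 * cosh s)) / (sinh s ^ 3 * sinh s ^ 3))) (at s)"
        by (intro DERIV_add DERIV_const DERIV_cmult DERIV_diff)
      then show ?thesis by simp
    qed
    ultimately show "((\<lambda>s::real. 2 * a2 + a6 * (2 * cosh s / sinh s - cosh s / sinh s ^ 3)) has_real_derivative
      a6 * (3 / sinh s ^ 4)) (at s)" by simp
  qed (use False in \<open>auto intro!: smooth_intros zeros_le_const\<close>)
qed

text \<open>Differentiation removes \<open>a4\<close>. If \<open>a2 = a6 = 0\<close> the function is
  the nonzero constant \<open>a4\<close> itself; every stage splits off such a case, in which the
  next stage would vanish identically.\<close>

lemma zeros_le_S1_stage_4:
  assumes "a2 \<noteq> 0 \<or> a4 \<noteq> 0 \<or> a6 \<noteq> 0"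
  shows "zeros_le {0<..} 2 (\<lambda>s::real. 6 * a2 * cosh s + a4 + 3 * a6 * (2 * sinh s + 1 / sinh s))"
proof (cases "a2 = 0 \<and> a6 = 0")
  case True
  with assms show ?thesis by (simp add: zeros_le_const)
next
  case False
  show ?thesis unfolding numeral_2_eq_2
  proof (rule zeros_le_step[where g = "\<lambda>s. 2 * a2 + a6 * (2 * cosh s / sinh s - cosh s / sinh s ^ 3)" and \<phi> = "\<lambda>s. 1 / (3 * sinh s)"
      and f' = "\<lambda>s. 6 * a2 * sinh s + 3 * a6 * (2 * cosh s - cosh s / sinh s ^ 2)"])
    fix s :: real assume s: "s > 0"
    then have S: "sinh s \<noteq> 0" by simp
    show "((\<lambda>s::real. 6 * a2 * cosh s + a4 + 3 * a6 * (2 * sinh s + 1 / sinh s)) has_real_derivative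
      6 * a2 * sinh s + 3 * a6 * (2 * cosh s - cosh s / sinh s ^ 2)) (at s)"
      using S by (auto intro!: derivative_eq_intros simp: power2_eq_square)
    show "(6 * a2 * sinh s + 3 * a6 * (2 * cosh s - cosh s / sinh s ^ 2)) * (1 / (3 * sinh s)) =
      2 * a2 + a6 * (2 * cosh s / sinh s - cosh s / sinh s ^ 3)"
      using S by (simp add: field_simps eval_nat_numeral)
  qed (use False zeros_le_S1_stage_5[of a2 a6] in \<open>auto intro!: smooth_intros\<close>)
qed

text \<open>The constant removed here is \<open>- 3 * a2 - a3\<close>; losing this mixture is
  harmless because \<open>a2\<close> persists in the next stage.\<close>

lemma zeros_le_S1_stage_3:
  assumes "a2 \<noteq> 0 \<or> a3 \<noteq> 0 \<or> a4 \<noteq> 0 \<or> a6 \<noteq> 0"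
  shows "zeros_le {0<..} 3 (\<lambda>s::real. a2 * (6 * cosh s ^ 2 - 3) - a3 + 2 * a4 * cosh s + 6 * a6 * (sinh s * cosh s))"
proof (cases "a2 = 0 \<and> a4 = 0 \<and> a6 = 0")
  case True
  with assms show ?thesis by (simp add: zeros_le_const)
next
  case False
  show ?thesis unfolding numeral_3_eq_3 numeral_2_eq_2[symmetric]
  proof (rule zeros_le_step[where g = "\<lambda>s. 6 * a2 * cosh s + a4 + 3 * a6 * (2 * sinh s + 1 / sinh s)" and \<phi> = "\<lambda>s. 1 / (2 * sinh s)"
      and f' = "\<lambda>s. 12 * a2 * cosh s * sinh s + 2 * a4 * sinh s + 6 * a6 * (sinh s ^ 2 + cosh s ^ 2)"])
    fix s :: real assume s: "s > 0"
    then have S: "sinh s \<noteq> 0" by simp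
    show "((\<lambda>s::real. a2 * (6 * cosh s ^ 2 - 3) - a3 + 2 * a4 * cosh s + 6 * a6 * (sinh s * cosh s)) has_real_derivative
      12 * a2 * cosh s * sinh s + 2 * a4 * sinh s + 6 * a6 * (sinh s ^ 2 + cosh s ^ 2)) (at s)"
      by (auto intro!: derivative_eq_intros simp: power2_eq_square algebra_simps)
    show "(12 * a2 * cosh s * sinh s + 2 * a4 * sinh s + 6 * a6 * (sinh s ^ 2 + cosh s ^ 2)) * (1 / (2 * sinh s)) =
      6 * a2 * cosh s + a4 + 3 * a6 * (2 * sinh s + 1 / sinh s)"
      using S by (simp add: field_simps cosh_square_eq) (simp add: algebra_simps eval_nat_numeral)
  qed (use False zeros_le_S1_stage_4[of a2 a4 a6] in \<open>auto intro!: smooth_intros\<close>)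
qed

text \<open>Multiplication by \<open>sinh s ^ 2\<close> has turned the derivative of
  \<open>cosh s / sinh s\<close> into \<open>- 1\<close>; therefore \<open>a1\<close> occurs only in
  the constant \<open>- (a1 + a4)\<close>.\<close>

lemma zeros_le_S1_stage_2:
  assumes "a1 + a4 \<noteq> 0 \<or> a2 \<noteq> 0 \<or> a3 \<noteq> 0 \<or> a4 \<noteq> 0 \<or> a6 \<noteq> 0"
  shows "zeros_le {0<..} 4 (\<lambda>s::real. - (a1 + a4) + a2 * (2 * cosh s * sinh s ^ 2 - cosh s) - a3 * cosh s
    + a4 * sinh s ^ 2 + 2 * a6 * sinh s ^ 3)"
proof (cases "a2 = 0 \<and> a3 = 0 \<and> a4 = 0 \<and> a6 = 0")
  case True
  with assms show ?thesis by (simp add: zeros_le_const)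
next
  case False
  have "zeros_le {0<..} (Suc 3) (\<lambda>s::real. - (a1 + a4) + a2 * (2 * cosh s * sinh s ^ 2 - cosh s) - a3 * cosh s
    + a4 * sinh s ^ 2 + 2 * a6 * sinh s ^ 3)"
  proof (rule zeros_le_step[where g = "\<lambda>s. a2 * (6 * cosh s ^ 2 - 3) - a3 + 2 * a4 * cosh s + 6 * a6 * (sinh s * cosh s)"
      and \<phi> = "\<lambda>s. 1 / sinh s"
      and f' = "\<lambda>s. a2 * (2 * sinh s ^ 3 + 4 * cosh s ^ 2 * sinh s - sinh s) - a3 * sinh s + 2 * a4 * sinh s * cosh s
        + 6 * a6 * sinh s ^ 2 * cosh s"])
    fix s :: real assume s: "s > 0"
    then have S: "sinh s \<noteq> 0" by simp
    show "((\<lambda>s::real. - (a1 + a4) + a2 * (2 * cosh s * sinh s ^ 2 - cosh s) - a3 * cosh s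
      + a4 * sinh s ^ 2 + 2 * a6 * sinh s ^ 3) has_real_derivative
      a2 * (2 * sinh s ^ 3 + 4 * cosh s ^ 2 * sinh s - sinh s) - a3 * sinh s + 2 * a4 * sinh s * cosh s
        + 6 * a6 * sinh s ^ 2 * cosh s) (at s)"
      by (auto intro!: derivative_eq_intros simp: eval_nat_numeral algebra_simps)
    show "(a2 * (2 * sinh s ^ 3 + 4 * cosh s ^ 2 * sinh s - sinh s) - a3 * sinh s + 2 * a4 * sinh s * cosh s
        + 6 * a6 * sinh s ^ 2 * cosh s) * (1 / sinh s) =
      a2 * (6 * cosh s ^ 2 - 3) - a3 + 2 * a4 * cosh s + 6 * a6 * (sinh s * cosh s)"
      using S by (simp add: field_simps cosh_square_eq) (simp add: algebra_simps eval_nat_numeral)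
  qed (use False zeros_le_S1_stage_3[of a2 a3 a4 a6] in \<open>auto intro!: smooth_intros\<close>)
  then show ?thesis by simp
qed

text \<open>The derivative of \<open>S1_comb\<close> divided by \<open>sinh s\<close>, which makes
  the contribution of \<open>cosh s - 1\<close> constant. The sum \<open>a1 + a4\<close> arises
  because the derivative of \<open>s * cosh s\<close> contains another
  \<open>cosh s\<close>.\<close>

lemma zeros_le_S1_derivative:
  assumes "a1 \<noteq> 0 \<or> a2 \<noteq> 0 \<or> a3 \<noteq> 0 \<or> a4 \<noteq> 0 \<or> a5 \<noteq> 0 \<or> a6 \<noteq> 0"
  shows "zeros_le {0<..} 5 (\<lambda>s::real. (a1 + a4) * (cosh s / sinh s) + a2 * (2 * sinh s + 1 / sinh s) + a3 * (1 / sinh s)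
    + a4 * s + (a5 - 2 * a6) + 2 * a6 * cosh s)"
proof (cases "a1 = 0 \<and> a2 = 0 \<and> a3 = 0 \<and> a4 = 0 \<and> a6 = 0")
  case True
  with assms show ?thesis by (simp add: zeros_le_const)
next
  case False
  have "zeros_le {0<..} (Suc 4) (\<lambda>s::real. (a1 + a4) * (cosh s / sinh s) + a2 * (2 * sinh s + 1 / sinh s) + a3 * (1 / sinh s)
    + a4 * s + (a5 - 2 * a6) + 2 * a6 * cosh s)"
  proof (rule zeros_le_step[where g = "\<lambda>s::real. - (a1 + a4) + a2 * (2 * cosh s * sinh s ^ 2 - cosh s) - a3 * cosh s
    + a4 * sinh s ^ 2 + 2 * a6 * sinh s ^ 3"
      and \<phi> = "\<lambda>s. sinh s ^ 2"
      and f' = "\<lambda>s. (a1 + a4) * ((sinh s * sinh s - cosh s * cosh s) / (sinh s * sinh s)) + a2 * (2 * cosh s - cosh s / (sinh s * sinh s))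
        + a3 * (- cosh s / (sinh s * sinh s)) + a4 + 2 * a6 * sinh s"])
    fix s :: real assume s: "s > 0"
    then have S: "sinh s \<noteq> 0" by simp
    show "((\<lambda>s::real. (a1 + a4) * (cosh s / sinh s) + a2 * (2 * sinh s + 1 / sinh s) + a3 * (1 / sinh s)
    + a4 * s + (a5 - 2 * a6) + 2 * a6 * cosh s) has_real_derivative
      (a1 + a4) * ((sinh s * sinh s - cosh s * cosh s) / (sinh s * sinh s)) + a2 * (2 * cosh s - cosh s / (sinh s * sinh s))
        + a3 * (- cosh s / (sinh s * sinh s)) + a4 + 2 * a6 * sinh s) (at s)"
      by (rule DERIV_cong, (rule DERIV_add DERIV_cmult DERIV_const DERIV_ident DERIV_cosh_div_sinh
        DERIV_one_div_sinh sinh_real_DERIV cosh_real_DERIV | use s in simp)+)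
    show "((a1 + a4) * ((sinh s * sinh s - cosh s * cosh s) / (sinh s * sinh s)) + a2 * (2 * cosh s - cosh s / (sinh s * sinh s))
        + a3 * (- cosh s / (sinh s * sinh s)) + a4 + 2 * a6 * sinh s) * sinh s ^ 2 =
      - (a1 + a4) + a2 * (2 * cosh s * sinh s ^ 2 - cosh s) - a3 * cosh s + a4 * sinh s ^ 2 + 2 * a6 * sinh s ^ 3"
      using S by (simp add: power2_eq_square[symmetric] cosh_square_eq field_simps) (simp add: algebra_simps eval_nat_numeral)
  qed (use False zeros_le_S1_stage_2[of a1 a4 a2 a3 a6] in \<open>auto intro!: smooth_intros\<close>)
  then show ?thesis by simp
qed

lemma smooth_S1_comb: "open S \<Longrightarrow> smooth (S1_comb a1 a2 a3 a4 a5 a6) S"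
  unfolding S1_comb_def[abs_def] by (intro smooth_intros)

text \<open>In the generic case six differentiations reduce the six functions to a constant; all but
  the first cost one zero, hence the bound 5.\<close>

lemma zeros_le_S1_comb:
  assumes "a1 \<noteq> 0 \<or> a2 \<noteq> 0 \<or> a3 \<noteq> 0 \<or> a4 \<noteq> 0 \<or> a5 \<noteq> 0 \<or> a6 \<noteq> 0"
  shows "zeros_le {0<..} 5 (S1_comb a1 a2 a3 a4 a5 a6)"
proof (rule zeros_le_step_endpoint[where g = "\<lambda>s::real. (a1 + a4) * (cosh s / sinh s) + a2 * (2 * sinh s + 1 / sinh s) + a3 * (1 / sinh s)
    + a4 * s + (a5 - 2 * a6) + 2 * a6 * cosh s" and \<phi> = "\<lambda>s. 1 / sinh s"
    and f' = "\<lambda>s. a1 * cosh s + a2 * (sinh s * sinh s + cosh s * cosh s) + a3 + a4 * (cosh s + s * sinh s) + a5 * sinh s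
      + a6 * (2 * (cosh s - 1) * sinh s)"])
  fix s :: real assume s: "s > 0"
  then have S: "sinh s \<noteq> 0" by simp
  show "(S1_comb a1 a2 a3 a4 a5 a6 has_real_derivative
    a1 * cosh s + a2 * (sinh s * sinh s + cosh s * cosh s) + a3 + a4 * (cosh s + s * sinh s) + a5 * sinh s
      + a6 * (2 * (cosh s - 1) * sinh s)) (at s)"
    unfolding S1_comb_def[abs_def] by (auto intro!: derivative_eq_intros simp: algebra_simps)
  show "(a1 * cosh s + a2 * (sinh s * sinh s + cosh s * cosh s) + a3 + a4 * (cosh s + s * sinh s) + a5 * sinh s
      + a6 * (2 * (cosh s - 1) * sinh s)) * (1 / sinh s) =
    (a1 + a4) * (cosh s / sinh s) + a2 * (2 * sinh s + 1 / sinh s) + a3 * (1 / sinh s)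
    + a4 * s + (a5 - 2 * a6) + 2 * a6 * cosh s"
    using S by (simp add: power2_eq_square[symmetric] cosh_square_eq field_simps) (simp add: algebra_simps eval_nat_numeral)
qed (use zeros_le_S1_derivative[OF assms] in \<open>auto intro!: smooth_intros smooth_S1_comb continuous_intros simp: S1_comb_def\<close>)

text \<open>In the variable \<open>u = sinh s\<close> this is the degree bound for the roots of a
  polynomial; dividing the derivative in \<open>s\<close> by \<open>cosh s\<close> gives the
  derivative in \<open>u\<close>.\<close>

lemma zeros_le_poly_sinh:
  assumes "\<exists>i\<le>n. c i \<noteq> 0"
  shows "zeros_le {0<..} n (\<lambda>s::real. \<Sum>i\<le>n. c i * sinh s ^ i)"
  using assms
proof (induction n arbitrary: c)
  case 0
  then show ?case by (simp add: zeros_le_const)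
next
  case (Suc n)
  show ?case
  proof (cases "\<exists>i\<le>n. c (Suc i) \<noteq> 0")
    case False
    then have "(\<Sum>i\<le>Suc n. c i * sinh s ^ i) = c 0" for s :: real
      by (simp add: sum.atMost_Suc_shift del: sum.atMost_Suc)
    moreover have "c 0 \<noteq> 0" using False Suc.prems by (metis Suc_le_mono not0_implies_Suc)
    ultimately show ?thesis by (simp add: zeros_le_const del: sum.atMost_Suc)
  next
    case True
    show ?thesis
    proof (rule zeros_le_step[where g = "\<lambda>s. \<Sum>i\<le>n. (c (Suc i) * real (Suc i)) * sinh s ^ i" and \<phi> = "\<lambda>s. 1 / cosh s"
      and f' = "\<lambda>s. (\<Sum>i\<le>n. (c (Suc i) * real (Suc i)) * sinh s ^ i) * cosh s"])
      fix s :: real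
      have "((\<lambda>s. sinh s ^ Suc i) has_real_derivative real (Suc i) * cosh s * sinh s ^ i) (at s)" for i
        by (rule derivative_eq_intros refl)+ simp
      then have "((\<lambda>s::real. c 0 + (\<Sum>i\<le>n. c (Suc i) * sinh s ^ Suc i)) has_real_derivative
        0 + (\<Sum>i\<le>n. c (Suc i) * (real (Suc i) * cosh s * sinh s ^ i))) (at s)"
        by (intro DERIV_add DERIV_const DERIV_sum DERIV_cmult)
      then show "((\<lambda>s::real. \<Sum>i\<le>Suc n. c i * sinh s ^ i) has_real_derivative
        (\<Sum>i\<le>n. (c (Suc i) * real (Suc i)) * sinh s ^ i) * cosh s) (at s)"
        by (simp add: sum.atMost_Suc_shift sum_distrib_left sum_distrib_right mult_ac del: sum.atMost_Suc of_nat_Suc power_Suc)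
    qed (use True in \<open>auto intro!: Suc.IH smooth_sum smooth_intros simp del: sum.atMost_Suc of_nat_Suc\<close>)
  qed
qed

section \<open>The chain of differentiations for the second system\<close>

definition S2_comb :: "real \<Rightarrow> real \<Rightarrow> real \<Rightarrow> real \<Rightarrow> real \<Rightarrow> real \<Rightarrow> real \<Rightarrow> real \<Rightarrow> real" where
  "S2_comb b1 b2 b3 b4 b5 b6 b7 s = b1 * (sinh s / cosh s) + b2 * (sinh s / cosh s) ^ 3 + b3 * s
     + b4 * (s * (sinh s / cosh s)\<^sup>2) + b5 * (1 - 1 / cosh s) + b6 * (1 - 1 / (cosh s)\<^sup>2) + b7 * (1 - 1 / cosh s ^ 3)"

text \<open>For a polynomial \<open>P\<close> of degree six without linear term,
  \<open>P' u = u * Q u\<close> with \<open>Q\<close> of degree four. As \<open>sinh s\<close> has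
  no zero for \<open>s > 0\<close>, Rolle's theorem gives \<open>4 + 1\<close> zeros instead of
  6.\<close>

lemma zeros_le_poly_sinh_no_linear_term:
  assumes "e0 \<noteq> 0 \<or> e2 \<noteq> 0 \<or> e3 \<noteq> 0 \<or> e4 \<noteq> 0 \<or> e5 \<noteq> 0 \<or> e6 \<noteq> 0"
  shows "zeros_le {0<..} 5 (\<lambda>s::real. e0 + e2 * sinh s ^ 2 + e3 * sinh s ^ 3 + e4 * sinh s ^ 4
    + e5 * sinh s ^ 5 + e6 * sinh s ^ 6)"
proof (cases "e2 = 0 \<and> e3 = 0 \<and> e4 = 0 \<and> e5 = 0 \<and> e6 = 0")
  case True
  with assms show ?thesis by (simp add: zeros_le_const)
next
  case False
  \<comment> \<open>The coefficients of \<open>Q\<close>, that is, those of \<open>P'\<close>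
    shifted down by one power.\<close>
  define c where "c i = [2 * e2, 3 * e3, 4 * e4, 5 * e5, 6 * e6] ! i" for i
  have cs: "c 0 = 2 * e2" "c (Suc 0) = 3 * e3" "c 2 = 4 * e4" "c 3 = 5 * e5" "c 4 = 6 * e6"
    by (auto simp: c_def)
  have "\<exists>i\<le>4. c i \<noteq> 0"
  proof (rule ccontr)
    assume *: "\<not> (\<exists>i\<le>4. c i \<noteq> 0)"
    have "c 0 = 0" "c (Suc 0) = 0" "c 2 = 0" "c 3 = 0" "c 4 = 0" using * by simp_all
    with False show False unfolding cs by simp
  qed
  then have z: "zeros_le {0<..} 4 (\<lambda>s::real. \<Sum>i\<le>4. c i * sinh s ^ i)"
    by (rule zeros_le_poly_sinh)
  have "zeros_le {0<..} (Suc 4) (\<lambda>s::real. e0 + e2 * sinh s ^ 2 + e3 * sinh s ^ 3 + e4 * sinh s ^ 4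
    + e5 * sinh s ^ 5 + e6 * sinh s ^ 6)"
  proof (rule zeros_le_step[OF _ _ _ _ z, where \<phi> = "\<lambda>s. 1 / (sinh s * cosh s)"
      and f' = "\<lambda>s. e2 * (2 * sinh s * cosh s) + e3 * (3 * sinh s ^ 2 * cosh s)
    + e4 * (4 * sinh s ^ 3 * cosh s) + e5 * (5 * sinh s ^ 4 * cosh s) + e6 * (6 * sinh s ^ 5 * cosh s)"])
    fix s :: real assume s: "s > 0"
    then have S: "sinh s \<noteq> 0" by simp
    have D: "((\<lambda>s. sinh s ^ k) has_real_derivative real k * sinh s ^ (k - 1) * cosh s) (at s)" for k
      by (rule DERIV_cong[OF DERIV_power[OF sinh_real_DERIV]]) simp
    have "((\<lambda>s. e0 + e2 * sinh s ^ 2 + e3 * sinh s ^ 3 + e4 * sinh s ^ 4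
      + e5 * sinh s ^ 5 + e6 * sinh s ^ 6) has_real_derivative
      0 + e2 * (real 2 * sinh s ^ (2 - 1) * cosh s) + e3 * (real 3 * sinh s ^ (3 - 1) * cosh s)
      + e4 * (real 4 * sinh s ^ (4 - 1) * cosh s) + e5 * (real 5 * sinh s ^ (5 - 1) * cosh s)
      + e6 * (real 6 * sinh s ^ (6 - 1) * cosh s)) (at s)"
      by (intro DERIV_add DERIV_cmult DERIV_const D)
    then show "((\<lambda>s. e0 + e2 * sinh s ^ 2 + e3 * sinh s ^ 3 + e4 * sinh s ^ 4
      + e5 * sinh s ^ 5 + e6 * sinh s ^ 6) has_real_derivative
      e2 * (2 * sinh s * cosh s) + e3 * (3 * sinh s ^ 2 * cosh s)
    + e4 * (4 * sinh s ^ 3 * cosh s) + e5 * (5 * sinh s ^ 4 * cosh s) + e6 * (6 * sinh s ^ 5 * cosh s)) (at s)"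
      by simp
    have "(\<Sum>i\<le>4. c i * sinh s ^ i) = c 0 + c (Suc 0) * sinh s + c 2 * sinh s ^ 2 + c 3 * sinh s ^ 3 + c 4 * sinh s ^ 4"
      by (simp add: eval_nat_numeral)
    also have "\<dots> * (sinh s * cosh s) = e2 * (2 * sinh s * cosh s) + e3 * (3 * sinh s ^ 2 * cosh s)
    + e4 * (4 * sinh s ^ 3 * cosh s) + e5 * (5 * sinh s ^ 4 * cosh s) + e6 * (6 * sinh s ^ 5 * cosh s)"
      unfolding cs by algebra
    finally show "(e2 * (2 * sinh s * cosh s) + e3 * (3 * sinh s ^ 2 * cosh s)
    + e4 * (4 * sinh s ^ 3 * cosh s) + e5 * (5 * sinh s ^ 4 * cosh s) + e6 * (6 * sinh s ^ 5 * cosh s))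
      * (1 / (sinh s * cosh s)) = (\<Sum>i\<le>4. c i * sinh s ^ i)"
      by (rule times_one_div_cancel) (use S in simp)
  qed (auto intro!: smooth_intros)
  then show ?thesis by simp
qed

text \<open>The six coefficients vanish only together with the parameters: the powers 4 and 6 give
  \<open>b3 = b4 = 0\<close>, then the powers 0 and 2 give \<open>b1 = b2 = 0\<close>, and the
  powers 5 and 3 give \<open>b5 = b7 = 0\<close>.\<close>

lemma zeros_le_S2_second_stage:
  assumes "b1 \<noteq> 0 \<or> b2 \<noteq> 0 \<or> b3 \<noteq> 0 \<or> b4 \<noteq> 0 \<or> b5 \<noteq> 0 \<or> b7 \<noteq> 0"
  shows "zeros_le {0<..} 5 (\<lambda>s::real. (- b1 - b3) + (- b1 + 3 * b2 + 3 * b4) * sinh s ^ 2 + (b5 - 3 * b7) * sinh s ^ 3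
    + (3 * b3 + 5 * b4) * sinh s ^ 4 + b5 * sinh s ^ 5 + (2 * b3 + 2 * b4) * sinh s ^ 6)"
proof (rule zeros_le_poly_sinh_no_linear_term, rule ccontr)
  assume "\<not> (- b1 - b3 \<noteq> 0 \<or> - b1 + 3 * b2 + 3 * b4 \<noteq> 0 \<or> b5 - 3 * b7 \<noteq> 0 \<or> 3 * b3 + 5 * b4 \<noteq> 0 \<or> b5 \<noteq> 0 \<or>
    2 * b3 + 2 * b4 \<noteq> 0)"
  then have "- b1 - b3 = 0" "- b1 + 3 * b2 + 3 * b4 = 0" "b5 - 3 * b7 = 0" "3 * b3 + 5 * b4 = 0" "b5 = 0" "2 * b3 + 2 * b4 = 0"
    by blast+
  then have "b1 = 0" "b2 = 0" "b3 = 0" "b4 = 0" "b5 = 0" "b7 = 0" by linarith+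
  with assms show False by blast
qed

text \<open>Here \<open>b6\<close> is left only in the constant \<open>2 * b6\<close>. Multiplying
  the derivative by \<open>sinh s ^ 2 * cosh s ^ 2\<close> clears the denominators, and since
  \<open>cosh s\<close> then occurs only in even powers, the result is a polynomial in
  \<open>sinh s\<close>.\<close>

lemma zeros_le_S2_derivative:
  assumes "b1 \<noteq> 0 \<or> b2 \<noteq> 0 \<or> b3 \<noteq> 0 \<or> b4 \<noteq> 0 \<or> b5 \<noteq> 0 \<or> b6 \<noteq> 0 \<or> b7 \<noteq> 0"
  shows "zeros_le {0<..} 6 (\<lambda>s::real. b1 * (cosh s / sinh s) + 3 * b2 * (sinh s / cosh s) + b3 * (cosh s ^ 3 / sinh s)
    + b4 * (sinh s * cosh s + 2 * s) + b5 * cosh s + 2 * b6 + 3 * b7 * (1 / cosh s))"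
proof (cases "b1 = 0 \<and> b2 = 0 \<and> b3 = 0 \<and> b4 = 0 \<and> b5 = 0 \<and> b7 = 0")
  case True
  with assms show ?thesis by (simp add: zeros_le_const)
next
  case False
  have "zeros_le {0<..} (Suc 5) (\<lambda>s::real. b1 * (cosh s / sinh s) + 3 * b2 * (sinh s / cosh s) + b3 * (cosh s ^ 3 / sinh s)
    + b4 * (sinh s * cosh s + 2 * s) + b5 * cosh s + 2 * b6 + 3 * b7 * (1 / cosh s))"
  proof (rule zeros_le_step[where \<phi> = "\<lambda>s. sinh s ^ 2 * cosh s ^ 2"
      and f' = "\<lambda>s. b1 * ((sinh s * sinh s - cosh s * cosh s) / (sinh s * sinh s))
       + 3 * b2 * ((cosh s * cosh s - sinh s * sinh s) / (cosh s * cosh s))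
       + b3 * ((3 * cosh s ^ 2 * sinh s * sinh s - cosh s ^ 3 * cosh s) / (sinh s * sinh s))
       + b4 * (cosh s * cosh s + sinh s * sinh s + 2) + b5 * sinh s + 3 * b7 * (- sinh s / (cosh s * cosh s))"
      and g = "\<lambda>s::real. (- b1 - b3) + (- b1 + 3 * b2 + 3 * b4) * sinh s ^ 2 + (b5 - 3 * b7) * sinh s ^ 3
    + (3 * b3 + 5 * b4) * sinh s ^ 4 + b5 * sinh s ^ 5 + (2 * b3 + 2 * b4) * sinh s ^ 6"])
    fix s :: real assume s: "s > 0"
    then have S: "sinh s \<noteq> 0" by simp
    show "((\<lambda>s::real. b1 * (cosh s / sinh s) + 3 * b2 * (sinh s / cosh s) + b3 * (cosh s ^ 3 / sinh s)
    + b4 * (sinh s * cosh s + 2 * s) + b5 * cosh s + 2 * b6 + 3 * b7 * (1 / cosh s)) has_real_derivative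
      b1 * ((sinh s * sinh s - cosh s * cosh s) / (sinh s * sinh s))
       + 3 * b2 * ((cosh s * cosh s - sinh s * sinh s) / (cosh s * cosh s))
       + b3 * ((3 * cosh s ^ 2 * sinh s * sinh s - cosh s ^ 3 * cosh s) / (sinh s * sinh s))
       + b4 * (cosh s * cosh s + sinh s * sinh s + 2) + b5 * sinh s + 3 * b7 * (- sinh s / (cosh s * cosh s))) (at s)"
    proof -
      have 1: "((\<lambda>s. cosh s ^ 3 / sinh s) has_real_derivative
        (3 * cosh s ^ 2 * sinh s * sinh s - cosh s ^ 3 * cosh s) / (sinh s * sinh s)) (at s)"
        using S by (auto intro!: derivative_eq_intros)
      have 2: "((\<lambda>s. sinh s * cosh s + 2 * s) has_real_derivative cosh s * cosh s + sinh s * sinh s + 2) (at s)"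
        by (auto intro!: derivative_eq_intros)
      have "((\<lambda>s::real. b1 * (cosh s / sinh s) + 3 * b2 * (sinh s / cosh s) + b3 * (cosh s ^ 3 / sinh s)
        + b4 * (sinh s * cosh s + 2 * s) + b5 * cosh s + 2 * b6 + 3 * b7 * (1 / cosh s)) has_real_derivative
        b1 * ((sinh s * sinh s - cosh s * cosh s) / (sinh s * sinh s))
        + 3 * b2 * ((cosh s * cosh s - sinh s * sinh s) / (cosh s * cosh s))
        + b3 * ((3 * cosh s ^ 2 * sinh s * sinh s - cosh s ^ 3 * cosh s) / (sinh s * sinh s))
        + b4 * (cosh s * cosh s + sinh s * sinh s + 2) + b5 * sinh s + 2 * 0 + 3 * b7 * (- sinh s / (cosh s * cosh s))) (at s)"
        by (rule 1 2 DERIV_cosh_div_sinh[OF less_imp_neq[OF s, symmetric]] DERIV_sinh_div_cosh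
          DERIV_one_div_cosh cosh_real_DERIV DERIV_add DERIV_cmult DERIV_const)+
      then show ?thesis by simp
    qed
    \<comment> \<open>In \<open>y\<close> and \<open>z\<close> the claim becomes a polynomial
      identity modulo \<open>y ^ 2 = z ^ 2 + 1\<close>.\<close>
    define z where "z = sinh s"
    define y where "y = cosh s"
    have yz: "y ^ 2 = z ^ 2 + 1" by (simp add: y_def z_def cosh_square_eq)
    have ne: "y \<noteq> 0" "z \<noteq> 0" using S by (simp_all add: y_def z_def)
    have "(b1 * ((z * z - y * y) / (z * z)) + 3 * b2 * ((y * y - z * z) / (y * y))
       + b3 * ((3 * y ^ 2 * z * z - y ^ 3 * y) / (z * z))
       + b4 * (y * y + z * z + 2) + b5 * z + 3 * b7 * (- z / (y * y))) * (z ^ 2 * y ^ 2) =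
      b1 * (z\<^sup>2 - y\<^sup>2) * y\<^sup>2 + 3 * b2 * (y\<^sup>2 - z\<^sup>2) * z\<^sup>2 + b3 * (3 * y\<^sup>2 * z\<^sup>2 - (y\<^sup>2)\<^sup>2) * y\<^sup>2
      + b4 * (y\<^sup>2 + z\<^sup>2 + 2) * (z\<^sup>2 * y\<^sup>2) + b5 * z ^ 3 * y\<^sup>2 - 3 * b7 * z ^ 3"
    proof -
      have f: "(z * z - y * y) / (z * z) * (z ^ 2 * y ^ 2) = (z\<^sup>2 - y\<^sup>2) * y\<^sup>2"
        "(y * y - z * z) / (y * y) * (z ^ 2 * y ^ 2) = (y\<^sup>2 - z\<^sup>2) * z\<^sup>2"
        "(3 * y ^ 2 * z * z - y ^ 3 * y) / (z * z) * (z ^ 2 * y ^ 2) = (3 * y\<^sup>2 * z\<^sup>2 - (y\<^sup>2)\<^sup>2) * y\<^sup>2"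
        "(- z / (y * y)) * (z ^ 2 * y ^ 2) = - (z ^ 3)"
        using ne by (simp_all add: eval_nat_numeral)
      have gen: "(b1 * p1 + 3 * b2 * p2 + b3 * p3 + b4 * p4 + b5 * z + 3 * b7 * p5) * (z ^ 2 * y ^ 2) =
        b1 * (p1 * (z ^ 2 * y ^ 2)) + 3 * b2 * (p2 * (z ^ 2 * y ^ 2)) + b3 * (p3 * (z ^ 2 * y ^ 2))
        + b4 * p4 * (z ^ 2 * y ^ 2) + b5 * z ^ 3 * y ^ 2 + 3 * b7 * (p5 * (z ^ 2 * y ^ 2))" for p1 p2 p3 p4 p5
        by algebra
      show ?thesis unfolding gen f by (simp add: mult.assoc power2_eq_square[symmetric])
    qed
    also have "\<dots> = (- b1 - b3) + (- b1 + 3 * b2 + 3 * b4) * z ^ 2 + (b5 - 3 * b7) * z ^ 3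
    + (3 * b3 + 5 * b4) * z ^ 4 + b5 * z ^ 5 + (2 * b3 + 2 * b4) * z ^ 6"
      unfolding yz by algebra
    finally show "(b1 * ((sinh s * sinh s - cosh s * cosh s) / (sinh s * sinh s))
       + 3 * b2 * ((cosh s * cosh s - sinh s * sinh s) / (cosh s * cosh s))
       + b3 * ((3 * cosh s ^ 2 * sinh s * sinh s - cosh s ^ 3 * cosh s) / (sinh s * sinh s))
       + b4 * (cosh s * cosh s + sinh s * sinh s + 2) + b5 * sinh s + 3 * b7 * (- sinh s / (cosh s * cosh s))) * (sinh s ^ 2 * cosh s ^ 2) =
      (- b1 - b3) + (- b1 + 3 * b2 + 3 * b4) * sinh s ^ 2 + (b5 - 3 * b7) * sinh s ^ 3
    + (3 * b3 + 5 * b4) * sinh s ^ 4 + b5 * sinh s ^ 5 + (2 * b3 + 2 * b4) * sinh s ^ 6"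
      unfolding y_def z_def .
  qed (use False zeros_le_S2_second_stage[of b1 b2 b3 b4 b5 b7] in \<open>auto intro!: smooth_intros\<close>)
  then show ?thesis by simp
qed

lemma smooth_S2_comb: "open S \<Longrightarrow> smooth (S2_comb b1 b2 b3 b4 b5 b6 b7) S"
  unfolding S2_comb_def[abs_def] by (intro smooth_intros) auto

text \<open>The factor \<open>cosh s ^ 3 / sinh s\<close> is, up to 2, the reciprocal of the
  derivative of \<open>1 - 1 / cosh s ^ 2\<close>; it makes the \<open>b6\<close> term
  constant.\<close>

lemma zeros_le_S2_comb:
  assumes "b1 \<noteq> 0 \<or> b2 \<noteq> 0 \<or> b3 \<noteq> 0 \<or> b4 \<noteq> 0 \<or> b5 \<noteq> 0 \<or> b6 \<noteq> 0 \<or> b7 \<noteq> 0"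
  shows "zeros_le {0<..} 6 (S2_comb b1 b2 b3 b4 b5 b6 b7)"
proof (rule zeros_le_step_endpoint[where g = "\<lambda>s::real. b1 * (cosh s / sinh s) + 3 * b2 * (sinh s / cosh s) + b3 * (cosh s ^ 3 / sinh s)
    + b4 * (sinh s * cosh s + 2 * s) + b5 * cosh s + 2 * b6 + 3 * b7 * (1 / cosh s)" and \<phi> = "\<lambda>s. cosh s ^ 3 / sinh s"
    and f' = "\<lambda>s. b1 * ((cosh s * cosh s - sinh s * sinh s) / (cosh s * cosh s))
      + b2 * (3 * (sinh s / cosh s)\<^sup>2 * ((cosh s * cosh s - sinh s * sinh s) / (cosh s * cosh s))) + b3
      + b4 * ((sinh s / cosh s)\<^sup>2 + s * (2 * (sinh s / cosh s) * ((cosh s * cosh s - sinh s * sinh s) / (cosh s * cosh s))))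
      + b5 * (sinh s / (cosh s * cosh s)) + b6 * (2 * cosh s * sinh s / ((cosh s)\<^sup>2 * (cosh s)\<^sup>2))
      + b7 * (3 * (cosh s)\<^sup>2 * sinh s / (cosh s ^ 3 * cosh s ^ 3))"])
  fix s :: real assume s: "s > 0"
  then have S: "sinh s \<noteq> 0" by simp
  show "(S2_comb b1 b2 b3 b4 b5 b6 b7 has_real_derivative
    b1 * ((cosh s * cosh s - sinh s * sinh s) / (cosh s * cosh s))
      + b2 * (3 * (sinh s / cosh s)\<^sup>2 * ((cosh s * cosh s - sinh s * sinh s) / (cosh s * cosh s))) + b3
      + b4 * ((sinh s / cosh s)\<^sup>2 + s * (2 * (sinh s / cosh s) * ((cosh s * cosh s - sinh s * sinh s) / (cosh s * cosh s))))
      + b5 * (sinh s / (cosh s * cosh s)) + b6 * (2 * cosh s * sinh s / ((cosh s)\<^sup>2 * (cosh s)\<^sup>2))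
      + b7 * (3 * (cosh s)\<^sup>2 * sinh s / (cosh s ^ 3 * cosh s ^ 3))) (at s)"
  proof -
    have 1: "((\<lambda>s. (sinh s / cosh s) ^ 3) has_real_derivative
      3 * (sinh s / cosh s)\<^sup>2 * ((cosh s * cosh s - sinh s * sinh s) / (cosh s * cosh s))) (at s)"
      by (rule DERIV_cong[OF DERIV_power[OF DERIV_sinh_div_cosh]]) (simp add: mult_ac)
    have "((\<lambda>s. (sinh s / cosh s)\<^sup>2) has_real_derivative
      2 * (sinh s / cosh s) * ((cosh s * cosh s - sinh s * sinh s) / (cosh s * cosh s))) (at s)"
      by (rule DERIV_cong[OF DERIV_power[OF DERIV_sinh_div_cosh]]) (simp add: mult_ac)
    then have 2: "((\<lambda>s. s * (sinh s / cosh s)\<^sup>2) has_real_derivative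
      (sinh s / cosh s)\<^sup>2 + s * (2 * (sinh s / cosh s) * ((cosh s * cosh s - sinh s * sinh s) / (cosh s * cosh s)))) (at s)"
      by (rule DERIV_cong[OF DERIV_mult[OF DERIV_ident]]) simp
    have 3: "((\<lambda>s. 1 - 1 / cosh s) has_real_derivative sinh s / (cosh s * cosh s)) (at s)"
      "((\<lambda>s. 1 - 1 / (cosh s)\<^sup>2) has_real_derivative 2 * cosh s * sinh s / ((cosh s)\<^sup>2 * (cosh s)\<^sup>2)) (at s)"
      "((\<lambda>s. 1 - 1 / cosh s ^ 3) has_real_derivative 3 * (cosh s)\<^sup>2 * sinh s / (cosh s ^ 3 * cosh s ^ 3)) (at s)"
      by (auto intro!: derivative_eq_intros)
    show ?thesis
      unfolding S2_comb_def[abs_def]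
      by (rule DERIV_cong, (rule 1 2 3 DERIV_sinh_div_cosh DERIV_ident DERIV_add DERIV_cmult)+) simp
  qed
  have u: "cosh s * cosh s - sinh s * sinh s = 1"
    using cosh_square_eq[of s] by (simp add: power2_eq_square)
  define z where "z = sinh s"
  define y where "y = cosh s"
  have ne: "y \<noteq> 0" "z \<noteq> 0" using S by (simp_all add: y_def z_def)
  have yz: "y ^ 2 = z ^ 2 + 1" by (simp add: y_def z_def cosh_square_eq)
  have "(b1 * (1 / (y * y)) + b2 * (3 * (z / y)\<^sup>2 * (1 / (y * y))) + b3
      + b4 * ((z / y)\<^sup>2 + s * (2 * (z / y) * (1 / (y * y))))
      + b5 * (z / (y * y)) + b6 * (2 * y * z / (y\<^sup>2 * y\<^sup>2)) + b7 * (3 * y\<^sup>2 * z / (y ^ 3 * y ^ 3))) * (y ^ 3 / z) =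
    b1 * (y / z) + 3 * b2 * (z / y) + b3 * (y ^ 3 / z) + b4 * (z * y + 2 * s) + b5 * y + 2 * b6 + 3 * b7 * (1 / y)"
    using ne by (simp add: field_simps) (simp add: algebra_simps eval_nat_numeral)
  then show "(b1 * ((cosh s * cosh s - sinh s * sinh s) / (cosh s * cosh s))
      + b2 * (3 * (sinh s / cosh s)\<^sup>2 * ((cosh s * cosh s - sinh s * sinh s) / (cosh s * cosh s))) + b3
      + b4 * ((sinh s / cosh s)\<^sup>2 + s * (2 * (sinh s / cosh s) * ((cosh s * cosh s - sinh s * sinh s) / (cosh s * cosh s))))
      + b5 * (sinh s / (cosh s * cosh s)) + b6 * (2 * cosh s * sinh s / ((cosh s)\<^sup>2 * (cosh s)\<^sup>2))
      + b7 * (3 * (cosh s)\<^sup>2 * sinh s / (cosh s ^ 3 * cosh s ^ 3))) * (cosh s ^ 3 / sinh s) =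
    b1 * (cosh s / sinh s) + 3 * b2 * (sinh s / cosh s) + b3 * (cosh s ^ 3 / sinh s)
    + b4 * (sinh s * cosh s + 2 * s) + b5 * cosh s + 2 * b6 + 3 * b7 * (1 / cosh s)"
    unfolding u y_def z_def .
qed (use zeros_le_S2_derivative[OF assms] in \<open>auto intro!: smooth_intros smooth_S2_comb continuous_intros simp: S2_comb_def\<close>)


section \<open>Line integrals along graphs\<close>

text \<open>A flow parametrisation prescribes only the image of the open parameter interval.
  Continuity puts the end values into the closure of \<open>{p<..<q}\<close>, monotonicity makes
  them bounds of it.\<close>

lemma increasing_image_endpoints:
  fixes g :: "real \<Rightarrow> real"
  assumes "continuous_on {0..1} g" "g ` {0<..<1} = {p<..<q}" "p < q"
    and D: "\<And>t. t \<in> {0<..<1} \<Longrightarrow> (g has_real_derivative g' t) (at t)" "\<And>t. t \<in> {0<..<1} \<Longrightarrow> 0 < g' t"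
  shows "g 0 = p" "g 1 = q"
proof -
  have mono: "g s \<le> g t" if "0 \<le> s" "s < t" "t \<le> 1" for s t
  proof (rule less_imp_le, rule DERIV_pos_imp_increasing_open[OF that(2)])
    show "continuous_on {s..t} g" using that by (intro continuous_on_subset[OF assms(1)]) auto
    fix x assume "s < x" "x < t"
    then have "x \<in> {0<..<1}" using that by auto
    with D show "\<exists>y. (g has_real_derivative y) (at x) \<and> 0 < y" by blast
  qed
  have "g ` closure {0<..<1} \<subseteq> closure {p<..<q}"
    by (rule image_closure_subset) (use assms(1,2) in \<open>auto intro: closure_subset[THEN subsetD]\<close>)
  then have cl: "g t \<in> {p..q}" if "t \<in> {0..1}" for t
    using that assms(3) by (auto simp: closure_greaterThanLessThan image_subset_iff)
  have "g 0 \<le> x \<and> x \<le> g 1" if "x \<in> {p<..<q}" for x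
    using that mono[of 0] mono[of _ 1] unfolding assms(2)[symmetric] by auto
  then have "g 0 \<le> p" "q \<le> g 1"
    using assms(3) by (auto intro!: dense_ge_bounded[OF assms(3)] dense_le_bounded[OF assms(3)])
  with cl[of 0] cl[of 1] show "g 0 = p" "g 1 = q" by auto
qed

lemma decreasing_image_endpoints:
  fixes g :: "real \<Rightarrow> real"
  assumes "continuous_on {0..1} g" "g ` {0<..<1} = {p<..<q}" "p < q"
    and D: "\<And>t. t \<in> {0<..<1} \<Longrightarrow> (g has_real_derivative g' t) (at t)" "\<And>t. t \<in> {0<..<1} \<Longrightarrow> g' t < 0"
  shows "g 0 = q" "g 1 = p"
proof -
  have "(\<lambda>t. - g t) ` {0<..<1} = uminus ` {p<..<q}"
    unfolding assms(2)[symmetric] by (simp add: image_image)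
  then have im: "(\<lambda>t. - g t) ` {0<..<1} = {-q<..<-p}" by simp
  have "continuous_on {0..1} (\<lambda>t. - g t)" by (intro continuous_intros assms)
  note e = increasing_image_endpoints[OF this im, of "\<lambda>t. - g' t"]
  have "- g 0 = - q" "- g 1 = - p"
    by (rule e; use assms in \<open>auto intro!: DERIV_minus\<close>)+
  then show "g 0 = q" "g 1 = p" by auto
qed

text \<open>On a graph the form \<open>P dx + Q dy\<close> pulls back to a form in \<open>x\<close> alone, so a primitive in \<open>x\<close>
  gives the integral along every parametrisation.\<close>

lemma path_line_integral_graph:
  fixes Y Y' \<phi> :: "real \<Rightarrow> real"
  assumes fp: "flow_parametrization X \<Gamma> \<gamma>"
    and G: "\<Gamma> = (\<lambda>x. (x, Y x)) ` {p<..<q}" and pq: "p < q" and e: "\<sigma> = 1 \<or> \<sigma> = - 1"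
    and X1: "\<And>x. x \<in> {p<..<q} \<Longrightarrow> 0 < \<sigma> * fst (X (x, Y x))"
    and X2: "\<And>x. x \<in> {p<..<q} \<Longrightarrow> snd (X (x, Y x)) = Y' x * fst (X (x, Y x))"
    and \<phi>: "continuous_on {p..q} \<phi>"
      "\<And>x. x \<in> {p<..<q} \<Longrightarrow> (\<phi> has_real_derivative P (x, Y x) + Q (x, Y x) * Y' x) (at x)"
  shows "path_line_integral \<gamma> P Q = \<sigma> * (\<phi> q - \<phi> p)"
proof -
  define v where "v t = vector_derivative \<gamma> (at t)" for t
  define g where "g t = fst (\<gamma> t)" for t
  have im: "\<gamma> ` {0<..<1} = \<Gamma>" and C: "\<gamma> C1_differentiable_on {0..1}" and
    vX: "\<And>t. t \<in> {0<..<1} \<Longrightarrow> \<exists>c>0. v t = c *\<^sub>R X (\<gamma> t)" and "arc \<gamma>"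
    using fp by (auto simp: flow_parametrization_def v_def)
  have V: "(\<gamma> has_vector_derivative v t) (at t)" if "t \<in> {0..1}" for t
    using C that unfolding C1_differentiable_on_eq v_def by (simp add: vector_derivative_works)
  have V1: "(g has_real_derivative fst (v t)) (at t)" if "t \<in> {0..1}" for t
    using bounded_linear.has_vector_derivative[OF bounded_linear_fst V[OF that]]
    by (simp add: has_real_derivative_iff_has_vector_derivative g_def[abs_def])
  have gim: "g ` {0<..<1} = {p<..<q}"
  proof -
    have "g ` {0<..<1} = fst ` (\<gamma> ` {0<..<1})" by (simp add: g_def image_image)
    also have "\<dots> = {p<..<q}" unfolding im G by (simp add: image_image)
    finally show ?thesis .
  qed
  have \<gamma>: "\<gamma> t = (g t, Y (g t))" "g t \<in> {p<..<q}" if "t \<in> {0<..<1}" for t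
  proof -
    have "\<gamma> t \<in> \<Gamma>" using that im by blast
    then show "\<gamma> t = (g t, Y (g t))" "g t \<in> {p<..<q}" by (auto simp: G g_def)
  qed
  have contg: "continuous_on {0..1} g"
    by (rule DERIV_continuous_on) (use V1 in \<open>auto intro: has_field_derivative_at_within\<close>)
  \<comment> \<open>The velocity is a positive multiple of the field, so \<open>\<sigma>\<close> is
    the sign of \<open>dx/dt\<close>, and tangency of the field to the graph gives
    \<open>dy = Y' dx\<close>.\<close>
  have sg: "0 < \<sigma> * fst (v t)" and v2: "snd (v t) = Y' (g t) * fst (v t)" if t: "t \<in> {0<..<1}" for t
  proof -
    obtain c where c: "c > 0" "v t = c *\<^sub>R X (g t, Y (g t))" using vX[OF t] \<gamma>(1)[OF t] by metis
    have "\<sigma> * fst (v t) = c * (\<sigma> * fst (X (g t, Y (g t))))" using c by simp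
    also have "\<dots> > 0" using c(1) X1[OF \<gamma>(2)[OF t]] by (rule mult_pos_pos)
    finally show "0 < \<sigma> * fst (v t)" .
    show "snd (v t) = Y' (g t) * fst (v t)" using c(2) X2[OF \<gamma>(2)[OF t]] by simp
  qed
  have ends: "\<phi> (g 1) - \<phi> (g 0) = \<sigma> * (\<phi> q - \<phi> p)" and sub: "g ` {0..1} \<subseteq> {p..q}"
  proof -
    have "g 0 = p \<and> g 1 = q \<and> \<sigma> = 1 \<or> g 0 = q \<and> g 1 = p \<and> \<sigma> = - 1"
      using e
    proof
      assume s: "\<sigma> = 1"
      have "g 0 = p" "g 1 = q"
        by (rule increasing_image_endpoints[OF contg gim pq, of "\<lambda>t. fst (v t)"]; use V1 sg s in force)+
      with s show ?thesis by simp
    next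
      assume s: "\<sigma> = - 1"
      have "g 0 = q" "g 1 = p"
        by (rule decreasing_image_endpoints[OF contg gim pq, of "\<lambda>t. fst (v t)"]; use V1 sg s in force)+
      with s show ?thesis by simp
    qed
    then show "\<phi> (g 1) - \<phi> (g 0) = \<sigma> * (\<phi> q - \<phi> p)" by auto
    have "g t \<in> {p..q}" if "t \<in> {0..1}" for t
    proof (cases "t \<in> {0<..<1}")
      case True
      then show ?thesis using \<gamma>(2)[OF True] by auto
    next
      case False
      then have "t = 0 \<or> t = 1" using that by auto
      with \<open>g 0 = p \<and> g 1 = q \<and> \<sigma> = 1 \<or> g 0 = q \<and> g 1 = p \<and> \<sigma> = - 1\<close> pq show ?thesis by auto
    qed
    then show "g ` {0..1} \<subseteq> {p..q}" by blast
  qed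
  have "((\<lambda>t. P (\<gamma> t) * fst (v t) + Q (\<gamma> t) * snd (v t)) has_integral \<phi> (g 1) - \<phi> (g 0)) {0..1}"
  \<comment> \<open>The primitive is assumed differentiable only in the open interval, because the
    arcs have vertical tangents at their ends.\<close>
  proof (rule fundamental_theorem_of_calculus_interior)
    show "continuous_on {0..1} (\<lambda>t. \<phi> (g t))"
      by (rule continuous_on_compose2[OF \<phi>(1) contg sub])
    fix t :: real assume t: "t \<in> {0<..<1}"
    have "((\<lambda>t. \<phi> (g t)) has_real_derivative (P (g t, Y (g t)) + Q (g t, Y (g t)) * Y' (g t)) * fst (v t)) (at t)"
      by (rule DERIV_chain2[OF \<phi>(2)[OF \<gamma>(2)[OF t]] V1]) (use t in auto)
    also have "(P (g t, Y (g t)) + Q (g t, Y (g t)) * Y' (g t)) * fst (v t) = P (\<gamma> t) * fst (v t) + Q (\<gamma> t) * snd (v t)"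
      unfolding \<gamma>(1)[OF t] v2[OF t] by (simp add: algebra_simps)
    finally show "((\<lambda>t. \<phi> (g t)) has_vector_derivative P (\<gamma> t) * fst (v t) + Q (\<gamma> t) * snd (v t)) (at t)"
      by (simp add: has_real_derivative_iff_has_vector_derivative)
  qed simp
  then show ?thesis
    unfolding path_line_integral_def ends[symmetric] v_def by (rule integral_unique)
qed

section \<open>Reduction of the line integrals to moments\<close>

definition moment :: "real \<Rightarrow> real \<Rightarrow> (real \<Rightarrow> real) \<Rightarrow> int \<Rightarrow> nat \<Rightarrow> real" where
  "moment p q Y n j = integral {p..q} (\<lambda>x. x powi n * Y x ^ j)"

text \<open>The line integral over the arc \<open>y = \<sigma> * Y x\<close>: the outer
  \<open>\<sigma>\<close> is the direction in which \<open>x\<close> runs, and the second summand is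
  the term \<open>- x^n y^j dy\<close> after integration by parts, with
  \<open>n = i - k - 1\<close>. The table \<open>m\<close> of moments is a parameter so that both
  systems share the formula.\<close>

definition arc_value :: "int \<Rightarrow> (int \<Rightarrow> nat \<Rightarrow> real) \<Rightarrow> real \<Rightarrow> (nat \<Rightarrow> nat \<Rightarrow> real) \<Rightarrow> (nat \<Rightarrow> nat \<Rightarrow> real) \<Rightarrow> real" where
  "arc_value k m \<sigma> a b = \<sigma> * (\<Sum>i\<le>2. \<Sum>j\<le>2 - i. b i j * \<sigma> ^ j * m (int i - k - 1) j
     + a i j * (real_of_int (int i - k - 1) / real (Suc j)) * \<sigma> ^ Suc j * m (int i - k - 2) (Suc j))"

text \<open>The terms in \<open>dy\<close> are integrated by parts; the boundary terms vanish because \<open>Y\<close> does.\<close>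

lemma path_line_integral_quad_poly:
  fixes Y Y' :: "real \<Rightarrow> real"
  assumes fp: "flow_parametrization X \<Gamma> \<gamma>"
    and G: "\<Gamma> = (\<lambda>x. (x, \<sigma> * Y x)) ` {p<..<q}" and pq: "0 < p" "p < q" and e: "\<sigma> = 1 \<or> \<sigma> = - 1"
    and X1: "\<And>x. x \<in> {p<..<q} \<Longrightarrow> 0 < \<sigma> * fst (X (x, \<sigma> * Y x))"
    and X2: "\<And>x. x \<in> {p<..<q} \<Longrightarrow> snd (X (x, \<sigma> * Y x)) = \<sigma> * Y' x * fst (X (x, \<sigma> * Y x))"
    and Y: "continuous_on {p..q} Y" "Y p = 0" "Y q = 0"
      "\<And>x. x \<in> {p<..<q} \<Longrightarrow> (Y has_real_derivative Y' x) (at x)"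
  shows "path_line_integral \<gamma> (\<lambda>z. fst z powi (- k - 1) * quad_poly b z) (\<lambda>z. - (fst z powi (- k - 1) * quad_poly a z))
    = arc_value k (moment p q Y) \<sigma> a b"
proof -
  define Z where "Z x = \<sigma> * Y x" for x
  define f where "f n j x = x powi n * Z x ^ j" for n j and x :: real
  define F where "F n j x = integral {p..x} (f n j)" for n j x
  have cf: "continuous_on {p..q} (f n j)" for n j
    unfolding f_def[abs_def] Z_def using pq by (intro continuous_intros Y(1)) auto
  have DF: "(F n j has_real_derivative f n j x) (at x)" if "x \<in> {p<..<q}" for n j x
  proof -
    have "(F n j has_real_derivative f n j x) (at x within {p..q})"
      unfolding F_def[abs_def] using that by (intro integral_has_real_derivative cf) auto
    moreover have "at x within {p..q} = at x" using that by (intro at_within_interior) auto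
    ultimately show ?thesis by simp
  qed
  have cF: "continuous_on {p..q} (F n j)" for n j
    unfolding F_def[abs_def] by (intro indefinite_integral_continuous_1 integrable_continuous_real cf)
  define N where "N i = int i - k - 1" for i :: nat
  \<comment> \<open>A primitive of \<open>x^N y^j (b dx - a dy)\<close> along the arc: the
    \<open>dy\<close> part is the differential of \<open>x^N y^(j+1) / (j+1)\<close> minus its
    component in \<open>dx\<close>.\<close>
  define T where "T i j x = b i j * F (N i) j x - a i j * (x powi N i * Z x ^ Suc j / real (Suc j)
    - real_of_int (N i) / real (Suc j) * F (N i - 1) (Suc j) x)" for i j x
  define \<phi> where "\<phi> x = (\<Sum>i\<le>2. \<Sum>j\<le>2 - i. T i j x)" for x
  have DZ: "(Z has_real_derivative \<sigma> * Y' x) (at x)" if "x \<in> {p<..<q}" for x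
    unfolding Z_def[abs_def] by (intro DERIV_cmult Y that)
  have DT: "(T i j has_real_derivative b i j * f (N i) j x - a i j * (f (N i) j x * (\<sigma> * Y' x))) (at x)"
    if x: "x \<in> {p<..<q}" for i j x
  proof -
    have x0: "x \<noteq> 0" using x pq by auto
    have "((\<lambda>x. x powi N i * Z x ^ Suc j / real (Suc j)) has_real_derivative
      ((real_of_int (N i) * x powi (N i - 1)) * Z x ^ Suc j + (real (Suc j) * Z x ^ j * (\<sigma> * Y' x)) * x powi N i) / real (Suc j)) (at x)"
      by (intro DERIV_cdivide DERIV_mult DERIV_cong[OF DERIV_power_int[OF DERIV_ident disjI2[OF x0]]]
        DERIV_cong[OF DERIV_power[OF DZ[OF x], of "Suc j"]]) simp_all
    then have "((\<lambda>x. x powi N i * Z x ^ Suc j / real (Suc j)) has_real_derivative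
      real_of_int (N i) / real (Suc j) * f (N i - 1) (Suc j) x + f (N i) j x * (\<sigma> * Y' x)) (at x)"
      by (rule DERIV_cong) (simp add: f_def field_simps)
    then have "((\<lambda>x. x powi N i * Z x ^ Suc j / real (Suc j) - real_of_int (N i) / real (Suc j) * F (N i - 1) (Suc j) x) has_real_derivative
      f (N i) j x * (\<sigma> * Y' x)) (at x)"
      by (rule DERIV_cong[OF DERIV_diff[OF _ DERIV_cmult[OF DF[OF x]]]]) simp
    then show ?thesis
      unfolding T_def[abs_def] by (intro DERIV_diff DERIV_cmult DF x)
  qed
  have pw: "f (N i) j x = x powi (- k - 1) * (x ^ i * Z x ^ j)" if x: "x \<in> {p<..<q}" for i j x
  proof -
    have "x \<noteq> 0" using x pq by auto
    moreover have "N i = (- k - 1) + int i" by (simp add: N_def)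
    ultimately have "x powi N i = x powi (- k - 1) * x ^ i" by (metis power_int_add power_int_of_nat)
    then show ?thesis by (simp add: f_def)
  qed
  have "path_line_integral \<gamma> (\<lambda>z. fst z powi (- k - 1) * quad_poly b z) (\<lambda>z. - (fst z powi (- k - 1) * quad_poly a z))
    = \<sigma> * (\<phi> q - \<phi> p)"
  proof (rule path_line_integral_graph[OF fp _ pq(2) e, where Y = Z and Y' = "\<lambda>x. \<sigma> * Y' x"])
    show "\<Gamma> = (\<lambda>x. (x, Z x)) ` {p<..<q}" unfolding G Z_def ..
    show "continuous_on {p..q} \<phi>"
      unfolding \<phi>_def[abs_def] T_def Z_def using pq by (intro continuous_intros cF Y(1)) auto
    fix x assume x: "x \<in> {p<..<q}"
    show "0 < \<sigma> * fst (X (x, Z x))" "snd (X (x, Z x)) = \<sigma> * Y' x * fst (X (x, Z x))"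
      using X1[OF x] X2[OF x] by (simp_all add: Z_def)
    have "(\<phi> has_real_derivative (\<Sum>i\<le>2. \<Sum>j\<le>2 - i. b i j * f (N i) j x - a i j * (f (N i) j x * (\<sigma> * Y' x)))) (at x)"
      unfolding \<phi>_def[abs_def] by (intro DERIV_sum DT x)
    also have "(\<Sum>i\<le>2. \<Sum>j\<le>2 - i. b i j * f (N i) j x - a i j * (f (N i) j x * (\<sigma> * Y' x))) =
      fst (x, Z x) powi (- k - 1) * quad_poly b (x, Z x) + - (fst (x, Z x) powi (- k - 1) * quad_poly a (x, Z x)) * (\<sigma> * Y' x)"
      unfolding quad_poly_def pw[OF x]
      by (simp add: sum_distrib_left sum_distrib_right sum_subtractf sum_negf mult_ac)
    finally show "(\<phi> has_real_derivative
      fst (x, Z x) powi (- k - 1) * quad_poly b (x, Z x) + - (fst (x, Z x) powi (- k - 1) * quad_poly a (x, Z x)) * (\<sigma> * Y' x)) (at x)" .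
  qed
  also have "\<phi> q - \<phi> p = (\<Sum>i\<le>2. \<Sum>j\<le>2 - i. b i j * F (N i) j q + a i j * (real_of_int (N i) / real (Suc j)) * F (N i - 1) (Suc j) q)"
  proof -
    have "F n j p = 0" for n j by (simp add: F_def)
    moreover have "Z p = 0" "Z q = 0" using Y by (simp_all add: Z_def)
    ultimately have "T i j q - T i j p = b i j * F (N i) j q + a i j * (real_of_int (N i) / real (Suc j)) * F (N i - 1) (Suc j) q" for i j
      by (simp add: T_def)
    then show ?thesis unfolding \<phi>_def by (simp add: sum_subtractf[symmetric])
  qed
  also have "\<sigma> * \<dots> = arc_value k (moment p q Y) \<sigma> a b"
  proof -
    have "F n j q = \<sigma> ^ j * moment p q Y n j" for n j
    proof -
      have "f n j = (\<lambda>x. \<sigma> ^ j * (x powi n * Y x ^ j))"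
        by (auto simp: f_def Z_def power_mult_distrib mult_ac)
      then show ?thesis unfolding F_def moment_def by simp
    qed
    then show ?thesis
      unfolding arc_value_def N_def by (simp only: mult.assoc) (simp add: algebra_simps)
  qed
  finally show ?thesis .
qed

lemma moment_eq:
  assumes "p \<le> q" "continuous_on {p..q} \<Psi>"
    "\<And>x. x \<in> {p<..<q} \<Longrightarrow> (\<Psi> has_real_derivative x powi n * Y x ^ j) (at x)"
  shows "moment p q Y n j = \<Psi> q - \<Psi> p"
  unfolding moment_def
  by (intro integral_unique fundamental_theorem_of_calculus_interior assms)
     (use assms(3) in \<open>auto simp: has_real_derivative_iff_has_vector_derivative\<close>)

text \<open>Substitution \<open>x = C * u\<close>: the power contributes \<open>C powi n\<close>,
  the differential one more factor \<open>C\<close>, and doubling the ordinate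
  \<open>2 ^ j\<close>.\<close>

lemma moment_scale:
  assumes "0 < p" "p < q" "0 < C" "continuous_on {p..q} Y"
  shows "moment (C * p) (C * q) (\<lambda>x. 2 * Y (x / C)) n j = C powi (n + 1) * 2 ^ j * moment p q Y n j"
proof -
  define f where "f x = x powi n * Y x ^ j" for x
  have "continuous_on {p..q} f" unfolding f_def[abs_def] using assms by (intro continuous_intros) auto
  then have "(f has_integral integral {p..q} f) {p..q}"
    using integrable_continuous_real integrable_integral by blast
  then have "((\<lambda>x. f ((1 / C) * x)) has_integral (1 / \<bar>1 / C\<bar>) * integral {p..q} f) ((\<lambda>x. x / (1 / C)) ` {p..q})"
    using has_integral_stretch_real[of f "integral {p..q} f" p q "1 / C"] assms by auto
  moreover have "(\<lambda>x. x / (1 / C)) ` {p..q} = {C * p..C * q}"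
    using assms(2,3) by (simp add: mult.commute[of _ C])
  ultimately have "((\<lambda>x. f (x / C)) has_integral C * integral {p..q} f) {C * p..C * q}"
    using assms(3) by simp
  then have "((\<lambda>x. (C powi n * 2 ^ j) * f (x / C)) has_integral (C powi n * 2 ^ j) * (C * integral {p..q} f)) {C * p..C * q}"
    by (rule has_integral_mult_right)
  moreover have "(\<lambda>x. (C powi n * 2 ^ j) * f (x / C)) = (\<lambda>x. x powi n * (2 * Y (x / C)) ^ j)"
    using assms(3) by (intro ext) (simp add: f_def power_int_divide_distrib power_mult_distrib)
  ultimately have "((\<lambda>x. x powi n * (2 * Y (x / C)) ^ j) has_integral (C powi n * 2 ^ j) * (C * integral {p..q} f)) {C * p..C * q}"
    by simp
  then have "moment (C * p) (C * q) (\<lambda>x. 2 * Y (x / C)) n j = (C powi n * 2 ^ j) * (C * integral {p..q} f)"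
    unfolding moment_def by (rule integral_unique)
  also have "integral {p..q} f = moment p q Y n j"
    by (simp add: moment_def f_def[abs_def])
  finally show ?thesis using assms(3) by (simp add: power_int_add)
qed


section \<open>Moments of a half ellipse\<close>

text \<open>The upper half of the level \<open>(cosh s - 1) / 2\<close> of \<open>S1_H\<close>,
  solved for the ordinate.\<close>

definition arcY :: "real \<Rightarrow> real \<Rightarrow> real" where
  "arcY s x = sqrt ((2 * cosh s * x - x\<^sup>2 - 1) / 2)"

lemmas exp_eq_cosh_sinh = cosh_plus_sinh[symmetric] cosh_minus sinh_minus

lemma arcY_radicand: "2 * cosh s * x - x\<^sup>2 - 1 = (x - exp (- s)) * (exp s - x)" for s x :: real
proof -
  have "exp s * exp (- s) = 1" by (simp add: exp_minus)
  moreover have "2 * cosh s = exp s + exp (- s)" by (simp add: cosh_field_def)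
  ultimately show ?thesis by (simp add: algebra_simps power2_eq_square)
qed

lemma arcY_radicand_pos_iff:
  fixes s x :: real
  assumes "0 < s"
  shows "0 < 2 * cosh s * x - x\<^sup>2 - 1 \<longleftrightarrow> x \<in> {exp (- s)<..<exp s}"
proof -
  have "0 < x - p \<and> 0 < q - x \<or> x - p < 0 \<and> q - x < 0 \<longleftrightarrow> x \<in> {p<..<q}" if "p < q" for p q :: real
    using that by auto
  then show ?thesis unfolding arcY_radicand zero_less_mult_iff by this (use assms in simp)
qed

lemma arcY_pos: "0 < s \<Longrightarrow> x \<in> {exp (- s)<..<exp s} \<Longrightarrow> 0 < arcY s x"
  using arcY_radicand_pos_iff[of s x] by (simp add: arcY_def)

lemma arcY_sq: "0 < s \<Longrightarrow> x \<in> {exp (- s)<..<exp s} \<Longrightarrow> arcY s x * arcY s x = (2 * cosh s * x - x\<^sup>2 - 1) / 2"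
  using arcY_radicand_pos_iff[of s x] by (simp add: arcY_def)

lemma arcY_endpoints: "arcY s (exp (- s)) = 0" "arcY s (exp s) = 0"
  unfolding arcY_def arcY_radicand by simp_all

lemma continuous_arcY: "continuous_on S (arcY s)"
  unfolding arcY_def[abs_def] by (intro continuous_intros) auto

lemma DERIV_arcY:
  assumes "0 < s" "x \<in> {exp (- s)<..<exp s}"
  shows "(arcY s has_real_derivative (cosh s - x) / (2 * arcY s x)) (at x)"
proof -
  have "(arcY s has_real_derivative (2 * cosh s - 2 * x) / 2 * (inverse (arcY s x) / 2)) (at x)"
    unfolding arcY_def[abs_def] using arcY_radicand_pos_iff[of s x] assms
    by (auto intro!: derivative_eq_intros)
  then show ?thesis
    by (rule DERIV_cong) (use arcY_pos[OF assms] in \<open>simp add: field_simps\<close>)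
qed

text \<open>Primitives of \<open>x / y\<close>, \<open>1 / y\<close>, \<open>1 / (x y)\<close>, ..., \<open>1 / (x ^ 4 y)\<close> for \<open>y = arcY s x\<close>;
  from the fourth on they come from differentiating \<open>y / x ^ k\<close>.\<close>

definition prim1 :: "real \<Rightarrow> real \<Rightarrow> real" where "prim1 s x = sqrt 2 * arcsin ((x - cosh s) / sinh s)"
definition prim0 :: "real \<Rightarrow> real \<Rightarrow> real" where "prim0 s x = cosh s * prim1 s x - 2 * arcY s x"
definition prim2 :: "real \<Rightarrow> real \<Rightarrow> real" where "prim2 s x = sqrt 2 * arcsin ((cosh s * x - 1) / (sinh s * x))"
definition prim3 :: "real \<Rightarrow> real \<Rightarrow> real" where "prim3 s x = 2 * (arcY s x / x) + cosh s * prim2 s x"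
definition prim4 :: "real \<Rightarrow> real \<Rightarrow> real" where "prim4 s x = arcY s x / x\<^sup>2 - 1 / 2 * prim2 s x + 3 * cosh s / 2 * prim3 s x"
definition prim5 :: "real \<Rightarrow> real \<Rightarrow> real" where
  "prim5 s x = 2 / 3 * (arcY s x / x ^ 3) - 2 / 3 * prim3 s x + 5 * cosh s / 3 * prim4 s x"

text \<open>Both arcsines run from \<open>- pi / 2\<close> to \<open>pi / 2\<close> along the arc,
  which produces the factor \<open>pi\<close> of the moments with odd powers of
  \<open>y\<close>.\<close>

lemma arcsin_args:
  fixes s :: real
  assumes "0 < s"
  shows "(exp (- s) - cosh s) / sinh s = - 1" "(exp s - cosh s) / sinh s = 1"
    "(cosh s * exp (- s) - 1) / (sinh s * exp (- s)) = - 1" "(cosh s * exp s - 1) / (sinh s * exp s) = 1"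
proof -
  have S: "sinh s \<noteq> 0" using assms by simp
  have "exp (- s) - cosh s = - sinh s" "exp s - cosh s = sinh s"
    using cosh_plus_sinh[of s] cosh_minus_sinh[of s] by linarith+
  with S show "(exp (- s) - cosh s) / sinh s = - 1" "(exp s - cosh s) / sinh s = 1"
    by (simp_all only: divide_minus_left divide_self[OF S])
  have "(cosh s + sinh s) * exp (- s) = 1" "(cosh s - sinh s) * exp s = 1"
    unfolding cosh_plus_sinh cosh_minus_sinh by (simp_all add: exp_minus)
  then have n: "cosh s * exp (- s) - 1 = - (sinh s * exp (- s))" "cosh s * exp s - 1 = sinh s * exp s"
    unfolding distrib_right left_diff_distrib by linarith+
  have z: "sinh s * exp (- s) \<noteq> 0" "sinh s * exp s \<noteq> 0" using S by auto
  show "(cosh s * exp (- s) - 1) / (sinh s * exp (- s)) = - 1" "(cosh s * exp s - 1) / (sinh s * exp s) = 1"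
    unfolding n divide_minus_left divide_self[OF z(1)] divide_self[OF z(2)] by (rule refl)+
qed

lemma continuous_prim1:
  assumes "0 < s"
  shows "continuous_on {exp (- s)..exp s} (prim1 s)"
  unfolding prim1_def[abs_def]
proof (intro continuous_intros ballI)
  have S: "sinh s > 0" using assms by simp
  then show "sinh s \<noteq> 0" by simp
  fix x assume "x \<in> {exp (- s)..exp s}"
  then have "- sinh s \<le> x - cosh s" "x - cosh s \<le> sinh s"
    using cosh_plus_sinh[of s] cosh_minus_sinh[of s] by auto
  then show "- 1 \<le> (x - cosh s) / sinh s \<and> (x - cosh s) / sinh s \<le> 1"
    using S by (auto simp: divide_le_eq le_divide_eq simp del: sinh_real_pos_iff)
qed

lemma continuous_prim2:
  assumes "0 < s"
  shows "continuous_on {exp (- s)..exp s} (prim2 s)"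
  unfolding prim2_def[abs_def]
proof (intro continuous_intros)
  have S: "sinh s > 0" using assms by simp
  have e: "exp s * exp (- s) = 1" by (simp add: exp_minus)
  have "- 1 \<le> (cosh s * x - 1) / (sinh s * x) \<and> (cosh s * x - 1) / (sinh s * x) \<le> 1" "sinh s * x \<noteq> 0"
    if x: "x \<in> {exp (- s)..exp s}" for x
  proof -
    have x0: "0 < x" using x exp_gt_zero[of "- s"] by (auto intro: less_le_trans simp del: exp_gt_zero)
    have "exp s * exp (- s) \<le> exp s * x" "exp (- s) * x \<le> exp (- s) * exp s"
      using x by (auto intro!: mult_left_mono)
    then have "1 \<le> (cosh s + sinh s) * x" "(cosh s - sinh s) * x \<le> 1"
      using e by (simp_all add: cosh_plus_sinh cosh_minus_sinh mult.commute)
    then show "- 1 \<le> (cosh s * x - 1) / (sinh s * x) \<and> (cosh s * x - 1) / (sinh s * x) \<le> 1"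
      using S x0 by (simp add: field_simps)
    show "sinh s * x \<noteq> 0" using S x0 by simp
  qed
  then show "\<forall>x\<in>{exp (- s)..exp s}. sinh s * x \<noteq> 0"
    "\<forall>x\<in>{exp (- s)..exp s}. - 1 \<le> (cosh s * x - 1) / (sinh s * x) \<and> (cosh s * x - 1) / (sinh s * x) \<le> 1" by auto
qed

lemma continuous_prim:
  assumes "0 < s"
  shows "continuous_on {exp (- s)..exp s} (prim0 s)" "continuous_on {exp (- s)..exp s} (prim3 s)"
    "continuous_on {exp (- s)..exp s} (prim4 s)" "continuous_on {exp (- s)..exp s} (prim5 s)"
proof -
  have nz: "x \<noteq> 0" if "x \<in> {exp (- s)..exp s}" for x :: real
    using that exp_gt_zero[of "- s"] by (auto simp del: exp_gt_zero)
  show "continuous_on {exp (- s)..exp s} (prim0 s)"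
    unfolding prim0_def[abs_def] by (intro continuous_intros continuous_prim1 continuous_arcY assms)
  show 3: "continuous_on {exp (- s)..exp s} (prim3 s)"
    unfolding prim3_def[abs_def] by (intro continuous_intros continuous_prim2 continuous_arcY assms) (use nz in auto)
  show 4: "continuous_on {exp (- s)..exp s} (prim4 s)"
    unfolding prim4_def[abs_def] by (intro continuous_intros continuous_prim2 continuous_arcY assms 3) (use nz in auto)
  show "continuous_on {exp (- s)..exp s} (prim5 s)"
    unfolding prim5_def[abs_def] by (intro continuous_intros continuous_prim2 continuous_arcY assms 3 4) (use nz in auto)
qed

lemma DERIV_prim:
  assumes s: "0 < s" and x: "x \<in> {exp (- s)<..<exp s}"
  shows "(prim0 s has_real_derivative x / arcY s x) (at x)"
    "(prim1 s has_real_derivative 1 / arcY s x) (at x)"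
    "(prim2 s has_real_derivative 1 / x / arcY s x) (at x)"
    "(prim3 s has_real_derivative 1 / x ^ 2 / arcY s x) (at x)"
    "(prim4 s has_real_derivative 1 / x ^ 3 / arcY s x) (at x)"
    "(prim5 s has_real_derivative 1 / x ^ 4 / arcY s x) (at x)"
proof -
  define y where "y = arcY s x"
  have y: "y > 0" "2 * (y * y) = 2 * cosh s * x - x * x - 1"
    using arcY_pos[OF s x] arcY_sq[OF s x] by (simp_all add: y_def power2_eq_square)
  have S: "sinh s > 0" using s by simp
  have CS: "cosh s * cosh s = sinh s * sinh s + 1"
    using cosh_square_eq[of s] by (simp add: power2_eq_square)
  have x0: "0 < x" using x exp_gt_zero[of "- s"] by (auto intro: less_trans simp del: exp_gt_zero)
  note DY = DERIV_arcY[OF s x, folded y_def]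
  \<comment> \<open>Both arcsines have an argument \<open>u\<close> with
    \<open>1 - u^2 = 2 y^2 / d^2\<close>, where \<open>d\<close> is the denominator of
    \<open>u\<close>; so the square root in the derivative is a multiple of
    \<open>y / d\<close>.\<close>
  have ran: "- 1 < u \<and> u < 1 \<and> sqrt (1 - u\<^sup>2) = sqrt 2 * y / d" if u: "1 - u * u = 2 * (y * y) / (d * d)" and d: "d > 0" for u d
  proof -
    have "sqrt 2 * sqrt 2 = (2::real)" by simp
    then have sq: "1 - u\<^sup>2 = (sqrt 2 * y / d)\<^sup>2"
      using u by (simp add: power2_eq_square)
    moreover have "0 < sqrt 2 * y / d" using y(1) d by simp
    ultimately have "sqrt (1 - u\<^sup>2) = sqrt 2 * y / d" by (simp only: real_sqrt_abs abs_of_pos)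
    moreover have "u\<^sup>2 < 1" using sq \<open>0 < sqrt 2 * y / d\<close> by (smt (verit) zero_less_power)
    then have "\<bar>u\<bar> < 1" by (simp add: abs_square_less_1)
    ultimately show ?thesis by auto
  qed
  show D1: "(prim1 s has_real_derivative 1 / arcY s x) (at x)"
  proof -
    have "1 - (x - cosh s) / sinh s * ((x - cosh s) / sinh s) = 2 * (y * y) / (sinh s * sinh s)"
      unfolding y(2) using S CS by (simp add: field_simps)
    note r = ran[OF this S]
    have "((\<lambda>x. (x - cosh s) / sinh s) has_real_derivative 1 / sinh s) (at x)"
      using S by (auto intro!: derivative_eq_intros)
    from DERIV_chain2[OF DERIV_arcsin this] r
    have "((\<lambda>x. arcsin ((x - cosh s) / sinh s)) has_real_derivative inverse (sqrt 2 * y / sinh s) * (1 / sinh s)) (at x)"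
      by simp
    then show ?thesis
      unfolding prim1_def[abs_def] y_def[symmetric]
      by (rule DERIV_cong[OF DERIV_cmult]) (use S y in \<open>simp add: field_simps\<close>)
  qed
  show D2: "(prim2 s has_real_derivative 1 / x / arcY s x) (at x)"
  proof -
    have "1 - (cosh s * x - 1) / (sinh s * x) * ((cosh s * x - 1) / (sinh s * x)) =
      ((sinh s * x) * (sinh s * x) - (cosh s * x - 1) * (cosh s * x - 1)) / ((sinh s * x) * (sinh s * x))"
      using S x0 by (simp add: field_simps)
    also have "(sinh s * x) * (sinh s * x) - (cosh s * x - 1) * (cosh s * x - 1) = 2 * (y * y)"
      using CS y(2) by algebra
    finally have "1 - (cosh s * x - 1) / (sinh s * x) * ((cosh s * x - 1) / (sinh s * x)) = 2 * (y * y) / ((sinh s * x) * (sinh s * x))" .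
    note r = ran[OF this mult_pos_pos[OF S x0]]
    have "((\<lambda>x. (cosh s * x - 1) / (sinh s * x)) has_real_derivative (cosh s * (sinh s * x) - (cosh s * x - 1) * sinh s) / ((sinh s * x) * (sinh s * x))) (at x)"
      using S x0 by (auto intro!: derivative_eq_intros)
    then have "((\<lambda>x. (cosh s * x - 1) / (sinh s * x)) has_real_derivative 1 / (sinh s * x * x)) (at x)"
      by (rule DERIV_cong) (use S x0 in \<open>simp add: field_simps\<close>)
    from DERIV_chain2[OF DERIV_arcsin this] r
    have "((\<lambda>x. arcsin ((cosh s * x - 1) / (sinh s * x))) has_real_derivative inverse (sqrt 2 * y / (sinh s * x)) * (1 / (sinh s * x * x))) (at x)"
      by simp
    then show ?thesis
      unfolding prim2_def[abs_def] y_def[symmetric]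
      by (rule DERIV_cong[OF DERIV_cmult]) (use S x0 y in \<open>simp add: field_simps\<close>)
  qed
  show "(prim0 s has_real_derivative x / arcY s x) (at x)"
    unfolding prim0_def[abs_def] y_def[symmetric]
    by (rule DERIV_cong[OF DERIV_diff[OF DERIV_cmult[OF D1] DERIV_cmult[OF DY]]])
       (use y x0 in \<open>simp add: y_def[symmetric] field_simps\<close>)
  have Yk: "((\<lambda>x. arcY s x / x ^ k) has_real_derivative
    ((cosh s - x) * x - 2 * real k * (y * y)) / (2 * x ^ Suc k * y)) (at x)" for k
  proof -
    have "((\<lambda>x. arcY s x / x ^ k) has_real_derivative
      ((cosh s - x) / (2 * y) * x ^ k - y * (real k * x ^ (k - 1))) / (x ^ k * x ^ k)) (at x)"
      unfolding y_def using x0 by (auto intro!: derivative_eq_intros DERIV_arcY[OF s x])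
    then show ?thesis
    proof (rule DERIV_cong)
      show "((cosh s - x) / (2 * y) * x ^ k - y * (real k * x ^ (k - 1))) / (x ^ k * x ^ k) =
        ((cosh s - x) * x - 2 * real k * (y * y)) / (2 * x ^ Suc k * y)"
        using x0 y(1) by (cases k) (simp_all add: field_simps)
    qed
  qed
  \<comment> \<open>After elimination of \<open>y^2\<close> the derivative of \<open>y / x^k\<close>
    combines \<open>1 / (x^(k-1) y)\<close>, \<open>1 / (x^k y)\<close> and
    \<open>1 / (x^(k+1) y)\<close>; solving for the last one gives the constants in
    \<open>prim3\<close>, \<open>prim4\<close> and \<open>prim5\<close>.\<close>
  have e: "((cosh s - x) * x - 2 * real k * (y * y)) = (real k - 1) * (x * x) + (1 - 2 * real k) * (cosh s * x) + real k" for k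
    unfolding mult.assoc[of 2] using y(2) by algebra
  show D3: "(prim3 s has_real_derivative 1 / x ^ 2 / arcY s x) (at x)"
  proof -
    have "((\<lambda>x. arcY s x / x) has_real_derivative (1 - cosh s * x) / (2 * x ^ 2 * y)) (at x)"
      using Yk[of 1] unfolding e by (simp add: power2_eq_square)
    then show ?thesis unfolding prim3_def[abs_def]
      by (rule DERIV_cong[OF DERIV_add[OF DERIV_cmult DERIV_cmult[OF D2]]])
         (use y x0 in \<open>simp add: y_def[symmetric] field_simps power2_eq_square\<close>)
  qed
  show D4: "(prim4 s has_real_derivative 1 / x ^ 3 / arcY s x) (at x)"
    unfolding prim4_def[abs_def] 
    by (rule DERIV_cong[OF DERIV_add[OF DERIV_diff[OF Yk[of 2, unfolded e] DERIV_cmult[OF D2]] DERIV_cmult[OF D3]]])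
       (use y x0 in \<open>simp add: y_def[symmetric] field_simps eval_nat_numeral\<close>)
  show "(prim5 s has_real_derivative 1 / x ^ 4 / arcY s x) (at x)"
    unfolding prim5_def[abs_def] 
    by (rule DERIV_cong[OF DERIV_add[OF DERIV_diff[OF DERIV_cmult[OF Yk[of 3, unfolded e]] DERIV_cmult[OF D3]] DERIV_cmult[OF D4]]])
       (use y x0 in \<open>simp add: y_def[symmetric] field_simps eval_nat_numeral\<close>)
qed

text \<open>The ordinate vanishes at both ends, so only the arcsines contribute. The polynomials in
  \<open>cosh s\<close> are the Legendre polynomials \<open>P_0\<close> to \<open>P_3\<close>, and
  the recursion behind \<open>prim3\<close> to \<open>prim5\<close> is theirs.\<close>

lemma prim_increments:
  assumes "0 < s"
  shows "prim0 s (exp s) - prim0 s (exp (- s)) = sqrt 2 * pi * cosh s"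
    "prim1 s (exp s) - prim1 s (exp (- s)) = sqrt 2 * pi"
    "prim2 s (exp s) - prim2 s (exp (- s)) = sqrt 2 * pi"
    "prim3 s (exp s) - prim3 s (exp (- s)) = sqrt 2 * pi * cosh s"
    "prim4 s (exp s) - prim4 s (exp (- s)) = sqrt 2 * pi * ((3 * cosh s ^ 2 - 1) / 2)"
    "prim5 s (exp s) - prim5 s (exp (- s)) = sqrt 2 * pi * ((5 * cosh s ^ 3 - 3 * cosh s) / 2)"
  unfolding prim0_def prim5_def prim4_def prim3_def prim2_def prim1_def arcY_endpoints arcsin_args[OF assms] arcsin_1 arcsin_minus_1
  by (simp_all add: field_simps eval_nat_numeral)

section \<open>Closed forms of the moments\<close>

abbreviation "mom s \<equiv> moment (exp (- s)) (exp s) (arcY s)"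

text \<open>For odd \<open>j\<close> the power \<open>y^(j+1)\<close> is a polynomial in
  \<open>x\<close>, so the integrand is a Laurent polynomial divided by \<open>y\<close>;
  \<open>e0\<close> to \<open>e5\<close> are its coefficients from \<open>x\<close> down to
  \<open>1 / x^4\<close>.\<close>

lemma mom_odd:
  assumes s: "0 < s"
    and f: "\<And>x. x \<in> {exp (- s)<..<exp s} \<Longrightarrow> x powi n * arcY s x ^ j =
      (e0 * x + e1 + e2 * (1 / x) + e3 * (1 / x ^ 2) + e4 * (1 / x ^ 3) + e5 * (1 / x ^ 4)) / arcY s x"
  shows "mom s n j = sqrt 2 * pi * (e0 * cosh s + e1 + e2 + e3 * cosh s + e4 * ((3 * cosh s ^ 2 - 1) / 2)
      + e5 * ((5 * cosh s ^ 3 - 3 * cosh s) / 2))"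
proof -
  define \<Psi> where "\<Psi> x = e0 * prim0 s x + e1 * prim1 s x + e2 * prim2 s x + e3 * prim3 s x + e4 * prim4 s x + e5 * prim5 s x" for x
  have "mom s n j = \<Psi> (exp s) - \<Psi> (exp (- s))"
  proof (rule moment_eq)
    show "continuous_on {exp (- s)..exp s} \<Psi>"
      unfolding \<Psi>_def[abs_def] by (intro continuous_intros continuous_prim continuous_prim1 continuous_prim2 s)
    fix x assume x: "x \<in> {exp (- s)<..<exp s}"
    have "(\<Psi> has_real_derivative e0 * (x / arcY s x) + e1 * (1 / arcY s x) + e2 * (1 / x / arcY s x)
      + e3 * (1 / x ^ 2 / arcY s x) + e4 * (1 / x ^ 3 / arcY s x) + e5 * (1 / x ^ 4 / arcY s x)) (at x)"
      unfolding \<Psi>_def[abs_def] by (intro DERIV_add DERIV_cmult DERIV_prim s x)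
    then show "(\<Psi> has_real_derivative x powi n * arcY s x ^ j) (at x)"
      by (rule DERIV_cong) (simp add: f[OF x] add_divide_distrib)
  qed (use s in simp)
  also have "\<dots> = e0 * (prim0 s (exp s) - prim0 s (exp (- s))) + e1 * (prim1 s (exp s) - prim1 s (exp (- s)))
    + e2 * (prim2 s (exp s) - prim2 s (exp (- s))) + e3 * (prim3 s (exp s) - prim3 s (exp (- s)))
    + e4 * (prim4 s (exp s) - prim4 s (exp (- s))) + e5 * (prim5 s (exp s) - prim5 s (exp (- s)))"
    unfolding \<Psi>_def by (simp add: algebra_simps)
  finally show ?thesis unfolding prim_increments[OF s] by (simp add: algebra_simps)
qed

text \<open>For even \<open>j\<close> the integrand is itself a Laurent polynomial.
  \<open>ln x\<close> increases by \<open>2 * s\<close> over the arc, and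
  \<open>3 * sinh s + 4 * sinh s ^ 3\<close> is \<open>sinh (3 * s)\<close>.\<close>

lemma mom_even:
  assumes s: "0 < s"
    and f: "\<And>x. x \<in> {exp (- s)<..<exp s} \<Longrightarrow> x powi n * arcY s x ^ j =
      e0 + e1 * (1 / x) + e2 * (1 / x ^ 2) + e3 * (1 / x ^ 3) + e4 * (1 / x ^ 4)"
  shows "mom s n j = e0 * (2 * sinh s) + e1 * (2 * s) + e2 * (2 * sinh s) + e3 * (2 * cosh s * sinh s)
      + e4 * (2 / 3 * (3 * sinh s + 4 * sinh s ^ 3))"
proof -
  define \<Psi> where "\<Psi> x = e0 * x + e1 * ln x + e2 * (- (1 / x)) + e3 * (- (1 / 2) * (1 / x) ^ 2) + e4 * (- (1 / 3) * (1 / x) ^ 3)" for x :: real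
  have x0: "0 < x" if "x \<in> {exp (- s)..exp s}" for x :: real
    using that exp_gt_zero[of "- s"] by (auto intro: less_le_trans simp del: exp_gt_zero)
  have "mom s n j = \<Psi> (exp s) - \<Psi> (exp (- s))"
  proof (rule moment_eq)
    show "continuous_on {exp (- s)..exp s} \<Psi>"
      unfolding \<Psi>_def[abs_def] by (intro continuous_intros) (use x0 in force)+
    fix x assume x: "x \<in> {exp (- s)<..<exp s}"
    then have x0: "0 < x" using x0 by auto
    have I: "((\<lambda>x. 1 / x) has_real_derivative - (1 / x ^ 2)) (at x)"
      using x0 by (auto intro!: derivative_eq_intros simp: power2_eq_square)
    have "(\<Psi> has_real_derivative e0 * 1 + e1 * (1 / x) + e2 * (- (- (1 / x ^ 2)))
      + e3 * (- (1 / 2) * (real 2 * (- (1 / x ^ 2) * (1 / x) ^ (2 - Suc 0))))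
      + e4 * (- (1 / 3) * (real 3 * (- (1 / x ^ 2) * (1 / x) ^ (3 - Suc 0))))) (at x)"
      unfolding \<Psi>_def[abs_def]
      by (intro DERIV_add DERIV_cmult DERIV_minus DERIV_power I DERIV_ident DERIV_ln_divide x0)
    then show "(\<Psi> has_real_derivative x powi n * arcY s x ^ j) (at x)"
      by (rule DERIV_cong) (use x0 in \<open>simp add: f[OF x] field_simps eval_nat_numeral\<close>)
  qed (use s in simp)
  also have "\<dots> = e0 * (exp s - exp (- s)) + e1 * (2 * s) + e2 * (exp s - exp (- s)) + e3 * ((exp s ^ 2 - exp (- s) ^ 2) / 2)
    + e4 * ((exp s ^ 3 - exp (- s) ^ 3) / 3)"
  proof -
    have "1 / exp s = exp (- s)" "1 / exp (- s) = exp s" by (simp_all add: exp_minus field_simps)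
    then show ?thesis unfolding \<Psi>_def by (simp add: algebra_simps diff_divide_distrib)
  qed
  also have "exp s ^ 3 - exp (- s) ^ 3 = 6 * cosh s ^ 2 * sinh s + 2 * sinh s ^ 3"
    unfolding exp_eq_cosh_sinh by algebra
  also have "exp s ^ 2 - exp (- s) ^ 2 = 4 * cosh s * sinh s"
    unfolding exp_eq_cosh_sinh by algebra
  also have "exp s - exp (- s) = 2 * sinh s"
    unfolding exp_eq_cosh_sinh by algebra
  finally show ?thesis unfolding cosh_square_eq by (simp add: algebra_simps eval_nat_numeral)
qed

text \<open>The moments that occur in the two Abelian integrals; the coefficients supplied are those
  of \<open>x^n\<close> times a power of \<open>(2 * C * x - x^2 - 1) / 2\<close>. The map from
  \<open>(x, y)\<close> to \<open>(1 / x, y / x)\<close> preserves the ellipse, which explains equal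
  values such as those for the exponents \<open>- 1\<close> and \<open>- 2\<close> with
  \<open>j = 1\<close>.\<close>

lemma mom_values:
  assumes s: "0 < s"
  shows "mom s 0 0 = 2 * sinh s" "mom s (- 1) 0 = 2 * s" "mom s (- 2) 0 = 2 * sinh s"
    "mom s (- 3) 0 = 2 * cosh s * sinh s"
    "mom s (- 2) 2 = 2 * (s * cosh s - sinh s)" "mom s (- 3) 2 = cosh s * sinh s - s"
    "mom s (- 4) 2 = 2 / 3 * sinh s ^ 3"
    "mom s (- 1) 1 = sqrt 2 * pi * ((cosh s - 1) / 2)" "mom s (- 2) 1 = sqrt 2 * pi * ((cosh s - 1) / 2)"
    "mom s (- 3) 1 = sqrt 2 * pi * ((cosh s ^ 2 - 1) / 4)"
    "mom s (- 3) 3 = sqrt 2 * pi * (3 / 8 * (cosh s - 1) ^ 2)"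
    "mom s (- 4) 1 = sqrt 2 * pi * ((cosh s ^ 3 - cosh s) / 4)"
    "mom s (- 4) 3 = sqrt 2 * pi * ((cosh s ^ 3 - 3 * cosh s + 2) / 8)"
proof -
  define C where "C = cosh s"
  have x0: "0 < x" if "x \<in> {exp (- s)<..<exp s}" for x :: real
    using that exp_gt_zero[of "- s"] by (auto intro: less_trans simp del: exp_gt_zero)
  have y2: "arcY s x ^ 2 = (2 * C * x - x ^ 2 - 1) / 2" and y0: "0 < arcY s x" 
    and y1: "arcY s x ^ 1 = (2 * C * x - x ^ 2 - 1) / 2 / arcY s x"
    and y3: "arcY s x ^ 3 = ((2 * C * x - x ^ 2 - 1) / 2) ^ 2 / arcY s x" if "x \<in> {exp (- s)<..<exp s}" for x
  proof -
    show p: "0 < arcY s x" by (rule arcY_pos[OF s that])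
    have q: "arcY s x * arcY s x = (2 * C * x - x ^ 2 - 1) / 2" unfolding C_def by (rule arcY_sq[OF s that])
    show "arcY s x ^ 2 = (2 * C * x - x ^ 2 - 1) / 2" "arcY s x ^ 1 = (2 * C * x - x ^ 2 - 1) / 2 / arcY s x"
      "arcY s x ^ 3 = ((2 * C * x - x ^ 2 - 1) / 2) ^ 2 / arcY s x"
      unfolding q[symmetric] using p by (simp_all add: eval_nat_numeral)
  qed
  note odd = mom_odd[OF s, folded C_def] and even = mom_even[OF s, folded C_def]
  note sq = cosh_square_eq[of s, folded C_def]
  show "mom s 0 0 = 2 * sinh s"
    by (subst even[where ?e0.0 = 1 and ?e1.0 = 0 and ?e2.0 = 0 and ?e3.0 = 0 and ?e4.0 = 0]) simp_all
  show "mom s (- 1) 0 = 2 * s"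
    by (subst even[where ?e0.0 = 0 and ?e1.0 = 1 and ?e2.0 = 0 and ?e3.0 = 0 and ?e4.0 = 0])
       (simp_all add: power_int_minus inverse_eq_divide)
  show "mom s (- 2) 0 = 2 * sinh s"
    by (subst even[where ?e0.0 = 0 and ?e1.0 = 0 and ?e2.0 = 1 and ?e3.0 = 0 and ?e4.0 = 0])
       (simp_all add: power_int_minus inverse_eq_divide)
  show "mom s (- 3) 0 = 2 * cosh s * sinh s"
    by (subst even[where ?e0.0 = 0 and ?e1.0 = 0 and ?e2.0 = 0 and ?e3.0 = 1 and ?e4.0 = 0])
       (simp_all add: power_int_minus inverse_eq_divide C_def)
  show "mom s (- 2) 2 = 2 * (s * cosh s - sinh s)"
  proof (subst even[where ?e0.0 = "- 1 / 2" and ?e1.0 = C and ?e2.0 = "- 1 / 2" and ?e3.0 = 0 and ?e4.0 = 0])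
    fix x assume x: "x \<in> {exp (- s)<..<exp s}"
    show "x powi (- 2) * arcY s x ^ 2 = - 1 / 2 + C * (1 / x) + - 1 / 2 * (1 / x ^ 2) + 0 * (1 / x ^ 3) + 0 * (1 / x ^ 4)"
      unfolding y2[OF x] using x0[OF x] by (simp add: power_int_minus field_simps eval_nat_numeral)
  qed (simp add: C_def algebra_simps)
  show "mom s (- 3) 2 = cosh s * sinh s - s"
  proof (subst even[where ?e0.0 = 0 and ?e1.0 = "- 1 / 2" and ?e2.0 = C and ?e3.0 = "- 1 / 2" and ?e4.0 = 0])
    fix x assume x: "x \<in> {exp (- s)<..<exp s}"
    show "x powi (- 3) * arcY s x ^ 2 = 0 + - 1 / 2 * (1 / x) + C * (1 / x ^ 2) + - 1 / 2 * (1 / x ^ 3) + 0 * (1 / x ^ 4)"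
      unfolding y2[OF x] using x0[OF x] by (simp add: power_int_minus field_simps eval_nat_numeral)
  qed (simp add: C_def algebra_simps)
  show "mom s (- 4) 2 = 2 / 3 * sinh s ^ 3"
  proof (subst even[where ?e0.0 = 0 and ?e1.0 = 0 and ?e2.0 = "- 1 / 2" and ?e3.0 = C and ?e4.0 = "- 1 / 2"])
    fix x assume x: "x \<in> {exp (- s)<..<exp s}"
    show "x powi (- 4) * arcY s x ^ 2 = 0 + 0 * (1 / x) + - 1 / 2 * (1 / x ^ 2) + C * (1 / x ^ 3) + - 1 / 2 * (1 / x ^ 4)"
      unfolding y2[OF x] using x0[OF x] by (simp add: power_int_minus field_simps eval_nat_numeral)
  next
    have "C * (2 * C * sinh s) = 2 * (sinh s ^ 2 + 1) * sinh s" unfolding sq[symmetric] by (simp add: power2_eq_square)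
    then show "0 * (2 * sinh s) + 0 * (2 * s) + - 1 / 2 * (2 * sinh s) + C * (2 * C * sinh s)
      + - 1 / 2 * (2 / 3 * (3 * sinh s + 4 * sinh s ^ 3)) = 2 / 3 * sinh s ^ 3"
      by (simp add: algebra_simps eval_nat_numeral)
  qed
  show "mom s (- 1) 1 = sqrt 2 * pi * ((cosh s - 1) / 2)"
  proof (subst odd[where ?e0.0 = "- 1 / 2" and ?e1.0 = C and ?e2.0 = "- 1 / 2" and ?e3.0 = 0 and ?e4.0 = 0 and ?e5.0 = 0])
    fix x assume x: "x \<in> {exp (- s)<..<exp s}"
    show "x powi (- 1) * arcY s x ^ 1 = (- 1 / 2 * x + C + - 1 / 2 * (1 / x) + 0 * (1 / x ^ 2) + 0 * (1 / x ^ 3) + 0 * (1 / x ^ 4)) / arcY s x"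
      unfolding y1[OF x] using x0[OF x] y0[OF x] by (simp add: power_int_minus field_simps eval_nat_numeral)
  qed (simp add: C_def field_simps)
  show "mom s (- 2) 1 = sqrt 2 * pi * ((cosh s - 1) / 2)"
  proof (subst odd[where ?e0.0 = 0 and ?e1.0 = "- 1 / 2" and ?e2.0 = C and ?e3.0 = "- 1 / 2" and ?e4.0 = 0 and ?e5.0 = 0])
    fix x assume x: "x \<in> {exp (- s)<..<exp s}"
    show "x powi (- 2) * arcY s x ^ 1 = (0 * x + - 1 / 2 + C * (1 / x) + - 1 / 2 * (1 / x ^ 2) + 0 * (1 / x ^ 3) + 0 * (1 / x ^ 4)) / arcY s x"
      unfolding y1[OF x] using x0[OF x] y0[OF x] by (simp add: power_int_minus field_simps eval_nat_numeral)
  qed (simp add: C_def field_simps)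
  show "mom s (- 3) 1 = sqrt 2 * pi * ((cosh s ^ 2 - 1) / 4)"
  proof (subst odd[where ?e0.0 = 0 and ?e1.0 = 0 and ?e2.0 = "- 1 / 2" and ?e3.0 = C and ?e4.0 = "- 1 / 2" and ?e5.0 = 0])
    fix x assume x: "x \<in> {exp (- s)<..<exp s}"
    show "x powi (- 3) * arcY s x ^ 1 = (0 * x + 0 + - 1 / 2 * (1 / x) + C * (1 / x ^ 2) + - 1 / 2 * (1 / x ^ 3) + 0 * (1 / x ^ 4)) / arcY s x"
      unfolding y1[OF x] using x0[OF x] y0[OF x] by (simp add: power_int_minus field_simps eval_nat_numeral)
  qed (simp add: C_def field_simps eval_nat_numeral)
  show "mom s (- 4) 1 = sqrt 2 * pi * ((cosh s ^ 3 - cosh s) / 4)"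
  proof (subst odd[where ?e0.0 = 0 and ?e1.0 = 0 and ?e2.0 = 0 and ?e3.0 = "- 1 / 2" and ?e4.0 = C and ?e5.0 = "- 1 / 2"])
    fix x assume x: "x \<in> {exp (- s)<..<exp s}"
    show "x powi (- 4) * arcY s x ^ 1 = (0 * x + 0 + 0 * (1 / x) + - 1 / 2 * (1 / x ^ 2) + C * (1 / x ^ 3) + - 1 / 2 * (1 / x ^ 4)) / arcY s x"
      unfolding y1[OF x] using x0[OF x] y0[OF x] by (simp add: power_int_minus field_simps eval_nat_numeral)
  qed (simp add: C_def field_simps eval_nat_numeral)
  show "mom s (- 3) 3 = sqrt 2 * pi * (3 / 8 * (cosh s - 1) ^ 2)"
  \<comment> \<open>The coefficients of \<open>((2 * C * x - x^2 - 1) / 2)^2 / x^3\<close>.\<close>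
  proof (subst odd[where ?e0.0 = "1 / 4" and ?e1.0 = "- C" and ?e2.0 = "C ^ 2 + 1 / 2" and ?e3.0 = "- C" and ?e4.0 = "1 / 4" and ?e5.0 = 0])
    fix x assume x: "x \<in> {exp (- s)<..<exp s}"
    show "x powi (- 3) * arcY s x ^ 3 = (1 / 4 * x + - C + (C ^ 2 + 1 / 2) * (1 / x) + - C * (1 / x ^ 2) + 1 / 4 * (1 / x ^ 3) + 0 * (1 / x ^ 4)) / arcY s x"
      unfolding y3[OF x] using x0[OF x] y0[OF x] by (simp add: power_int_minus field_simps eval_nat_numeral)
  qed (simp add: C_def field_simps eval_nat_numeral)
  show "mom s (- 4) 3 = sqrt 2 * pi * ((cosh s ^ 3 - 3 * cosh s + 2) / 8)"
  proof (subst odd[where ?e0.0 = 0 and ?e1.0 = "1 / 4" and ?e2.0 = "- C" and ?e3.0 = "C ^ 2 + 1 / 2" and ?e4.0 = "- C" and ?e5.0 = "1 / 4"])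
    fix x assume x: "x \<in> {exp (- s)<..<exp s}"
    show "x powi (- 4) * arcY s x ^ 3 = (0 * x + 1 / 4 + - C * (1 / x) + (C ^ 2 + 1 / 2) * (1 / x ^ 2) + - C * (1 / x ^ 3) + 1 / 4 * (1 / x ^ 4)) / arcY s x"
      unfolding y3[OF x] using x0[OF x] y0[OF x] by (simp add: power_int_minus field_simps eval_nat_numeral)
  qed (simp add: C_def field_simps eval_nat_numeral)
qed

section \<open>Angular parametrisations of half ellipses\<close>

lemma flow_parametrizationI:
  assumes D: "\<And>t. t \<in> {0..1} \<Longrightarrow> (\<gamma> has_vector_derivative D t) (at t)" "continuous_on {0..1} D"
    and "inj_on \<gamma> {0..1}" "\<gamma> ` {0<..<1} = \<Gamma>" "\<And>t. t \<in> {0<..<1} \<Longrightarrow> \<exists>c>0. D t = c *\<^sub>R X (\<gamma> t)"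
  shows "flow_parametrization X \<Gamma> \<gamma>"
proof -
  have "continuous_on {0..1} \<gamma>"
    by (rule continuous_on_vector_derivative) (rule has_vector_derivative_at_within[OF D(1)])
  then have "arc \<gamma>" using assms(3) by (simp add: arc_def path_def)
  moreover have "\<gamma> C1_differentiable_on {0..1}"
    unfolding C1_differentiable_on_def using D by blast
  moreover have "vector_derivative \<gamma> (at t) = D t" if "t \<in> {0<..<1}" for t
    using D(1)[of t] that by (intro vector_derivative_at) auto
  ultimately show ?thesis unfolding flow_parametrization_def using assms(4,5) by auto
qed

text \<open>The scalings \<open>A\<close>, \<open>B\<close> are \<open>1\<close>, \<open>1\<close>
  for the first system and \<open>cosh s\<close>, \<open>2\<close> for the second.\<close>

definition half_ellipse :: "real \<Rightarrow> real \<Rightarrow> real \<Rightarrow> real \<Rightarrow> (real \<times> real) set" where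
  "half_ellipse s A B \<sigma> = (\<lambda>x. (x, \<sigma> * (B * arcY s (x / A)))) ` {A * exp (- s)<..<A * exp s}"

text \<open>An angle is used because the graph over \<open>x\<close> has infinite slope at its ends.
  The sign in front of the cosine makes \<open>x\<close> grow on the upper arc and decrease on the
  lower one, as both flows demand.\<close>

definition ellipse_param :: "real \<Rightarrow> real \<Rightarrow> real \<Rightarrow> real \<Rightarrow> real \<Rightarrow> real \<times> real" where
  "ellipse_param s A B \<sigma> t = (A * (cosh s - \<sigma> * (sinh s * cos (pi * t))), B * (\<sigma> * (sinh s * sin (pi * t) / sqrt 2)))"

lemma arcY_cos:
  assumes "0 < s" "\<sigma> = 1 \<or> \<sigma> = - 1" "0 \<le> sin u"
  shows "arcY s (cosh s - \<sigma> * (sinh s * cos u)) = sinh s * sin u / sqrt 2"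
proof -
  have "2 * cosh s * (cosh s - \<sigma> * (sinh s * cos u)) - (cosh s - \<sigma> * (sinh s * cos u))\<^sup>2 - 1 = (sinh s * sin u)\<^sup>2"
    using sin_cos_squared_add[of u] cosh_square_eq[of s] assms(2) by algebra
  moreover have "0 \<le> sinh s * sin u" using assms by simp
  ultimately show ?thesis by (simp add: arcY_def real_sqrt_divide)
qed

lemma ellipse_param_image:
  assumes s: "0 < s" and \<sigma>: "\<sigma> = 1 \<or> \<sigma> = - 1" and A: "0 < A"
  shows "ellipse_param s A B \<sigma> ` {0<..<1} = half_ellipse s A B \<sigma>"
proof (intro equalityI subsetI)
  have S: "0 < sinh s" using s by simp
  have e: "exp s = cosh s + sinh s" "exp (- s) = cosh s - sinh s" by (simp_all only: cosh_plus_sinh cosh_minus_sinh)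
  {
    fix z assume "z \<in> ellipse_param s A B \<sigma> ` {0<..<1}"
    then obtain t where t: "0 < t" "t < 1" "z = ellipse_param s A B \<sigma> t" by auto
    have "0 < sin (pi * t)" using t by (intro sin_gt_zero) auto
    note Y = arcY_cos[OF s \<sigma> less_imp_le[OF this]]
    have "cos (pi * t) < 1" using cos_monotone_0_pi[of 0 "pi * t"] t by simp
    moreover have "- 1 < cos (pi * t)" using cos_monotone_0_pi[of "pi * t" pi] t by simp
    ultimately have "\<bar>\<sigma> * cos (pi * t)\<bar> < 1" using \<sigma> by auto
    then have "\<bar>sinh s * (\<sigma> * cos (pi * t))\<bar> < sinh s" using S by (simp add: abs_mult)
    then have "cosh s - \<sigma> * (sinh s * cos (pi * t)) \<in> {exp (- s)<..<exp s}"
      unfolding e by (auto simp: mult_ac abs_less_iff)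
    then have "A * (cosh s - \<sigma> * (sinh s * cos (pi * t))) \<in> {A * exp (- s)<..<A * exp s}"
      using A by simp
    then show "z \<in> half_ellipse s A B \<sigma>"
      unfolding half_ellipse_def t(3) ellipse_param_def using A by (intro image_eqI[rotated]) (auto simp: Y)
  next
    fix z assume "z \<in> half_ellipse s A B \<sigma>"
    then obtain x where x: "A * exp (- s) < x" "x < A * exp s" "z = (x, \<sigma> * (B * arcY s (x / A)))"
      unfolding half_ellipse_def by auto
    define w where "w = x / A"
    have w: "cosh s - sinh s < w" "w < cosh s + sinh s" "x = A * w"
      using x A unfolding e w_def by (simp_all add: field_simps)
    \<comment> \<open>The first coordinate solved for the cosine; \<open>\<sigma>\<close> is its own
      reciprocal.\<close>
    define c where "c = \<sigma> * (cosh s - w) / sinh s"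
    have c: "- 1 < c" "c < 1" using w S \<sigma> by (auto simp: c_def field_simps)
    define t where "t = arccos c / pi"
    have "0 < arccos c" "arccos c < pi" using arccos_lt_bounded[OF c] by auto
    then have t: "t \<in> {0<..<1}" by (simp add: t_def)
    have pt: "pi * t = arccos c" by (simp add: t_def)
    then have ct: "cos (pi * t) = c" using c by simp
    have "w = cosh s - \<sigma> * (sinh s * cos (pi * t))"
      unfolding ct c_def using S \<sigma> by auto
    moreover have "0 \<le> sin (pi * t)" using \<open>0 < arccos c\<close> \<open>arccos c < pi\<close> unfolding pt by (intro sin_ge_zero) auto
    ultimately have "z = ellipse_param s A B \<sigma> t"
      using arcY_cos[OF s \<sigma>, of "pi * t"] A unfolding x(3) w_def[symmetric] ellipse_param_def w(3) by simp
    then show "z \<in> ellipse_param s A B \<sigma> ` {0<..<1}" using t by blast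
  }
qed

text \<open>Ensures that the choice in \<open>arc_line_integral\<close> is not vacuous. The pair in
  the last hypothesis is the velocity at \<open>z = x / A\<close>:
  \<open>sinh s * sin (pi * t)\<close> is \<open>sqrt 2 * arcY s z\<close>, and
  \<open>\<sigma> * sinh s * cos (pi * t)\<close> is \<open>cosh s - z\<close>.\<close>

lemma flow_parametrization_ellipse_param:
  assumes s: "0 < s" and \<sigma>: "\<sigma> = 1 \<or> \<sigma> = - 1" and A: "0 < A"
    and X: "\<And>z. z \<in> {exp (- s)<..<exp s} \<Longrightarrow>
      \<exists>c>0. (A * \<sigma> * sqrt 2 * pi * arcY s z, B * (pi / sqrt 2) * (cosh s - z)) = c *\<^sub>R X (A * z, \<sigma> * (B * arcY s z))"
  shows "flow_parametrization X (half_ellipse s A B \<sigma>) (ellipse_param s A B \<sigma>)"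
proof (rule flow_parametrizationI)
  have S: "0 < sinh s" using s by simp
  define D where "D t = (A * (\<sigma> * (sinh s * (sin (pi * t) * pi))), B * (\<sigma> * (sinh s * (cos (pi * t) * pi) / sqrt 2)))" for t
  show "(ellipse_param s A B \<sigma> has_vector_derivative D t) (at t)" for t
  proof -
    have c: "((\<lambda>t. cos (pi * t)) has_real_derivative - (sin (pi * t) * pi)) (at t)"
      and d: "((\<lambda>t. sin (pi * t)) has_real_derivative cos (pi * t) * pi) (at t)"
      by (auto intro!: derivative_eq_intros)
    have 1: "((\<lambda>t. A * (cosh s - \<sigma> * (sinh s * cos (pi * t)))) has_real_derivative
      A * (0 - \<sigma> * (sinh s * - (sin (pi * t) * pi)))) (at t)"
      by (intro DERIV_cmult DERIV_diff DERIV_const c)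
    have 2: "((\<lambda>t. B * (\<sigma> * (sinh s * sin (pi * t) / sqrt 2))) has_real_derivative
      B * (\<sigma> * (sinh s * (cos (pi * t) * pi) / sqrt 2))) (at t)"
      by (intro DERIV_cmult DERIV_cdivide d)
    have "D t = (A * (0 - \<sigma> * (sinh s * - (sin (pi * t) * pi))), B * (\<sigma> * (sinh s * (cos (pi * t) * pi) / sqrt 2)))"
      by (simp add: D_def)
    then show ?thesis
      using has_vector_derivative_Pair[OF 1[unfolded has_real_derivative_iff_has_vector_derivative]
        2[unfolded has_real_derivative_iff_has_vector_derivative]]
      unfolding ellipse_param_def[abs_def] by (simp only:)
  qed
  show "continuous_on {0..1} D" unfolding D_def[abs_def] by (intro continuous_intros) auto
  show "inj_on (ellipse_param s A B \<sigma>) {0..1}"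
  proof (rule inj_onI)
    fix t u assume t: "t \<in> {0..1}" and u: "u \<in> {0..1}" and eq: "ellipse_param s A B \<sigma> t = ellipse_param s A B \<sigma> u"
    have "A * (cosh s - \<sigma> * (sinh s * cos (pi * t))) = A * (cosh s - \<sigma> * (sinh s * cos (pi * u)))"
      using arg_cong[OF eq, of fst] unfolding ellipse_param_def fst_conv .
    moreover have "\<sigma> \<noteq> 0" "A \<noteq> 0" "sinh s \<noteq> 0" using \<sigma> A S by auto
    ultimately have "cos (pi * t) = cos (pi * u)" by simp
    from cos_inj_pi[OF _ _ _ _ this] have "pi * t = pi * u" using t u by simp
    then show "t = u" by simp
  qed
  show im: "ellipse_param s A B \<sigma> ` {0<..<1} = half_ellipse s A B \<sigma>" by (rule ellipse_param_image[OF s \<sigma> A])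
  fix t :: real assume t: "t \<in> {0<..<1}"
  define z where "z = cosh s - \<sigma> * (sinh s * cos (pi * t))"
  have "0 < sin (pi * t)" using t by (intro sin_gt_zero) auto
  note Y = arcY_cos[OF s \<sigma> less_imp_le[OF this], folded z_def]
  have g: "ellipse_param s A B \<sigma> t = (A * z, \<sigma> * (B * arcY s z))"
    unfolding Y by (simp add: ellipse_param_def z_def)
  have "ellipse_param s A B \<sigma> t \<in> half_ellipse s A B \<sigma>" unfolding im[symmetric] using t by (rule imageI)
  then have "A * z \<in> {A * exp (- s)<..<A * exp s}" unfolding g half_ellipse_def by (elim imageE) (simp only: prod.inject)
  then have "z \<in> {exp (- s)<..<exp s}" using A by simp
  from X[OF this] obtain c where c: "c > 0"
    "(A * \<sigma> * sqrt 2 * pi * arcY s z, B * (pi / sqrt 2) * (cosh s - z)) = c *\<^sub>R X (A * z, \<sigma> * (B * arcY s z))"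
    by (elim exE conjE)
  have Dt: "D t = (A * \<sigma> * sqrt 2 * pi * arcY s z, B * (pi / sqrt 2) * (cosh s - z))"
  proof -
    have "cosh s - z = \<sigma> * (sinh s * cos (pi * t))" by (simp add: z_def)
    then show ?thesis unfolding Y D_def by simp
  qed
  show "\<exists>c>0. D t = c *\<^sub>R X (ellipse_param s A B \<sigma> t)"
    unfolding g Dt by (intro exI[of _ c] conjI c)
qed

text \<open>Read componentwise, the velocity condition supplies both the direction of
  \<open>x\<close> and the slope of the graph, so the evaluation applies to every
  parametrisation.\<close>

lemma path_line_integral_half_ellipse:
  assumes s: "0 < s" and \<sigma>: "\<sigma> = 1 \<or> \<sigma> = - 1" and A: "0 < A" and B: "0 < B"
    and X: "\<And>z. z \<in> {exp (- s)<..<exp s} \<Longrightarrow>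
      \<exists>c>0. (A * \<sigma> * sqrt 2 * pi * arcY s z, B * (pi / sqrt 2) * (cosh s - z)) = c *\<^sub>R X (A * z, \<sigma> * (B * arcY s z))"
    and fp: "flow_parametrization X (half_ellipse s A B \<sigma>) \<gamma>"
  shows "path_line_integral \<gamma> (\<lambda>z. fst z powi (- k - 1) * quad_poly b z) (\<lambda>z. - (fst z powi (- k - 1) * quad_poly a z))
    = arc_value k (moment (A * exp (- s)) (A * exp s) (\<lambda>x. B * arcY s (x / A))) \<sigma> a b"
proof (rule path_line_integral_quad_poly[OF fp half_ellipse_def _ _ \<sigma>])
  show "0 < A * exp (- s)" "A * exp (- s) < A * exp s" using A s by simp_all
  show "continuous_on {A * exp (- s)..A * exp s} (\<lambda>x. B * arcY s (x / A))"
    using A by (intro continuous_intros continuous_on_compose2[OF continuous_arcY]) auto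
  show "B * arcY s (A * exp (- s) / A) = 0" "B * arcY s (A * exp s / A) = 0" using A by (simp_all add: arcY_endpoints)
  fix x assume x: "x \<in> {A * exp (- s)<..<A * exp s}"
  define z where "z = x / A"
  have z: "z \<in> {exp (- s)<..<exp s}" "x = A * z" using x A by (auto simp: z_def field_simps)
  note y = arcY_pos[OF s z(1)]
  show "((\<lambda>x. B * arcY s (x / A)) has_real_derivative B * ((cosh s - x / A) / (2 * arcY s (x / A)) * (1 / A))) (at x)"
    by (intro DERIV_cmult DERIV_chain2[OF DERIV_arcY[OF s]] DERIV_cdivide DERIV_ident) (use z(1) in \<open>simp add: z_def\<close>)
  from X[OF z(1)] obtain c where c: "c > 0"
    "A * \<sigma> * sqrt 2 * pi * arcY s z = c * fst (X (A * z, \<sigma> * (B * arcY s z)))"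
    "B * (pi / sqrt 2) * (cosh s - z) = c * snd (X (A * z, \<sigma> * (B * arcY s z)))"
    by (auto simp: prod_eq_iff)
  have xz: "(x, \<sigma> * (B * arcY s z)) = (A * z, \<sigma> * (B * arcY s z))" "x / A = z"
    unfolding z_def using A by simp_all
  have f: "fst (X (A * z, \<sigma> * (B * arcY s z))) = A * \<sigma> * sqrt 2 * pi * arcY s z / c"
    and g: "snd (X (A * z, \<sigma> * (B * arcY s z))) = B * (pi / sqrt 2) * (cosh s - z) / c"
    using c by (simp_all add: field_simps)
  have "\<sigma> * (A * \<sigma> * sqrt 2 * pi * arcY s z / c) = A * sqrt 2 * pi * arcY s z / c" using \<sigma> by auto
  also have "\<dots> > 0" using A y c(1) by simp
  finally show "0 < \<sigma> * fst (X (x, \<sigma> * (B * arcY s (x / A))))"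
    unfolding xz f .
  have "sqrt 2 * sqrt 2 = (2::real)" by simp
  then have h: "pi / sqrt 2 = pi * (sqrt 2 / 2)" by (simp add: field_simps)
  show "snd (X (x, \<sigma> * (B * arcY s (x / A)))) = \<sigma> * (B * ((cosh s - x / A) / (2 * arcY s (x / A)) * (1 / A))) * fst (X (x, \<sigma> * (B * arcY s (x / A))))"
    unfolding xz f g h using \<sigma> y A c(1) by (elim disjE) (simp_all add: field_simps)
qed


section \<open>Level curves of the two systems\<close>

text \<open>The quadratic equation confines \<open>x\<close> to the interval: its left side is
  positive because \<open>y \<noteq> 0\<close>, and the radicand is positive only between the
  endpoints. So the arc lies in \<open>x > 0\<close> automatically.\<close>

lemma mem_half_ellipse:
  assumes s: "0 < s" and \<sigma>: "\<sigma> = 1 \<or> \<sigma> = - 1" and A: "0 < A" and B: "0 < B"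
  shows "(x, y) \<in> half_ellipse s A B \<sigma> \<longleftrightarrow> 0 < \<sigma> * y \<and> (y / B)\<^sup>2 = (2 * cosh s * (x / A) - (x / A)\<^sup>2 - 1) / 2"
proof
  assume "(x, y) \<in> half_ellipse s A B \<sigma>"
  then have x: "A * exp (- s) < x" "x < A * exp s" and y: "y = \<sigma> * (B * arcY s (x / A))"
    by (auto simp: half_ellipse_def)
  have z: "x / A \<in> {exp (- s)<..<exp s}" using x A by (simp add: field_simps)
  have ss: "\<sigma> * \<sigma> = 1" using \<sigma> by auto
  have "\<sigma> * y = \<sigma> * \<sigma> * (B * arcY s (x / A))" unfolding y by simp
  then have 1: "0 < \<sigma> * y" using B arcY_pos[OF s z] unfolding ss by simp
  have "(y / B)\<^sup>2 = \<sigma> * \<sigma> * (arcY s (x / A) * arcY s (x / A))" unfolding y power2_eq_square using B by simp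
  then show "0 < \<sigma> * y \<and> (y / B)\<^sup>2 = (2 * cosh s * (x / A) - (x / A)\<^sup>2 - 1) / 2"
    using 1 unfolding ss arcY_sq[OF s z] by simp
next
  assume *: "0 < \<sigma> * y \<and> (y / B)\<^sup>2 = (2 * cosh s * (x / A) - (x / A)\<^sup>2 - 1) / 2"
  then have "y \<noteq> 0" by auto
  then have "0 < (y / B)\<^sup>2" using B by simp
  then have z: "x / A \<in> {exp (- s)<..<exp s}" using * arcY_radicand_pos_iff[OF s, of "x / A"] by simp
  then have x: "x \<in> {A * exp (- s)<..<A * exp s}" using A by (simp add: field_simps)
  have "(\<sigma> * y / B)\<^sup>2 = (y / B)\<^sup>2" using \<sigma> by auto
  then have "arcY s (x / A) = \<sigma> * y / B"
    unfolding arcY_def using * B by (intro real_sqrt_unique) auto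
  then have "y = \<sigma> * (B * arcY s (x / A))" using B \<sigma> by auto
  then show "(x, y) \<in> half_ellipse s A B \<sigma>"
    unfolding half_ellipse_def using x by blast
qed

text \<open>The angular parametrisation shows that a choice exists; its value is then the one common
  to all parametrisations.\<close>

lemma arc_line_integral_half_ellipse:
  assumes s: "0 < s" and \<sigma>: "\<sigma> = 1 \<or> \<sigma> = - 1" and A: "0 < A" and B: "0 < B"
    and X: "\<And>z. z \<in> {exp (- s)<..<exp s} \<Longrightarrow>
      \<exists>c>0. (A * \<sigma> * sqrt 2 * pi * arcY s z, B * (pi / sqrt 2) * (cosh s - z)) = c *\<^sub>R X (A * z, \<sigma> * (B * arcY s z))"
  shows "arc_line_integral X (half_ellipse s A B \<sigma>) (\<lambda>z. fst z powi (- k - 1) * quad_poly b z)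
      (\<lambda>z. - (fst z powi (- k - 1) * quad_poly a z))
    = arc_value k (moment (A * exp (- s)) (A * exp s) (\<lambda>x. B * arcY s (x / A))) \<sigma> a b"
  unfolding arc_line_integral_def
  by (rule path_line_integral_half_ellipse[OF s \<sigma> A B X
        someI[of "flow_parametrization X (half_ellipse s A B \<sigma>)", OF flow_parametrization_ellipse_param[OF s \<sigma> A X]]])

lemma pi_div_sqrt_2: "pi / sqrt 2 = pi * sqrt 2 / 2"
proof -
  have "sqrt 2 * sqrt 2 = (2::real)" by simp
  then show ?thesis by (simp add: field_simps)
qed

text \<open>On the arc \<open>1 - x^2 + 2 y^2 = 2 x (cosh s - x)\<close>, so the angular
  parametrisation moves with \<open>pi / x\<close> times the field.\<close>

lemma S1_field_half_ellipse:
  assumes s: "0 < s" and z: "z \<in> {exp (- s)<..<exp s}" and \<sigma>: "\<sigma> = 1 \<or> \<sigma> = - 1"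
  shows "\<exists>c>0. (1 * \<sigma> * sqrt 2 * pi * arcY s z, 1 * (pi / sqrt 2) * (cosh s - z)) = c *\<^sub>R S1_field (1 * z, \<sigma> * (1 * arcY s z))"
proof (intro exI conjI)
  have z0: "0 < z" using z exp_gt_zero[of "- s"] by (auto intro: less_trans simp del: exp_gt_zero)
  show "0 < pi / z" using z0 by simp
  have "(\<sigma> * arcY s z)\<^sup>2 = arcY s z * arcY s z" using \<sigma> by (auto simp: power2_eq_square)
  also note arcY_sq[OF s z]
  finally have "1 - z\<^sup>2 + 2 * (\<sigma> * arcY s z)\<^sup>2 = 2 * z * (cosh s - z)"
    by (simp add: algebra_simps power2_eq_square)
  then show "(1 * \<sigma> * sqrt 2 * pi * arcY s z, 1 * (pi / sqrt 2) * (cosh s - z)) = (pi / z) *\<^sub>R S1_field (1 * z, \<sigma> * (1 * arcY s z))"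
    unfolding S1_field_def pi_div_sqrt_2 using z0 by simp
qed

text \<open>The factor is again \<open>pi / z\<close>, now with \<open>z = x / cosh s\<close>: on
  the arc \<open>2 - 2 x + y^2 = 2 z (cosh s - z)\<close>.\<close>

lemma S2_field_half_ellipse:
  assumes s: "0 < s" and z: "z \<in> {exp (- s)<..<exp s}" and \<sigma>: "\<sigma> = 1 \<or> \<sigma> = - 1"
  shows "\<exists>c>0. (cosh s * \<sigma> * sqrt 2 * pi * arcY s z, 2 * (pi / sqrt 2) * (cosh s - z)) = c *\<^sub>R S2_field (cosh s * z, \<sigma> * (2 * arcY s z))"
proof (intro exI conjI)
  have z0: "0 < z" using z exp_gt_zero[of "- s"] by (auto intro: less_trans simp del: exp_gt_zero)
  show "0 < pi / z" using z0 by simp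
  have "(\<sigma> * (2 * arcY s z))\<^sup>2 = 4 * (arcY s z * arcY s z)" using \<sigma> by (auto simp: power2_eq_square)
  also note arcY_sq[OF s z]
  finally have "2 - 2 * (cosh s * z) + (\<sigma> * (2 * arcY s z))\<^sup>2 = 2 * z * (cosh s - z)"
    by (simp add: algebra_simps power2_eq_square)
  then show "(cosh s * \<sigma> * sqrt 2 * pi * arcY s z, 2 * (pi / sqrt 2) * (cosh s - z)) = (pi / z) *\<^sub>R S2_field (cosh s * z, \<sigma> * (2 * arcY s z))"
    unfolding S2_field_def pi_div_sqrt_2 using z0 by simp
qed

lemma S1_level:
  "x \<noteq> 0 \<and> S1_H (x, y) = (cosh s - 1) / 2 \<longleftrightarrow> (y / 1)\<^sup>2 = (2 * cosh s * (x / 1) - (x / 1)\<^sup>2 - 1) / 2"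
\<comment> \<open>At \<open>x = 0\<close> the left side fails by its first conjunct, the right side
  because it would read \<open>y^2 = - 1 / 2\<close>.\<close>
proof (cases "x = 0")
  case True
  have "0 \<le> y\<^sup>2" by simp
  then have "y\<^sup>2 \<noteq> - 1 / 2" by linarith
  with True show ?thesis by simp
next
  case False
  then show ?thesis by (simp add: S1_H_def divide_eq_eq) (auto simp: algebra_simps)
qed

text \<open>Multiplying by \<open>x^2\<close> cancels the term \<open>x^2\<close> of the first
  integral; in the coordinates \<open>x / cosh s\<close> and \<open>y / 2\<close> what remains is
  the ellipse of the first system.\<close>

lemma S2_level:
  "x \<noteq> 0 \<and> S2_H (x, y) = 1 - 1 / (cosh s)\<^sup>2 \<longleftrightarrow> (y / 2)\<^sup>2 = (2 * cosh s * (x / cosh s) - (x / cosh s)\<^sup>2 - 1) / 2"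
proof (cases "x = 0")
  case True
  have "0 \<le> (y / 2)\<^sup>2" by simp
  then have "(y / 2)\<^sup>2 \<noteq> - 1 / 2" by linarith
  with True show ?thesis by simp
next
  case False
  have "(y\<^sup>2 / 2 + x\<^sup>2 - 2 * x + 1) / x\<^sup>2 = 1 - 1 / (cosh s)\<^sup>2 \<longleftrightarrow> y\<^sup>2 / 2 + x\<^sup>2 - 2 * x + 1 = x\<^sup>2 - x\<^sup>2 / (cosh s)\<^sup>2"
    by (subst divide_eq_eq) (simp add: left_diff_distrib False)
  also have "\<dots> \<longleftrightarrow> (y / 2)\<^sup>2 = (2 * cosh s * (x / cosh s) - (x / cosh s)\<^sup>2 - 1) / 2"
    by (simp add: power_divide) (auto simp: algebra_simps)
  finally show ?thesis using False by (simp add: S2_H_def)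
qed

lemma S1_arcs:
  assumes "0 < s"
  shows "upper_arc S1_H ((cosh s - 1) / 2) = half_ellipse s 1 1 1"
    "lower_arc S1_H ((cosh s - 1) / 2) = half_ellipse s 1 1 (- 1)"
proof -
  have "(x, y) \<in> upper_arc S1_H ((cosh s - 1) / 2) \<longleftrightarrow> (x, y) \<in> half_ellipse s 1 1 1"
    "(x, y) \<in> lower_arc S1_H ((cosh s - 1) / 2) \<longleftrightarrow> (x, y) \<in> half_ellipse s 1 1 (- 1)" for x y
    using mem_half_ellipse[OF assms, of _ 1 1 x y] S1_level[of x y s]
    by (auto simp: upper_arc_def lower_arc_def)
  then show "upper_arc S1_H ((cosh s - 1) / 2) = half_ellipse s 1 1 1"
    "lower_arc S1_H ((cosh s - 1) / 2) = half_ellipse s 1 1 (- 1)" by auto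
qed

lemma S2_arcs:
  assumes "0 < s"
  shows "upper_arc S2_H (1 - 1 / (cosh s)\<^sup>2) = half_ellipse s (cosh s) 2 1"
    "lower_arc S2_H (1 - 1 / (cosh s)\<^sup>2) = half_ellipse s (cosh s) 2 (- 1)"
proof -
  have "(x, y) \<in> upper_arc S2_H (1 - 1 / (cosh s)\<^sup>2) \<longleftrightarrow> (x, y) \<in> half_ellipse s (cosh s) 2 1"
    "(x, y) \<in> lower_arc S2_H (1 - 1 / (cosh s)\<^sup>2) \<longleftrightarrow> (x, y) \<in> half_ellipse s (cosh s) 2 (- 1)" for x y
    using mem_half_ellipse[OF assms, of _ "cosh s" 2 x y] S2_level[of x y s]
    by (auto simp: upper_arc_def lower_arc_def)
  then show "upper_arc S2_H (1 - 1 / (cosh s)\<^sup>2) = half_ellipse s (cosh s) 2 1"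
    "lower_arc S2_H (1 - 1 / (cosh s)\<^sup>2) = half_ellipse s (cosh s) 2 (- 1)" by auto
qed

text \<open>The moments of the arcs of the second system, by \<open>moment_scale\<close> with
  \<open>C = cosh s\<close>.\<close>

definition mom2 :: "real \<Rightarrow> int \<Rightarrow> nat \<Rightarrow> real" where
  "mom2 s n j = cosh s powi (n + 1) * 2 ^ j * mom s n j"

lemma M1_eq_arc_value:
  assumes s: "0 < s"
  shows "M1 ap bp am bm ((cosh s - 1) / 2) = arc_value 1 (mom s) 1 ap bp + arc_value 1 (mom s) (- 1) am bm"
  unfolding M1_def abelian_integral_def S1_arcs[OF s]
proof -
  have "arc_line_integral S1_field (half_ellipse s 1 1 \<sigma>) (\<lambda>z. fst z powi (- 1 - 1) * quad_poly b z)
      (\<lambda>z. - (fst z powi (- 1 - 1) * quad_poly a z))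
    = arc_value 1 (moment (1 * exp (- s)) (1 * exp s) (\<lambda>x. 1 * arcY s (x / 1))) \<sigma> a b"
    if "\<sigma> = 1 \<or> \<sigma> = - 1" for \<sigma> a b
    by (rule arc_line_integral_half_ellipse[OF s that _ _ S1_field_half_ellipse[OF s _ that]]) simp_all
  note v = this[unfolded mult_1 div_by_1]
  show "arc_line_integral S1_field (half_ellipse s 1 1 1) (\<lambda>z. fst z powi (- 1 - 1) * quad_poly bp z)
      (\<lambda>z. - (fst z powi (- 1 - 1) * quad_poly ap z)) +
    arc_line_integral S1_field (half_ellipse s 1 1 (- 1)) (\<lambda>z. fst z powi (- 1 - 1) * quad_poly bm z)
      (\<lambda>z. - (fst z powi (- 1 - 1) * quad_poly am z)) = arc_value 1 (mom s) 1 ap bp + arc_value 1 (mom s) (- 1) am bm"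
    by (subst (1 2) v) simp_all
qed

lemma M2_eq_arc_value:
  assumes s: "0 < s"
  shows "M2 ap bp am bm (1 - 1 / (cosh s)\<^sup>2) = arc_value 2 (mom2 s) 1 ap bp + arc_value 2 (mom2 s) (- 1) am bm"
proof -
  have "moment (cosh s * exp (- s)) (cosh s * exp s) (\<lambda>x. 2 * arcY s (x / cosh s)) n j = mom2 s n j" for n j
    unfolding mom2_def using s by (intro moment_scale continuous_arcY) auto
  then have m: "moment (cosh s * exp (- s)) (cosh s * exp s) (\<lambda>x. 2 * arcY s (x / cosh s)) = mom2 s"
    by (intro ext)
  have v: "arc_line_integral S2_field (half_ellipse s (cosh s) 2 \<sigma>) (\<lambda>z. fst z powi (- 2 - 1) * quad_poly b z)
      (\<lambda>z. - (fst z powi (- 2 - 1) * quad_poly a z)) = arc_value 2 (mom2 s) \<sigma> a b"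
    if "\<sigma> = 1 \<or> \<sigma> = - 1" for \<sigma> a b
    unfolding m[symmetric]
    by (rule arc_line_integral_half_ellipse[OF s that _ _ S2_field_half_ellipse[OF s _ that]]) simp_all
  show ?thesis
    unfolding M2_def abelian_integral_def S2_arcs[OF s]
    by (subst (1 2) v) simp_all
qed

section \<open>Reflection of the first system in the \<open>y\<close>-axis\<close>

definition mirror :: "real \<times> real \<Rightarrow> real \<times> real" where "mirror z = (- fst z, snd z)"

lemma mirror_mirror [simp]: "mirror (mirror z) = z" by (simp add: mirror_def)

lemma bounded_linear_mirror: "bounded_linear mirror"
  unfolding mirror_def[abs_def] by (intro bounded_linear_Pair bounded_linear_minus bounded_linear_fst bounded_linear_snd)

lemma C1_has_vector_derivative:
  "\<gamma> C1_differentiable_on S \<Longrightarrow> t \<in> S \<Longrightarrow> (\<gamma> has_vector_derivative vector_derivative \<gamma> (at t)) (at t)"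
  by (simp add: C1_differentiable_on_eq vector_derivative_works)

text \<open>The reflection commutes with the field, whose first component is odd and whose second is
  even in \<open>x\<close>; hence it respects the orientation by the flow.\<close>

lemma flow_parametrization_mirror:
  assumes "flow_parametrization S1_field \<Gamma> \<gamma>"
  shows "flow_parametrization S1_field (mirror ` \<Gamma>) (\<lambda>t. mirror (\<gamma> t))"
proof (rule flow_parametrizationI[where D = "\<lambda>t. mirror (vector_derivative \<gamma> (at t))"])
  note a = assms[unfolded flow_parametrization_def]
  show "((\<lambda>t. mirror (\<gamma> t)) has_vector_derivative mirror (vector_derivative \<gamma> (at t))) (at t)" if "t \<in> {0..1}" for t
    using a that by (intro bounded_linear.has_vector_derivative[OF bounded_linear_mirror] C1_has_vector_derivative) auto
  have "continuous_on {0..1} (\<lambda>t. vector_derivative \<gamma> (at t))"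
    using a by (simp add: C1_differentiable_on_eq)
  then show "continuous_on {0..1} (\<lambda>t. mirror (vector_derivative \<gamma> (at t)))"
    by (rule bounded_linear.continuous_on[OF bounded_linear_mirror])
  show "inj_on (\<lambda>t. mirror (\<gamma> t)) {0..1}"
    using a by (metis (mono_tags, lifting) arc_def inj_on_def mirror_mirror)
  show "(\<lambda>t. mirror (\<gamma> t)) ` {0<..<1} = mirror ` \<Gamma>"
    using a by (metis image_image)
  fix t :: real assume "t \<in> {0<..<1}"
  then obtain c where c: "c > 0" "vector_derivative \<gamma> (at t) = c *\<^sub>R S1_field (\<gamma> t)"
    using a by blast
  have "mirror (c *\<^sub>R S1_field (\<gamma> t)) = c *\<^sub>R S1_field (mirror (\<gamma> t))"
    by (cases "\<gamma> t") (simp add: mirror_def S1_field_def)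
  with c show "\<exists>c>0. mirror (vector_derivative \<gamma> (at t)) = c *\<^sub>R S1_field (mirror (\<gamma> t))" by metis
qed

lemma path_line_integral_mirror:
  assumes "\<gamma> C1_differentiable_on {0..1}"
  shows "path_line_integral (\<lambda>t. mirror (\<gamma> t)) P Q = path_line_integral \<gamma> (\<lambda>z. - P (mirror z)) (\<lambda>z. Q (mirror z))"
  unfolding path_line_integral_def
proof (rule integral_cong)
  fix t :: real assume "t \<in> {0..1}"
  then have "vector_derivative (\<lambda>t. mirror (\<gamma> t)) (at t) = mirror (vector_derivative \<gamma> (at t))"
    by (intro vector_derivative_at bounded_linear.has_vector_derivative[OF bounded_linear_mirror]
      C1_has_vector_derivative[OF assms])
  then show "P (mirror (\<gamma> t)) * fst (vector_derivative (\<lambda>t. mirror (\<gamma> t)) (at t)) +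
      Q (mirror (\<gamma> t)) * snd (vector_derivative (\<lambda>t. mirror (\<gamma> t)) (at t)) =
    - P (mirror (\<gamma> t)) * fst (vector_derivative \<gamma> (at t)) + Q (mirror (\<gamma> t)) * snd (vector_derivative \<gamma> (at t))"
    by (simp add: mirror_def)
qed

lemma quad_poly_mirror: "quad_poly a (mirror z) = quad_poly (\<lambda>i j. (- 1) ^ i * a i j) z"
  unfolding quad_poly_def mirror_def split_beta
  by (intro sum.cong refl) (simp add: power_minus[of "fst z"])

text \<open>The parametrisation selected on the reflected arc is reflected back to the half ellipse,
  where every parametrisation has been evaluated. The weight \<open>x powi (- 2)\<close> is even,
  while \<open>dx\<close> changes sign; hence \<open>Suc i\<close> in the signs of
  \<open>b\<close>.\<close>

lemma arc_line_integral_mirror_half_ellipse: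
  assumes s: "0 < s" and \<sigma>: "\<sigma> = 1 \<or> \<sigma> = - 1"
  shows "arc_line_integral S1_field (mirror ` half_ellipse s 1 1 \<sigma>) (\<lambda>z. fst z powi (- 1 - 1) * quad_poly b z)
      (\<lambda>z. - (fst z powi (- 1 - 1) * quad_poly a z))
    = arc_value 1 (mom s) \<sigma> (\<lambda>i j. (- 1) ^ i * a i j) (\<lambda>i j. (- 1) ^ Suc i * b i j)"
proof -
  define \<gamma> where "\<gamma> = (SOME \<gamma>. flow_parametrization S1_field (mirror ` half_ellipse s 1 1 \<sigma>) \<gamma>)"
  have "flow_parametrization S1_field (half_ellipse s 1 1 \<sigma>) (ellipse_param s 1 1 \<sigma>)"
    by (rule flow_parametrization_ellipse_param[OF s \<sigma> _ S1_field_half_ellipse[OF s _ \<sigma>]]) simp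
  from someI[of "flow_parametrization S1_field (mirror ` half_ellipse s 1 1 \<sigma>)", OF flow_parametrization_mirror[OF this]]
  have "flow_parametrization S1_field (mirror ` half_ellipse s 1 1 \<sigma>) \<gamma>" unfolding \<gamma>_def .
  from flow_parametrization_mirror[OF this]
  have fp: "flow_parametrization S1_field (half_ellipse s 1 1 \<sigma>) (\<lambda>t. mirror (\<gamma> t))"
    by (simp add: image_image)
  then have C1: "(\<lambda>t. mirror (\<gamma> t)) C1_differentiable_on {0..1}" by (simp add: flow_parametrization_def)
  have p: "(- x) powi (- 1 - 1) = x powi (- 1 - 1)" for x :: real by (simp add: power_int_minus)
  have "arc_line_integral S1_field (mirror ` half_ellipse s 1 1 \<sigma>) (\<lambda>z. fst z powi (- 1 - 1) * quad_poly b z)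
      (\<lambda>z. - (fst z powi (- 1 - 1) * quad_poly a z)) =
    path_line_integral (\<lambda>t. mirror (mirror (\<gamma> t))) (\<lambda>z. fst z powi (- 1 - 1) * quad_poly b z)
      (\<lambda>z. - (fst z powi (- 1 - 1) * quad_poly a z))"
    unfolding arc_line_integral_def \<gamma>_def[symmetric] by simp
  also have "\<dots> = path_line_integral (\<lambda>t. mirror (\<gamma> t)) (\<lambda>z. fst z powi (- 1 - 1) * quad_poly (\<lambda>i j. (- 1) ^ Suc i * b i j) z)
      (\<lambda>z. - (fst z powi (- 1 - 1) * quad_poly (\<lambda>i j. (- 1) ^ i * a i j) z))"
  proof -
    have "- (fst (mirror z) powi (- 1 - 1) * quad_poly b (mirror z)) = fst z powi (- 1 - 1) * quad_poly (\<lambda>i j. (- 1) ^ Suc i * b i j) z"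
      "- (fst (mirror z) powi (- 1 - 1) * quad_poly a (mirror z)) = - (fst z powi (- 1 - 1) * quad_poly (\<lambda>i j. (- 1) ^ i * a i j) z)" for z
    proof -
      have f: "fst (mirror z) powi (- 1 - 1) = fst z powi (- 1 - 1)" by (simp only: mirror_def fst_conv p)
      show "- (fst (mirror z) powi (- 1 - 1) * quad_poly a (mirror z)) = - (fst z powi (- 1 - 1) * quad_poly (\<lambda>i j. (- 1) ^ i * a i j) z)"
        unfolding f quad_poly_mirror ..
      have q: "- quad_poly b (mirror z) = quad_poly (\<lambda>i j. (- 1) ^ Suc i * b i j) z"
        unfolding quad_poly_mirror by (simp add: quad_poly_def split_beta sum_negf)
      show "- (fst (mirror z) powi (- 1 - 1) * quad_poly b (mirror z)) = fst z powi (- 1 - 1) * quad_poly (\<lambda>i j. (- 1) ^ Suc i * b i j) z"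
        unfolding f q[symmetric] by (rule mult_minus_right[symmetric])
    qed
    then show ?thesis unfolding path_line_integral_mirror[OF C1] by presburger
  qed
  also have "\<dots> = arc_value 1 (moment (1 * exp (- s)) (1 * exp s) (\<lambda>x. 1 * arcY s (x / 1))) \<sigma>
      (\<lambda>i j. (- 1) ^ i * a i j) (\<lambda>i j. (- 1) ^ Suc i * b i j)"
    by (rule path_line_integral_half_ellipse[OF s \<sigma> _ _ S1_field_half_ellipse[OF s _ \<sigma>] fp]) simp_all
  finally show ?thesis by simp
qed

text \<open>The source of the pairing of \<open>h < - 1\<close> with
  \<open>- 1 - h > 0\<close>.\<close>

lemma S1_H_mirror: "x \<noteq> 0 \<Longrightarrow> S1_H (- x, y) = - 1 - S1_H (x, y)"
  by (simp add: S1_H_def field_simps)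

lemma S1_arcs_mirror:
  "upper_arc S1_H (- 1 - h) = mirror ` upper_arc S1_H h"
  "lower_arc S1_H (- 1 - h) = mirror ` lower_arc S1_H h"
proof -
  have "z \<in> upper_arc S1_H (- 1 - h) \<longleftrightarrow> mirror z \<in> upper_arc S1_H h"
    "z \<in> lower_arc S1_H (- 1 - h) \<longleftrightarrow> mirror z \<in> lower_arc S1_H h" for z
    by (cases z, use S1_H_mirror[of "fst z" "snd z"] in \<open>auto simp: upper_arc_def lower_arc_def mirror_def\<close>)+
  then show "upper_arc S1_H (- 1 - h) = mirror ` upper_arc S1_H h"
    "lower_arc S1_H (- 1 - h) = mirror ` lower_arc S1_H h"
    by (auto simp: image_iff) (metis mirror_mirror)+
qed

lemma M1_neg_eq_arc_value:
  assumes s: "0 < s"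
  shows "M1 ap bp am bm (- 1 - (cosh s - 1) / 2) =
    arc_value 1 (mom s) 1 (\<lambda>i j. (- 1) ^ i * ap i j) (\<lambda>i j. (- 1) ^ Suc i * bp i j) +
    arc_value 1 (mom s) (- 1) (\<lambda>i j. (- 1) ^ i * am i j) (\<lambda>i j. (- 1) ^ Suc i * bm i j)"
  unfolding M1_def abelian_integral_def S1_arcs_mirror S1_arcs[OF s]
  by (subst (1 2) arc_line_integral_mirror_half_ellipse[OF s]) auto


section \<open>Bounds for the Abelian integrals\<close>

lemma sum_quad: "(\<Sum>i\<le>2. \<Sum>j\<le>2 - i. f i j) = f 0 0 + f 0 1 + f 0 2 + f 1 0 + f 1 1 + f 2 0" for f :: "nat \<Rightarrow> nat \<Rightarrow> real"
  by (simp add: numeral_2_eq_2)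

text \<open>As \<open>\<sigma> * \<sigma> ^ j\<close> is \<open>1\<close> for odd \<open>j\<close>
  and \<open>\<sigma>\<close> for even \<open>j\<close>, the coefficients of \<open>dx\<close> enter
  as sums for odd and differences for even \<open>j\<close>; integration by parts reverses this for
  \<open>dy\<close>. The coefficient \<open>a 2 0\<close> drops out because its form
  \<open>dy\<close> is exact.\<close>

lemma arc_value_1_add:
  "arc_value 1 m 1 a b + arc_value 1 m (- 1) a' b' =
    (b 0 0 - b' 0 0) * m (- 2) 0 + (b 0 1 + b' 0 1) * m (- 2) 1 + (b 0 2 - b' 0 2) * m (- 2) 2
    + (b 1 0 - b' 1 0) * m (- 1) 0 + (b 1 1 + b' 1 1) * m (- 1) 1 + (b 2 0 - b' 2 0) * m 0 0
    - 2 * (a 0 0 + a' 0 0) * m (- 3) 1 - (a 0 1 - a' 0 1) * m (- 3) 2 - 2 / 3 * (a 0 2 + a' 0 2) * m (- 3) 3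
    - (a 1 0 + a' 1 0) * m (- 2) 1 - 1 / 2 * (a 1 1 - a' 1 1) * m (- 2) 2"
  unfolding arc_value_def sum_quad by (simp add: algebra_simps numeral_2_eq_2 numeral_3_eq_3)

lemma arc_value_2_add:
  "arc_value 2 m 1 a b + arc_value 2 m (- 1) a' b' =
    (b 0 0 - b' 0 0) * m (- 3) 0 + (b 0 1 + b' 0 1) * m (- 3) 1 + (b 0 2 - b' 0 2) * m (- 3) 2
    + (b 1 0 - b' 1 0) * m (- 2) 0 + (b 1 1 + b' 1 1) * m (- 2) 1 + (b 2 0 - b' 2 0) * m (- 1) 0
    - 3 * (a 0 0 + a' 0 0) * m (- 4) 1 - 3 / 2 * (a 0 1 - a' 0 1) * m (- 4) 2 - (a 0 2 + a' 0 2) * m (- 4) 3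
    - 2 * (a 1 0 + a' 1 0) * m (- 3) 1 - (a 1 1 - a' 1 1) * m (- 3) 2 - (a 2 0 + a' 2 0) * m (- 2) 1"
  unfolding arc_value_def sum_quad by (simp add: algebra_simps numeral_2_eq_2 numeral_3_eq_3)

text \<open>Even powers of \<open>y\<close> feed the first four coefficients, odd ones the last two.
  The moment with \<open>cosh s ^ 2 - 1\<close> is split as
  \<open>(cosh s - 1)^2 + 2 * (cosh s - 1)\<close>.\<close>

lemma arc_values_S1:
  assumes s: "0 < s"
  shows "arc_value 1 (mom s) 1 ap bp + arc_value 1 (mom s) (- 1) am bm =
    S1_comb (2 * (bp 0 0 - bm 0 0) - 2 * (bp 0 2 - bm 0 2) + 2 * (bp 2 0 - bm 2 0) + (ap 1 1 - am 1 1))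
       (- (ap 0 1 - am 0 1))
       (2 * (bp 1 0 - bm 1 0) + (ap 0 1 - am 0 1))
       (2 * (bp 0 2 - bm 0 2) - (ap 1 1 - am 1 1))
       (sqrt 2 * pi / 2 * (bp 0 1 + bm 0 1 + (bp 1 1 + bm 1 1) - (ap 1 0 + am 1 0) - 2 * (ap 0 0 + am 0 0)))
       (- (sqrt 2 * pi / 2 * (ap 0 0 + am 0 0)) - sqrt 2 * pi / 4 * (ap 0 2 + am 0 2)) s"
proof -
  define k where "k = sqrt 2 * pi"
  show ?thesis
    unfolding arc_value_1_add mom_values[OF s] S1_comb_def k_def[symmetric]
    by (simp add: field_simps power2_eq_square)
qed

text \<open>With \<open>q = 1 / cosh s\<close>, the last moment is a multiple of
  \<open>1 - 3 q^2 + 2 q^3\<close>, expressible by the functions \<open>1 - q^i\<close> because its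
  coefficients add up to zero.\<close>

lemma mom2_values:
  assumes s: "0 < s"
  shows "mom2 s (- 1) 0 = 2 * s" "mom2 s (- 2) 0 = 2 * (sinh s / cosh s)"
    "mom2 s (- 3) 0 = 2 * (sinh s / cosh s)"
    "mom2 s (- 3) 2 = 4 * (sinh s / cosh s) - 4 * s + 4 * (s * (sinh s / cosh s)\<^sup>2)"
    "mom2 s (- 4) 2 = 8 / 3 * (sinh s / cosh s) ^ 3"
    "mom2 s (- 2) 1 = sqrt 2 * pi * (1 - 1 / cosh s)"
    "mom2 s (- 3) 1 = sqrt 2 * pi / 2 * (1 - 1 / (cosh s)\<^sup>2)"
    "mom2 s (- 4) 1 = sqrt 2 * pi / 2 * (1 - 1 / (cosh s)\<^sup>2)"
    "mom2 s (- 4) 3 = sqrt 2 * pi * (3 * (1 - 1 / (cosh s)\<^sup>2) - 2 * (1 - 1 / cosh s ^ 3))"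
proof -
  define C where "C = cosh s"
  define S where "S = sinh s"
  have C: "C > 0" by (simp add: C_def)
  have sq: "S\<^sup>2 = C\<^sup>2 - 1" by (simp add: C_def S_def cosh_square_eq)
  have p: "C powi (- 1) = 1 / C" "C powi (- 2) = 1 / C ^ 2" "C powi (- 3) = 1 / C ^ 3"
    by (simp_all add: power_int_minus inverse_eq_divide)
  have sh: "mom2 s (- 1) j = 2 ^ j * mom s (- 1) j" "mom2 s (- 2) j = C powi (- 1) * 2 ^ j * mom s (- 2) j"
    "mom2 s (- 3) j = C powi (- 2) * 2 ^ j * mom s (- 3) j" "mom2 s (- 4) j = C powi (- 3) * 2 ^ j * mom s (- 4) j" for j
    by (simp_all add: mom2_def C_def)
  note v = sh[unfolded p] mom_values[OF s, folded C_def S_def]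
  show "mom2 s (- 1) 0 = 2 * s" "mom2 s (- 2) 0 = 2 * (sinh s / cosh s)"
    "mom2 s (- 3) 0 = 2 * (sinh s / cosh s)"
    "mom2 s (- 4) 2 = 8 / 3 * (sinh s / cosh s) ^ 3"
    "mom2 s (- 2) 1 = sqrt 2 * pi * (1 - 1 / cosh s)"
    "mom2 s (- 3) 1 = sqrt 2 * pi / 2 * (1 - 1 / (cosh s)\<^sup>2)"
    "mom2 s (- 4) 1 = sqrt 2 * pi / 2 * (1 - 1 / (cosh s)\<^sup>2)"
    "mom2 s (- 4) 3 = sqrt 2 * pi * (3 * (1 - 1 / (cosh s)\<^sup>2) - 2 * (1 - 1 / cosh s ^ 3))"
    unfolding C_def[symmetric] S_def[symmetric] v using C by (simp_all add: field_simps eval_nat_numeral)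
  \<comment> \<open>The summand \<open>s / cosh s ^ 2\<close> is
    \<open>s - s * (sinh s / cosh s) ^ 2\<close>, a combination of two basis functions.\<close>
  show "mom2 s (- 3) 2 = 4 * (sinh s / cosh s) - 4 * s + 4 * (s * (sinh s / cosh s)\<^sup>2)"
    unfolding C_def[symmetric] S_def[symmetric] v power_divide sq using C by (simp add: field_simps eval_nat_numeral)
qed

lemma arc_values_S2:
  assumes s: "0 < s"
  shows "arc_value 2 (mom2 s) 1 ap bp + arc_value 2 (mom2 s) (- 1) am bm =
    S2_comb (2 * (bp 0 0 - bm 0 0) + 2 * (bp 1 0 - bm 1 0) + 4 * (bp 0 2 - bm 0 2) - 4 * (ap 1 1 - am 1 1))
       (- 4 * (ap 0 1 - am 0 1))
       (2 * (bp 2 0 - bm 2 0) - 4 * (bp 0 2 - bm 0 2) + 4 * (ap 1 1 - am 1 1))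
       (4 * (bp 0 2 - bm 0 2) - 4 * (ap 1 1 - am 1 1))
       (sqrt 2 * pi * (bp 1 1 + bm 1 1 - (ap 2 0 + am 2 0)))
       (sqrt 2 * pi / 2 * (bp 0 1 + bm 0 1 - 3 * (ap 0 0 + am 0 0) - 2 * (ap 1 0 + am 1 0)) - 3 * (sqrt 2 * pi) * (ap 0 2 + am 0 2))
       (2 * (sqrt 2 * pi) * (ap 0 2 + am 0 2)) s"
proof -
  define k where "k = sqrt 2 * pi"
  define T where "T = sinh s / cosh s"
  define u where "u i = 1 - 1 / cosh s ^ i" for i
  have u: "1 - 1 / cosh s = u 1" "1 - 1 / (cosh s)\<^sup>2 = u 2" "1 - 1 / cosh s ^ 3 = u 3" by (simp_all add: u_def)
  show ?thesis
    unfolding arc_value_2_add mom2_values[OF s] S2_comb_def k_def[symmetric] T_def[symmetric] u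
    by (simp add: field_simps)
qed

section \<open>Transfer to the energy variable and sharpness\<close>

lemma smooth_arcosh: "smooth arcosh {1<..}"
proof (rule smoothI)
  show "(arcosh has_real_derivative inverse (sqrt (x\<^sup>2 - 1))) (at x)" if "x \<in> {1<..}" for x :: real
    using arcosh_real_has_field_derivative[of x UNIV] that by (simp add: inverse_eq_divide)
  have p: "0 < x\<^sup>2 - 1" if "x \<in> {1<..}" for x :: real
    using that by simp
  have "sqrt (x\<^sup>2 - 1) \<noteq> 0" if "x \<in> {1<..}" for x :: real
    by (metis p[OF that] less_irrefl real_sqrt_eq_zero_cancel_iff)
  with p show "smooth (\<lambda>x. inverse (sqrt (x\<^sup>2 - 1))) {1<..}"
    by (intro smooth_inverse smooth_compose[OF _ _ smooth_sqrt] smooth_intros) auto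
qed simp

text \<open>\<open>h\<close> parametrises the energies by \<open>s > 0\<close> and \<open>g\<close>
  inverts it: \<open>g\<close> transports smoothness to \<open>M p\<close>, and \<open>h\<close>
  pulls the zeros of \<open>M p\<close> back to \<open>s\<close>. \<open>MF\<close> is what the
  bound needs; \<open>FM\<close>, that every coefficient vector is realised, is what sharpness
  needs.\<close>

lemma zeros_bound_sharp:
  fixes M :: "'p \<Rightarrow> real \<Rightarrow> real" and F :: "(nat \<Rightarrow> real) \<Rightarrow> real \<Rightarrow> real"
  assumes L: "open L" and sh: "smooth h {0<..}" and sg: "smooth g L"
    and h: "\<And>s. 0 < s \<Longrightarrow> h s \<in> L \<and> g (h s) = s" and g: "\<And>x. x \<in> L \<Longrightarrow> 0 < g x \<and> h (g x) = x"
    and MF: "\<And>p. \<exists>c. \<forall>s>0. M p (h s) = F c s" and FM: "\<And>c. \<exists>p. \<forall>s>0. M p (h s) = F c s"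
    and F: "\<And>c s. F c s = (\<Sum>i<Suc n. c i * v i s)"
    and sF: "\<And>c. smooth (F c) {0<..}"
    and z: "\<And>c. \<exists>i<Suc n. c i \<noteq> 0 \<Longrightarrow> zeros_le {0<..} n (F c)"
  shows "(\<forall>p. (\<exists>x\<in>L. M p x \<noteq> 0) \<longrightarrow> zeros_with_multiplicity (M p) L \<le> enat n) \<and>
    (\<exists>p. zeros_with_multiplicity (M p) L = enat n)"
proof -
  have bij: "bij_betw h {0<..} L"
    by (rule bij_betw_byWitness[where f' = g]) (use h g in auto)
  \<comment> \<open>Stated for a nonzero coefficient vector instead of a nonzero value of
    \<open>M p\<close>, so that it also bounds the count for the extremal example.\<close>
  have bound: "zeros_with_multiplicity (M p) L \<le> enat n"
    if c: "\<exists>i<Suc n. c i \<noteq> 0" and p: "\<forall>s>0. M p (h s) = F c s" for p c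
  proof (rule zeros_with_multiplicity_le)
    show sM: "smooth (M p) L"
    proof (rule smooth_cong[OF L])
      show "smooth (\<lambda>x. F c (g x)) L"
        by (rule smooth_compose[OF L _ sF sg]) (use g in auto)
      show "F c (g x) = M p x" if "x \<in> L" for x
        using g[OF that] p by metis
    qed
    have "zeros_le {0<..} n (\<lambda>s. M p (h s))"
      by (rule zeros_le_cong[OF _ _ z[OF c]]) (use p in auto)
    then show "zeros_le L n (M p)"
      by (intro zeros_le_compose[OF open_greaterThan L sh bij sM])
  qed
  have "zeros_with_multiplicity (M p) L \<le> enat n" if x: "x \<in> L" "M p x \<noteq> 0" for p x
  proof -
    obtain c where c: "\<forall>s>0. M p (h s) = F c s" using MF by blast
    have "F c (g x) \<noteq> 0" using x g[OF x(1)] c by metis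
    then have "\<exists>i<Suc n. c i \<noteq> 0"
      unfolding F by (metis (no_types, lifting) lessThan_iff mult_zero_left sum.neutral)
    then show ?thesis using bound c by blast
  qed
  moreover have "\<exists>p. zeros_with_multiplicity (M p) L = enat n"
  proof -
    \<comment> \<open>Any \<open>n\<close> distinct positive numbers would do; the upper bound then
      leaves no room for further zeros.\<close>
    define T where "T = (\<lambda>k. real (Suc k)) ` {..<n}"
    have T: "finite T" "card T = n" "T \<subseteq> {0<..}"
      by (auto simp: T_def card_image inj_on_def)
    obtain c where c: "\<exists>i<Suc n. c i \<noteq> 0" "\<forall>t\<in>T. (\<Sum>i<Suc n. c i * v i t) = 0"
      using nontrivial_combination_vanishing[OF T(1), of "Suc n" v] T(2) by auto
    obtain p where p: "\<forall>s>0. M p (h s) = F c s" using FM by blast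
    have "inj_on h T" using bij T(3) by (metis bij_betw_def inj_on_subset)
    then have "card (h ` T) = n" by (simp add: card_image T(2))
    moreover have "enat (card (h ` T)) \<le> zeros_with_multiplicity (M p) L"
    proof (rule zeros_with_multiplicity_ge_card)
      show "h ` T \<subseteq> L" using h T(3) by auto
      fix x assume "x \<in> h ` T"
      then obtain t where t: "t \<in> T" "x = h t" by blast
      then have "M p x = F c t" using p T(3) by auto
      also have "\<dots> = 0" using c(2) t(1) by (simp only: F)
      finally show "M p x = 0" .
    qed (use T in simp)
    ultimately show ?thesis using bound[OF c(1) p] by (metis order_antisym)
  qed
  ultimately show ?thesis by blast
qed

definition S1_basis :: "nat \<Rightarrow> real \<Rightarrow> real" where
  "S1_basis i s = [sinh s, cosh s * sinh s, s, s * cosh s, cosh s - 1, (cosh s - 1)\<^sup>2] ! i"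

definition S2_basis :: "nat \<Rightarrow> real \<Rightarrow> real" where
  "S2_basis i s = [sinh s / cosh s, (sinh s / cosh s) ^ 3, s, s * (sinh s / cosh s)\<^sup>2, 1 - 1 / cosh s,
     1 - 1 / (cosh s)\<^sup>2, 1 - 1 / cosh s ^ 3] ! i"

lemma ex_less_Suc: "(\<exists>i<Suc n. P i) \<longleftrightarrow> P n \<or> (\<exists>i<n. P i)"
  by (auto simp: less_Suc_eq)

lemma zeros_bound_sharp_S1:
  fixes M :: "'p \<Rightarrow> real \<Rightarrow> real"
  assumes "open L" "smooth h {0<..}" "smooth g L"
    "\<And>s. 0 < s \<Longrightarrow> h s \<in> L \<and> g (h s) = s" "\<And>x. x \<in> L \<Longrightarrow> 0 < g x \<and> h (g x) = x"
    and MF: "\<And>p. \<exists>a1 a2 a3 a4 a5 a6. \<forall>s>0. M p (h s) = S1_comb a1 a2 a3 a4 a5 a6 s"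
    and FM: "\<And>a1 a2 a3 a4 a5 a6. \<exists>p. \<forall>s>0. M p (h s) = S1_comb a1 a2 a3 a4 a5 a6 s"
  shows "(\<forall>p. (\<exists>x\<in>L. M p x \<noteq> 0) \<longrightarrow> zeros_with_multiplicity (M p) L \<le> 5) \<and>
    (\<exists>p. zeros_with_multiplicity (M p) L = 5)"
proof -
  have "(\<forall>p. (\<exists>x\<in>L. M p x \<noteq> 0) \<longrightarrow> zeros_with_multiplicity (M p) L \<le> enat 5) \<and>
    (\<exists>p. zeros_with_multiplicity (M p) L = enat 5)"
  proof (rule zeros_bound_sharp[OF assms(1-5), where F = "\<lambda>c. S1_comb (c 0) (c 1) (c 2) (c 3) (c 4) (c 5)" and v = S1_basis])
    show "\<exists>c :: nat \<Rightarrow> real. \<forall>s>0. M p (h s) = S1_comb (c 0) (c 1) (c 2) (c 3) (c 4) (c 5) s" for p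
    proof -
      obtain a1 a2 a3 a4 a5 a6 where "\<forall>s>0. M p (h s) = S1_comb a1 a2 a3 a4 a5 a6 s" using MF by blast
      then show ?thesis by (intro exI[of _ "\<lambda>i::nat. [a1, a2, a3, a4, a5, a6] ! i"]) simp
    qed
    show "\<exists>p. \<forall>s>0. M p (h s) = S1_comb (c 0) (c 1) (c 2) (c 3) (c 4) (c 5) s" for c :: "nat \<Rightarrow> real"
      by (rule FM)
    show "S1_comb (c 0) (c 1) (c 2) (c 3) (c 4) (c 5) s = (\<Sum>i<Suc 5. c i * S1_basis i s)" for c s
      by (simp add: S1_comb_def S1_basis_def eval_nat_numeral)
    show "smooth (S1_comb (c 0) (c 1) (c 2) (c 3) (c 4) (c 5)) {0<..}" for c :: "nat \<Rightarrow> real"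
      by (rule smooth_S1_comb) simp
    show "zeros_le {0<..} 5 (S1_comb (c 0) (c 1) (c 2) (c 3) (c 4) (c 5))" if "\<exists>i<Suc 5. c i \<noteq> 0" for c :: "nat \<Rightarrow> real"
    proof (rule zeros_le_S1_comb)
      from that have "\<exists>i<Suc (Suc (Suc (Suc (Suc (Suc 0))))). c i \<noteq> 0" by (simp add: eval_nat_numeral)
      then show "c 0 \<noteq> 0 \<or> c 1 \<noteq> 0 \<or> c 2 \<noteq> 0 \<or> c 3 \<noteq> 0 \<or> c 4 \<noteq> 0 \<or> c 5 \<noteq> 0"
        unfolding ex_less_Suc by (auto simp: eval_nat_numeral)
    qed
  qed
  then show ?thesis by (simp add: numeral_eq_enat)
qed

lemma zeros_bound_sharp_S2:
  fixes M :: "'p \<Rightarrow> real \<Rightarrow> real"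
  assumes "open L" "smooth h {0<..}" "smooth g L"
    "\<And>s. 0 < s \<Longrightarrow> h s \<in> L \<and> g (h s) = s" "\<And>x. x \<in> L \<Longrightarrow> 0 < g x \<and> h (g x) = x"
    and MF: "\<And>p. \<exists>b1 b2 b3 b4 b5 b6 b7. \<forall>s>0. M p (h s) = S2_comb b1 b2 b3 b4 b5 b6 b7 s"
    and FM: "\<And>b1 b2 b3 b4 b5 b6 b7. \<exists>p. \<forall>s>0. M p (h s) = S2_comb b1 b2 b3 b4 b5 b6 b7 s"
  shows "(\<forall>p. (\<exists>x\<in>L. M p x \<noteq> 0) \<longrightarrow> zeros_with_multiplicity (M p) L \<le> 6) \<and>
    (\<exists>p. zeros_with_multiplicity (M p) L = 6)"
proof -
  have "(\<forall>p. (\<exists>x\<in>L. M p x \<noteq> 0) \<longrightarrow> zeros_with_multiplicity (M p) L \<le> enat 6) \<and>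
    (\<exists>p. zeros_with_multiplicity (M p) L = enat 6)"
  proof (rule zeros_bound_sharp[OF assms(1-5), where F = "\<lambda>c. S2_comb (c 0) (c 1) (c 2) (c 3) (c 4) (c 5) (c 6)" and v = S2_basis])
    show "\<exists>c :: nat \<Rightarrow> real. \<forall>s>0. M p (h s) = S2_comb (c 0) (c 1) (c 2) (c 3) (c 4) (c 5) (c 6) s" for p
    proof -
      obtain b1 b2 b3 b4 b5 b6 b7 where "\<forall>s>0. M p (h s) = S2_comb b1 b2 b3 b4 b5 b6 b7 s" using MF by blast
      then show ?thesis by (intro exI[of _ "\<lambda>i::nat. [b1, b2, b3, b4, b5, b6, b7] ! i"]) simp
    qed
    show "\<exists>p. \<forall>s>0. M p (h s) = S2_comb (c 0) (c 1) (c 2) (c 3) (c 4) (c 5) (c 6) s" for c :: "nat \<Rightarrow> real"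
      by (rule FM)
    show "S2_comb (c 0) (c 1) (c 2) (c 3) (c 4) (c 5) (c 6) s = (\<Sum>i<Suc 6. c i * S2_basis i s)" for c s
      by (simp add: S2_comb_def S2_basis_def eval_nat_numeral)
    show "smooth (S2_comb (c 0) (c 1) (c 2) (c 3) (c 4) (c 5) (c 6)) {0<..}" for c :: "nat \<Rightarrow> real"
      by (rule smooth_S2_comb) simp
    show "zeros_le {0<..} 6 (S2_comb (c 0) (c 1) (c 2) (c 3) (c 4) (c 5) (c 6))" if "\<exists>i<Suc 6. c i \<noteq> 0" for c :: "nat \<Rightarrow> real"
    proof (rule zeros_le_S2_comb)
      from that have "\<exists>i<Suc (Suc (Suc (Suc (Suc (Suc (Suc 0)))))). c i \<noteq> 0" by (simp add: eval_nat_numeral)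
      then show "c 0 \<noteq> 0 \<or> c 1 \<noteq> 0 \<or> c 2 \<noteq> 0 \<or> c 3 \<noteq> 0 \<or> c 4 \<noteq> 0 \<or> c 5 \<noteq> 0 \<or> c 6 \<noteq> 0"
        unfolding ex_less_Suc by (auto simp: eval_nat_numeral)
    qed
  qed
  then show ?thesis by (simp add: numeral_eq_enat)
qed

section \<open>Realisation of arbitrary coefficient vectors and conclusion\<close>

definition quad_coeffs :: "real \<Rightarrow> real \<Rightarrow> real \<Rightarrow> real \<Rightarrow> real \<Rightarrow> real \<Rightarrow> nat \<Rightarrow> nat \<Rightarrow> real" where
  "quad_coeffs c00 c01 c02 c10 c11 c20 i j = [[c00, c01, c02], [c10, c11], [c20]] ! i ! j"

lemma quad_coeffs_simps [simp]:
  "quad_coeffs c00 c01 c02 c10 c11 c20 0 0 = c00" "quad_coeffs c00 c01 c02 c10 c11 c20 0 (Suc 0) = c01"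
  "quad_coeffs c00 c01 c02 c10 c11 c20 0 2 = c02" "quad_coeffs c00 c01 c02 c10 c11 c20 (Suc 0) 0 = c10"
  "quad_coeffs c00 c01 c02 c10 c11 c20 (Suc 0) (Suc 0) = c11" "quad_coeffs c00 c01 c02 c10 c11 c20 2 0 = c20"
  by (simp_all add: quad_coeffs_def)

text \<open>The upper arc alone reaches the whole span: with zero lower coefficients the formulas of
  \<open>arc_values_S1\<close> form a triangular system, solved here.\<close>

lemma arc_values_S1_surj:
  "\<exists>a b. \<forall>s>0. arc_value 1 (mom s) 1 a b + arc_value 1 (mom s) (- 1) (\<lambda>_ _. 0) (\<lambda>_ _. 0) = S1_comb a1 a2 a3 a4 a5 a6 s"
proof (intro exI allI impI)
  fix s :: real assume "s > 0"
  show "arc_value 1 (mom s) 1 (quad_coeffs 0 (- a2) (- 4 * a6 / (sqrt 2 * pi)) 0 0 0)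
      (quad_coeffs ((a1 + a4) / 2) 0 (a4 / 2) ((a3 + a2) / 2) (2 * a5 / (sqrt 2 * pi)) 0)
    + arc_value 1 (mom s) (- 1) (\<lambda>_ _. 0) (\<lambda>_ _. 0) = S1_comb a1 a2 a3 a4 a5 a6 s"
    unfolding arc_values_S1[OF \<open>s > 0\<close>] by (simp add: add_divide_distrib)
qed

text \<open>The signs produced by the reflection square to one, so the coefficients found for
  \<open>h > 0\<close> work with the same signs inserted in advance.\<close>

lemma M1_neg_surj:
  "\<exists>p. \<forall>s>0. (case p of (ap, bp, am, bm) \<Rightarrow> M1 ap bp am bm) (- 1 - (cosh s - 1) / 2) = S1_comb a1 a2 a3 a4 a5 a6 s"
proof -
  obtain a b where ab: "\<forall>s>0. arc_value 1 (mom s) 1 a b + arc_value 1 (mom s) (- 1) (\<lambda>_ _. 0) (\<lambda>_ _. 0) = S1_comb a1 a2 a3 a4 a5 a6 s"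
    using arc_values_S1_surj by blast
  have e: "(- 1) ^ i * ((- 1) ^ i * x) = x" "(- 1) ^ Suc i * ((- 1) ^ Suc i * x) = x" for i and x :: real
    by (simp_all add: mult.assoc[symmetric] power_mult_distrib[symmetric])
  show ?thesis
  proof (intro exI[of _ "(\<lambda>i j. (- 1) ^ i * a i j, \<lambda>i j. (- 1) ^ Suc i * b i j, \<lambda>_ _. 0, \<lambda>_ _. 0)"] allI impI)
    fix s :: real assume s: "0 < s"
    show "(case (\<lambda>i j. (- 1) ^ i * a i j, \<lambda>i j. (- 1) ^ Suc i * b i j, \<lambda>_ _. 0, \<lambda>_ _. 0) of (ap, bp, am, bm) \<Rightarrow> M1 ap bp am bm)
      (- 1 - (cosh s - 1) / 2) = S1_comb a1 a2 a3 a4 a5 a6 s"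
      unfolding prod.case M1_neg_eq_arc_value[OF s] e mult_zero_right using ab s by blast
  qed
qed

text \<open>Here \<open>b7\<close> determines \<open>a 0 2\<close>, whose contribution
  \<open>- 3 / 2 * b7\<close> to the sixth coefficient is compensated in
  \<open>b 0 1\<close>.\<close>

lemma arc_values_S2_surj:
  "\<exists>a b. \<forall>s>0. arc_value 2 (mom2 s) 1 a b + arc_value 2 (mom2 s) (- 1) (\<lambda>_ _. 0) (\<lambda>_ _. 0) = S2_comb b1 b2 b3 b4 b5 b6 b7 s"
proof (intro exI allI impI)
  fix s :: real assume "s > 0"
  show "arc_value 2 (mom2 s) 1 (quad_coeffs 0 (- b2 / 4) (b7 / (2 * (sqrt 2 * pi))) 0 0 0)
      (quad_coeffs ((b1 - b4) / 2) ((2 * b6 + 3 * b7) / (sqrt 2 * pi)) (b4 / 4) 0 (b5 / (sqrt 2 * pi)) ((b3 + b4) / 2))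
    + arc_value 2 (mom2 s) (- 1) (\<lambda>_ _. 0) (\<lambda>_ _. 0) = S2_comb b1 b2 b3 b4 b5 b6 b7 s"
    unfolding arc_values_S2[OF \<open>s > 0\<close>] by (simp add: add_divide_distrib diff_divide_distrib distrib_left)
qed

lemma cosh_gt_1: "0 < s \<Longrightarrow> 1 < cosh s" for s :: real
  by (metis cosh_0 cosh_real_strict_mono order_refl)

text \<open>The four coefficient families form one tuple, the parameter \<open>p\<close> of the
  general bound. On the level \<open>x\<close>, \<open>cosh s\<close> is
  \<open>1 + 2 * x\<close>.\<close>

lemma M1_bound_pos:
  defines "M \<equiv> \<lambda>(ap, bp, am, bm). M1 ap bp am bm"
  shows "(\<forall>p. (\<exists>x\<in>{0<..}. M p x \<noteq> 0) \<longrightarrow> zeros_with_multiplicity (M p) {0<..} \<le> 5) \<and>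
    (\<exists>p. zeros_with_multiplicity (M p) {0<..} = 5)"
proof (rule zeros_bound_sharp_S1[where h = "\<lambda>s. (cosh s - 1) / 2" and g = "\<lambda>x. arcosh (1 + 2 * x)"])
  show "smooth (\<lambda>s. (cosh s - 1) / 2 :: real) {0<..}" by (intro smooth_intros) auto
  show "smooth (\<lambda>x. arcosh (1 + 2 * x) :: real) {0<..}"
    by (rule smooth_compose[OF _ _ smooth_arcosh]) (auto intro!: smooth_intros)
  show "(cosh s - 1) / 2 \<in> {0<..} \<and> arcosh (1 + 2 * ((cosh s - 1) / 2)) = s" if "0 < s" for s :: real
    using cosh_gt_1[OF that] that by (simp add: arcosh_cosh_real diff_divide_distrib)
  show "0 < arcosh (1 + 2 * x) \<and> (cosh (arcosh (1 + 2 * x)) - 1) / 2 = x" if "x \<in> {0<..}" for x :: real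
    using that by (simp add: cosh_arcosh_real)
  show "\<exists>a1 a2 a3 a4 a5 a6. \<forall>s>0. M p ((cosh s - 1) / 2) = S1_comb a1 a2 a3 a4 a5 a6 s" for p
  proof -
    obtain ap bp am bm where p: "p = (ap, bp, am, bm)" by (cases p)
    show ?thesis unfolding M_def p prod.case
      by (intro exI allI impI, subst M1_eq_arc_value, assumption, rule arc_values_S1)
  qed
  show "\<exists>p. \<forall>s>0. M p ((cosh s - 1) / 2) = S1_comb a1 a2 a3 a4 a5 a6 s" for a1 a2 a3 a4 a5 a6
  proof -
    obtain a b where "\<forall>s>0. arc_value 1 (mom s) 1 a b + arc_value 1 (mom s) (- 1) (\<lambda>_ _. 0) (\<lambda>_ _. 0) = S1_comb a1 a2 a3 a4 a5 a6 s"
      using arc_values_S1_surj by blast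
    then show ?thesis unfolding M_def
      by (intro exI[of _ "(a, b, \<lambda>_ _. 0, \<lambda>_ _. 0)"]) (simp add: M1_eq_arc_value)
  qed
qed simp

text \<open>The reflected level is \<open>- 1 - x\<close>, so that
  \<open>cosh s = 1 + 2 * (- 1 - x) = - 1 - 2 * x\<close>.\<close>

lemma M1_bound_neg:
  defines "M \<equiv> \<lambda>(ap, bp, am, bm). M1 ap bp am bm"
  shows "(\<forall>p. (\<exists>x\<in>{..<- 1}. M p x \<noteq> 0) \<longrightarrow> zeros_with_multiplicity (M p) {..<- 1} \<le> 5) \<and>
    (\<exists>p. zeros_with_multiplicity (M p) {..<- 1} = 5)"
proof (rule zeros_bound_sharp_S1[where h = "\<lambda>s. - 1 - (cosh s - 1) / 2" and g = "\<lambda>x. arcosh (- 1 - 2 * x)"])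
  show "smooth (\<lambda>s. - 1 - (cosh s - 1) / 2 :: real) {0<..}" by (intro smooth_intros) auto
  show "smooth (\<lambda>x. arcosh (- 1 - 2 * x) :: real) {..<- 1}"
    by (rule smooth_compose[OF _ _ smooth_arcosh]) (auto intro!: smooth_intros)
  show "- 1 - (cosh s - 1) / 2 \<in> {..<- 1} \<and> arcosh (- 1 - 2 * (- 1 - (cosh s - 1) / 2)) = s" if "0 < s" for s :: real
  proof -
    have "- 1 - 2 * (- 1 - (cosh s - 1) / 2) = cosh s" by (simp add: diff_divide_distrib)
    then show ?thesis using cosh_gt_1[OF that] that by (simp add: arcosh_cosh_real)
  qed
  show "0 < arcosh (- 1 - 2 * x) \<and> - 1 - (cosh (arcosh (- 1 - 2 * x)) - 1) / 2 = x" if "x \<in> {..<- 1}" for x :: real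
    using that by (simp add: cosh_arcosh_real diff_divide_distrib)
  show "\<exists>a1 a2 a3 a4 a5 a6. \<forall>s>0. M p (- 1 - (cosh s - 1) / 2) = S1_comb a1 a2 a3 a4 a5 a6 s" for p
  proof -
    obtain ap bp am bm where p: "p = (ap, bp, am, bm)" by (cases p)
    show ?thesis unfolding M_def p prod.case
      by (intro exI allI impI, subst M1_neg_eq_arc_value, assumption, rule arc_values_S1)
  qed
  show "\<exists>p. \<forall>s>0. M p (- 1 - (cosh s - 1) / 2) = S1_comb a1 a2 a3 a4 a5 a6 s" for a1 a2 a3 a4 a5 a6
    unfolding M_def by (rule M1_neg_surj)
qed simp

text \<open>The inverse substitution solves \<open>x = 1 - 1 / cosh s ^ 2\<close> for
  \<open>cosh s\<close>.\<close>

lemma M2_bound: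
  defines "M \<equiv> \<lambda>(ap, bp, am, bm). M2 ap bp am bm"
  shows "(\<forall>p. (\<exists>x\<in>{0<..<1}. M p x \<noteq> 0) \<longrightarrow> zeros_with_multiplicity (M p) {0<..<1} \<le> 6) \<and>
    (\<exists>p. zeros_with_multiplicity (M p) {0<..<1} = 6)"
proof (rule zeros_bound_sharp_S2[where h = "\<lambda>s. 1 - 1 / (cosh s)\<^sup>2" and g = "\<lambda>x. arcosh (1 / sqrt (1 - x))"])
  show "smooth (\<lambda>s. 1 - 1 / (cosh s)\<^sup>2 :: real) {0<..}" by (intro smooth_intros) auto
  have gt: "1 < 1 / sqrt (1 - x)" if "x \<in> {0<..<1}" for x :: real
    using that by (simp add: less_divide_eq)
  show "smooth (\<lambda>x. arcosh (1 / sqrt (1 - x)) :: real) {0<..<1}"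
  proof (rule smooth_compose[OF _ _ smooth_arcosh])
    show "smooth (\<lambda>x. 1 / sqrt (1 - x) :: real) {0<..<1}"
      by (intro smooth_divide smooth_const smooth_compose[OF _ _ smooth_sqrt] smooth_diff smooth_ident) auto
  qed (use gt in auto)
  show "1 - 1 / (cosh s)\<^sup>2 \<in> {0<..<1} \<and> arcosh (1 / sqrt (1 - (1 - 1 / (cosh s)\<^sup>2))) = s" if "0 < s" for s :: real
  proof -
    have C: "1 < cosh s" by (rule cosh_gt_1[OF that])
    then have "1 < (cosh s)\<^sup>2" by simp
    moreover have "1 / sqrt (1 - (1 - 1 / (cosh s)\<^sup>2)) = cosh s"
      using C by (simp add: real_sqrt_divide)
    ultimately show ?thesis using that by (simp add: arcosh_cosh_real)
  qed
  show "0 < arcosh (1 / sqrt (1 - x)) \<and> 1 - 1 / (cosh (arcosh (1 / sqrt (1 - x))))\<^sup>2 = x" if x: "x \<in> {0<..<1}" for x :: real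
  proof -
    have "cosh (arcosh (1 / sqrt (1 - x))) = 1 / sqrt (1 - x)"
      using gt[OF x] by (intro cosh_arcosh_real) simp
    moreover have "0 < arcosh (1 / sqrt (1 - x))" using gt[OF x] x by simp
    ultimately show ?thesis using x by (simp add: power_divide)
  qed
  show "\<exists>b1 b2 b3 b4 b5 b6 b7. \<forall>s>0. M p (1 - 1 / (cosh s)\<^sup>2) = S2_comb b1 b2 b3 b4 b5 b6 b7 s" for p
  proof -
    obtain ap bp am bm where p: "p = (ap, bp, am, bm)" by (cases p)
    show ?thesis unfolding M_def p prod.case
      by (intro exI allI impI, subst M2_eq_arc_value, assumption, rule arc_values_S2)
  qed
  show "\<exists>p. \<forall>s>0. M p (1 - 1 / (cosh s)\<^sup>2) = S2_comb b1 b2 b3 b4 b5 b6 b7 s" for b1 b2 b3 b4 b5 b6 b7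
  proof -
    obtain a b where "\<forall>s>0. arc_value 2 (mom2 s) 1 a b + arc_value 2 (mom2 s) (- 1) (\<lambda>_ _. 0) (\<lambda>_ _. 0) = S2_comb b1 b2 b3 b4 b5 b6 b7 s"
      using arc_values_S2_surj by blast
    then show ?thesis unfolding M_def
      by (intro exI[of _ "(a, b, \<lambda>_ _. 0, \<lambda>_ _. 0)"]) (simp add: M2_eq_arc_value)
  qed
qed simp

theorem theorem1p3:
  "(\<forall>L\<in>{{..< -1}, {0<..}}.
      (\<forall>ap bp am bm. (\<exists>h\<in>L. M1 ap bp am bm h \<noteq> 0) \<longrightarrow>
         zeros_with_multiplicity (M1 ap bp am bm) L \<le> 5) \<and>
      (\<exists>ap bp am bm. zeros_with_multiplicity (M1 ap bp am bm) L = 5))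
   \<and>
   ((\<forall>ap bp am bm. (\<exists>h\<in>{0<..<1}. M2 ap bp am bm h \<noteq> 0) \<longrightarrow>
         zeros_with_multiplicity (M2 ap bp am bm) {0<..<1} \<le> 6) \<and>
      (\<exists>ap bp am bm. zeros_with_multiplicity (M2 ap bp am bm) {0<..<1} = 6))"
proof (intro conjI ballI)
  fix L :: "real set" assume "L \<in> {{..< -1}, {0<..}}"
  then have "L = {..< -1} \<or> L = {0<..}" by simp
  then have "(\<forall>ap bp am bm. (\<exists>h\<in>L. M1 ap bp am bm h \<noteq> 0) \<longrightarrow> zeros_with_multiplicity (M1 ap bp am bm) L \<le> 5) \<and>
      (\<exists>ap bp am bm. zeros_with_multiplicity (M1 ap bp am bm) L = 5)"
    using M1_bound_pos[unfolded split_paired_All split_paired_Ex prod.case]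
      M1_bound_neg[unfolded split_paired_All split_paired_Ex prod.case] by (elim disjE; hypsubst) assumption+
  then show "\<forall>ap bp am bm. (\<exists>h\<in>L. M1 ap bp am bm h \<noteq> 0) \<longrightarrow> zeros_with_multiplicity (M1 ap bp am bm) L \<le> 5"
    "\<exists>ap bp am bm. zeros_with_multiplicity (M1 ap bp am bm) L = 5"
    by (rule conjunct1, rule conjunct2)
next
  note b = M2_bound[unfolded split_paired_All split_paired_Ex prod.case]
  show "\<forall>ap bp am bm. (\<exists>h\<in>{0<..<1}. M2 ap bp am bm h \<noteq> 0) \<longrightarrow>
      zeros_with_multiplicity (M2 ap bp am bm) {0<..<1} \<le> 6"
    "\<exists>ap bp am bm. zeros_with_multiplicity (M2 ap bp am bm) {0<..<1} = 6"
    by (rule conjunct1[OF b], rule conjunct2[OF b])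
qed

end
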